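(* For every composition $\alpha$, $$\mathfrak{L}^{(\beta)}_\alpha=\sum_{\substack{T\in \mathrm{RSVT}_{\alpha^+}\\ K_-(L(T))\le \alpha}}\beta^{\mathrm{ex}(T)}\,x^{\mathrm{wt}(T)} .$$
   Context: A composition is a sequence $\alpha=(\alpha_1,\alpha_2,\dots)$ of nonnegative integers, almost all zero; $\alpha^+$ is the partition obtained by sorting it; $s_i\alpha$ swaps $\alpha_i,\alpha_{i+1}$; $x^\alpha=\prod_i x_i^{\alpha_i}$. Lascoux polynomials. On $R=\mathbb{Z}[\beta][x_1,x_2,\dots]$ let $s_i$ swap $x_i,x_{i+1}$, $\partial_i(f)=(f-s_i f)/(x_i-x_{i+1})$ and $\pi^{(\beta)}_i(f)=\partial_i\big((1+\beta x_{i+1})x_i f\big)$; these satisfy the braid relations. Define $\mathfrak{L}^{(\beta)}_\alpha=x^\alpha$ if $\alpha$ is a partition and $\mathfrak{L}^{(\beta)}_\alpha=\pi^{(\beta)}_i(\mathfrak{L}^{(\beta)}_{s_i\alpha})$ if $\alpha_i<\alpha_{i+1}$. Tableaux. Partition shapes are drawn in English notation. A reverse semistandard Young tableau (RSSYT) is a filling by positive integers weakly decreasing along rows from left to right and strictly decreasing down columns. A reverse set-valued tableau (RSVT) of shape $\lambda$ fills each box $s$ of $\lambda$ with a nonempty finite set $T(s)\subset\mathbb{Z}_{>0}$ such that $\min T(s)\ge\max T(t)$ if $t$ is immediately right of $s$, and $\min T(s)>\max T(t)$ if $t$ is immediately below $s$. $\mathrm{RSVT}_\lambda$ is the set of these.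 $\mathrm{wt}(T)$ is the composition whose $i$-th part is the number of occurrences of $i$ in $T$; $\mathrm{ex}(T)=|\mathrm{wt}(T)|-|\lambda|$ where $|\cdot|$ is the sum of parts. $L(T)$ is the RSSYT obtained by replacing each set $T(s)$ by $\max T(s)$. Left key of an RSSYT. Columns are identified with their sets of entries. If $C_1C_2$ are two adjacent columns of an RSSYT and $C_2=\{a_1<\dots<a_m\}$, let $b_1$ be the smallest element of $C_1$ with $b_1\ge a_1$, and recursively let $b_j$ be the smallest element of $C_1$ with $b_j\ge a_j$ and $b_j>b_{j-1}$; put $C_1\triangleleft C_2=\{b_1<\dots<b_m\}$. For columns $C_1,\dots,C_k$ of an RSSYT put $C_1\triangleleft\cdots\triangleleft C_k=C_1\triangleleft(C_2\triangleleft\cdots\triangleleft C_k)$. If $T$ is an RSSYT with columns $C_1,C_2,\dots$, the left key $K_-(T)$ is the tableau whose $k$-th column is $C_1\triangleleft\cdots\triangleleft C_k$. It is a key tableau (each column, as a set, contains the next), and is identified with the composition $\mathrm{wt}(K_-(T))$. Order. For a composition $\alpha$, $\mathrm{key}(\alpha)$ is the key tableau whose $j$-th column is $\{i:\alpha_i\ge j\}$. For compositions, $\alpha\le\gamma$ means $\alpha^+=\gamma^+$ and, for every $j$ and $r$, the $r$-th smallest element of column $j$ of $\mathrm{key}(\alpha)$ is at most the $r$-th smallest element of column $j$ of $\mathrm{key}(\gamma)$. *)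

theory Defs
  imports
    "HOL-Library.Poly_Mapping"
    "HOL-Computational_Algebra.Polynomial"
    "HOL-Combinatorics.Transposition"
begin

section \<open>Compositions\<close>

text \<open>
  A composition is a finitely supported function on the indices 1, 2, ...; the unused index 0
  is required to carry the value 0. The order that the library puts on the type of finitely
  supported functions is not the order on compositions used here.
\<close>

type_synonym composition = "nat \<Rightarrow>\<^sub>0 nat"

abbreviation part :: "composition \<Rightarrow> nat \<Rightarrow> nat" where
  "part \<equiv> Poly_Mapping.lookup"

definition is_composition :: "composition \<Rightarrow> bool" where
  "is_composition \<alpha> \<longleftrightarrow> part \<alpha> 0 = 0"

definition is_partition :: "composition \<Rightarrow> bool" where
  "is_partition \<alpha> \<longleftrightarrow> is_composition \<alpha> \<and> (\<forall>i\<ge>1. part \<alpha> i \<ge> part \<alpha> (Suc i))"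

definition csize :: "composition \<Rightarrow> nat" where
  "csize \<alpha> = (\<Sum>i\<in>Poly_Mapping.keys \<alpha>. part \<alpha> i)"

text \<open>The leading 0 in the list is the unused entry at index 0.\<close>

definition sort_comp :: "composition \<Rightarrow> composition" where
  "sort_comp \<alpha> =
     Poly_Mapping.nth (0 # rev (sort (map (part \<alpha>) (sorted_list_of_set (Poly_Mapping.keys \<alpha>)))))"

definition swap_comp :: "nat \<Rightarrow> composition \<Rightarrow> composition" where
  "swap_comp i \<alpha> = Poly_Mapping.map_key (Transposition.transpose i (Suc i)) \<alpha>"


section \<open>Lascoux polynomials\<close>

text \<open>
  Multivariate polynomials over the univariate polynomial ring \<open>\<int>[\<beta>]\<close>: finitely supported
  coefficient functions on exponent vectors. The type also contains a variable with index 0,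
  which never occurs below.
\<close>

type_synonym mpoly_beta = "composition \<Rightarrow>\<^sub>0 int poly"

definition beta :: mpoly_beta where
  "beta = Poly_Mapping.single 0 [:0, 1:]"

definition X :: "nat \<Rightarrow> mpoly_beta" where
  "X i = Poly_Mapping.single (Poly_Mapping.single i 1) 1"

definition xpow :: "composition \<Rightarrow> mpoly_beta" where
  "xpow \<alpha> = (\<Prod>i\<in>Poly_Mapping.keys \<alpha>. X i ^ part \<alpha> i)"

text \<open>
  The coefficient of \<open>x\<^sup>\<gamma>\<close> in \<open>s\<^sub>i f\<close> is the coefficient of the monomial with
  exponent \<open>s\<^sub>i \<gamma>\<close> in \<open>f\<close>.
\<close>

definition swap_poly :: "nat \<Rightarrow> mpoly_beta \<Rightarrow> mpoly_beta" where
  "swap_poly i f = Poly_Mapping.map_key (swap_comp i) f"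

text \<open>The ring is an integral domain, so the quotient is unique.\<close>

definition divdiff :: "nat \<Rightarrow> mpoly_beta \<Rightarrow> mpoly_beta" where
  "divdiff i f = (THE g. (X i - X (Suc i)) * g = f - swap_poly i f)"

definition demazure_beta :: "nat \<Rightarrow> mpoly_beta \<Rightarrow> mpoly_beta" where
  "demazure_beta i f = divdiff i ((1 + beta * X (Suc i)) * X i * f)"

text \<open>
  The recursion for Lascoux polynomials may choose any ascent \<open>i\<close>; the result does not depend on
  the choices because the operators satisfy the braid relations. The relation collects
  the outcomes of all possible choices, and the Lascoux polynomial is the only outcome.
\<close>

inductive lascoux_rel :: "composition \<Rightarrow> mpoly_beta \<Rightarrow> bool" where
  partition: "is_partition \<alpha> \<Longrightarrow> lascoux_rel \<alpha> (xpow \<alpha>)"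
| ascent: "\<lbrakk>is_composition \<alpha>; i \<ge> 1; part \<alpha> i < part \<alpha> (Suc i); lascoux_rel (swap_comp i \<alpha>) f\<rbrakk>
    \<Longrightarrow> lascoux_rel \<alpha> (demazure_beta i f)"

definition lascoux :: "composition \<Rightarrow> mpoly_beta" where
  "lascoux \<alpha> = (THE f. lascoux_rel \<alpha> f)"


section \<open>Reverse set-valued tableaux\<close>

text \<open>
  Boxes are pairs (row, column), both counted from 1, in English notation. A set-valued filling
  is the empty set outside its shape, which makes it a canonical representative.
\<close>

definition boxes :: "composition \<Rightarrow> (nat \<times> nat) set" where
  "boxes \<mu> = {(r, c). r \<ge> 1 \<and> 1 \<le> c \<and> c \<le> part \<mu> r}"

definition RSVT :: "composition \<Rightarrow> (nat \<times> nat \<Rightarrow> nat set) set" where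
  "RSVT \<mu> = {T.
     (\<forall>s\<in>boxes \<mu>. finite (T s) \<and> T s \<noteq> {} \<and> (\<forall>i\<in>T s. i \<ge> 1)) \<and>
     (\<forall>s. s \<notin> boxes \<mu> \<longrightarrow> T s = {}) \<and>
     (\<forall>r c. (r, c) \<in> boxes \<mu> \<and> (r, Suc c) \<in> boxes \<mu> \<longrightarrow>
        Min (T (r, c)) \<ge> Max (T (r, Suc c))) \<and>
     (\<forall>r c. (r, c) \<in> boxes \<mu> \<and> (Suc r, c) \<in> boxes \<mu> \<longrightarrow>
        Min (T (r, c)) > Max (T (Suc r, c)))}"

text \<open>The support is finite for a tableau in \<open>RSVT \<mu>\<close>.\<close>

definition wt :: "(nat \<times> nat \<Rightarrow> nat set) \<Rightarrow> composition" where
  "wt T = Poly_Mapping.Abs_poly_mapping (\<lambda>i. card {s. i \<in> T s})"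

text \<open>
  The subtraction is exact for a tableau in \<open>RSVT \<mu>\<close>, where every box holds at least one entry.
\<close>

definition ex :: "composition \<Rightarrow> (nat \<times> nat \<Rightarrow> nat set) \<Rightarrow> nat" where
  "ex \<mu> T = csize (wt T) - csize \<mu>"

text \<open>Single-valued fillings have positive entries; the value 0 marks positions outside the shape.\<close>

definition leading :: "(nat \<times> nat \<Rightarrow> nat set) \<Rightarrow> nat \<times> nat \<Rightarrow> nat" where
  "leading T s = (if T s = {} then 0 else Max (T s))"


section \<open>Left keys\<close>

definition column :: "(nat \<times> nat \<Rightarrow> nat) \<Rightarrow> nat \<Rightarrow> nat set" where
  "column T c = {T (r, c) | r. T (r, c) \<noteq> 0}"

text \<open>
  \<open>pick C b as\<close> lists the successive choices for the increasing list \<open>as\<close>, where \<open>b\<close> is the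
  previous choice. The first call uses 0, which is no constraint since entries are positive. For
  columns arising from an RSSYT the elements chosen by \<open>LEAST\<close> always exist.
\<close>

primrec pick :: "nat set \<Rightarrow> nat \<Rightarrow> nat list \<Rightarrow> nat list" where
  "pick C b [] = []"
| "pick C b (a # as) = (let b' = (LEAST x. x \<in> C \<and> x \<ge> a \<and> x > b) in b' # pick C b' as)"

definition tri :: "nat set \<Rightarrow> nat set \<Rightarrow> nat set" (infixr \<open>\<lhd>\<^sub>k\<close> 65) where
  "C \<lhd>\<^sub>k D = set (pick C 0 (sorted_list_of_set D))"

text \<open>
  Column \<open>k \<ge> 1\<close> of the left key of a tableau \<open>T\<close> with columns \<open>C\<^sub>1, C\<^sub>2, \<dots>\<close> is
  \<open>C\<^sub>1 \<lhd>\<^sub>k (C\<^sub>2 \<lhd>\<^sub>k (\<dots> \<lhd>\<^sub>k C\<^sub>k))\<close>. It is empty for \<open>k = 0\<close> and for \<open>k\<close> beyond the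
  last column, where \<open>C\<^sub>k\<close> is empty.
\<close>

definition left_key :: "(nat \<times> nat \<Rightarrow> nat) \<Rightarrow> nat \<Rightarrow> nat set" where
  "left_key T k = foldr (\<lhd>\<^sub>k) (map (column T) [1..<k]) (column T k)"

text \<open>The weight of a tableau given by its columns, whose entries are distinct within a column.\<close>

definition col_wt :: "(nat \<Rightarrow> nat set) \<Rightarrow> composition" where
  "col_wt K = Poly_Mapping.Abs_poly_mapping (\<lambda>i. card {k. i \<in> K k})"

definition left_key_comp :: "(nat \<times> nat \<Rightarrow> nat) \<Rightarrow> composition" where
  "left_key_comp T = col_wt (left_key T)"


section \<open>The order on compositions\<close>

definition key_col :: "composition \<Rightarrow> nat \<Rightarrow> nat set" where
  "key_col \<alpha> j = {i. part \<alpha> i \<ge> j}"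

text \<open>
  If \<open>sort_comp \<alpha> = sort_comp \<gamma>\<close>, then the \<open>j\<close>-th columns of the two key tableaux have equally many
  elements for \<open>j \<ge> 1\<close>. The index \<open>r\<close> counts from 0.
\<close>

definition comp_le :: "composition \<Rightarrow> composition \<Rightarrow> bool" (infix \<open>\<le>\<^sub>k\<close> 50) where
  "\<alpha> \<le>\<^sub>k \<gamma> \<longleftrightarrow> sort_comp \<alpha> = sort_comp \<gamma> \<and>
     (\<forall>j\<ge>1. \<forall>r < card (key_col \<alpha> j).
        sorted_list_of_set (key_col \<alpha> j) ! r \<le> sorted_list_of_set (key_col \<gamma> j) ! r)"

end

theory Submission
  imports Defs
begin

text \<open>
  For fixed leading entries, the extra entries of a set-valued tableau are chosen independently of
  each other, and the letter \<open>j\<close> contributes a factor \<open>1 + \<beta> x\<^sub>j\<close> for each column that admits it as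
  an extra entry. Adding the letters to the leading tableau from the largest to the smallest changes
  the left key in a simple way: parking is independent of the order of the cars, so a new letter in
  column \<open>k\<close> adds to column \<open>k\<close> of the key the least label that the updated column \<open>k - 1\<close> has and the
  old column \<open>k\<close> lacks. Hence the sum of the weights is the partition function of a coloured
  five-vertex model with one row per letter, whose state records the rows of the key by their length.

  Let \<open>\<phi>\<close> and \<open>\<psi>\<close> be the indicators of the states \<open>\<le> s\<^sub>i \<alpha>\<close> and \<open>\<le> \<alpha>\<close>, where \<open>\<alpha>\<^sub>i < \<alpha>\<^sub>i\<^sub>+\<^sub>1\<close>. Then \<open>\<psi>\<close>
  does not change when the labels \<open>i\<close> and \<open>i + 1\<close> are exchanged, and \<open>\<phi> = \<psi>\<close> on the states in which
  row \<open>i\<close> is at least as long as row \<open>i + 1\<close>. The rows of the model for the letters below \<open>i\<close>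
  preserve this relation, the pair of rows \<open>i + 1, i\<close> turns it, by a Yang--Baxter type symmetry in
  \<open>x\<^sub>i\<close> and \<open>x\<^sub>i\<^sub>+\<^sub>1\<close>, into \<open>\<psi>\<close>-sum \<open>= \<pi>\<^sub>i\<close> (\<open>\<phi>\<close>-sum), and the rows above \<open>i + 1\<close> respect the operator \<open>\<pi>\<^sub>i\<close>. So
  every outcome of the recursion for Lascoux polynomials equals the tableau sum, and the braid
  relations are not needed.
\<close>

section \<open>Row transfer\<close>

text \<open>The bound by \<open>\<alpha>\<close> depends on which labels form the columns of the
  key, so the labels are kept as colours. Letters have to arrive from the largest down, whereas the
  rule for \<open>C \<lhd>\<^sub>k D\<close> chooses from the smallest entry up, and a new smallest
  entry would shift all later choices. Parking removes this obstacle: the new entry may park last.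
  Extra entries become local as well, since whether a column admits the new letter is visible at a
  single site. Rows act on test functions and not on states. This absorbs all rows below letter
  \<open>i\<close> into \<open>\<phi>\<close> and \<open>\<psi>\<close> and lets the relation given
  by \<open>\<pi>\<^sub>i\<close> pass upwards one row at a time. For test functions fixed by the
  exchange of the two variables, a pair of rows has a symmetric sum if no carrier enters, or if two
  enter with the smaller label first. The letters \<open>i + 1\<close> and \<open>i\<close> enter in
  the opposite order, where only weaker symmetries survive, and the defect is what
  \<open>\<pi>\<^sub>i\<close> describes.\<close>

text \<open>
  A state is a list of disjoint sets: the labels at position \<open>l\<close> are the rows of the key that have
  length \<open>l\<close>. A row of the model moves a carrier (the set \<open>c\<close> of at most one label) from left to
  right; each site either absorbs the carrier or emits its least label as the new carrier. The
  sum over all outcomes is taken against a test function \<open>\<phi>\<close> on states.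
\<close>

fun row :: "'r::comm_ring_1 \<Rightarrow> 'r \<Rightarrow> nat set \<Rightarrow> nat set list \<Rightarrow> (nat set list \<Rightarrow> 'r) \<Rightarrow> 'r" where
  "row t x c [] \<phi> = (if c = {} then \<phi> [] else 0)"
| "row t x c (A # As) \<phi> =
     (if c = {} \<and> A \<noteq> {} then 1 + t * x else 1) *
     (row t x {} As (\<lambda>Gs. \<phi> ((A \<union> c) # Gs)) +
      (if A \<union> c = {} then 0
       else x * row t x {Min (A \<union> c)} As (\<lambda>Gs. \<phi> ((A \<union> c - {Min (A \<union> c)}) # Gs))))"

lemma row_add: "row t x c As (\<lambda>Gs. \<phi> Gs + \<psi> Gs) = row t x c As \<phi> + row t x c As \<psi>"
proof (induction As arbitrary: c \<phi> \<psi>)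
  case (Cons A As)
  show ?case by (simp add: Cons.IH distrib_left)
qed simp

lemma row_scale: "row t x c As (\<lambda>Gs. k * \<phi> Gs) = k * row t x c As \<phi>"
proof (induction As arbitrary: c \<phi>)
  case (Cons A As)
  show ?case by (simp add: Cons.IH algebra_simps)
qed simp

text \<open>A site has two outcomes, absorption and emission, and its weight depends only on
  emptiness. Comparisons of two rows are therefore reduced, site by site, to the two
  continuations.\<close>

lemma row_Cons_eqI:
  assumes "c = {} \<longleftrightarrow> c' = {}" "A = {} \<longleftrightarrow> A' = {}"
    and "row t x {} As (\<lambda>Gs. \<phi> ((A \<union> c) # Gs)) = row t x {} As' (\<lambda>Gs. \<psi> ((A' \<union> c') # Gs))"
    and "A \<union> c \<noteq> {} \<Longrightarrow> row t x {Min (A \<union> c)} As (\<lambda>Gs. \<phi> ((A \<union> c - {Min (A \<union> c)}) # Gs)) =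
      row t x {Min (A' \<union> c')} As' (\<lambda>Gs. \<psi> ((A' \<union> c' - {Min (A' \<union> c')}) # Gs))"
  shows "row t x c (A # As) \<phi> = row t x c' (A' # As') \<psi>"
proof -
  have "A \<union> c = {} \<longleftrightarrow> A' \<union> c' = {}" using assms by blast
  then have E: "(if A \<union> c = {} then 0 else x * u) = (if A' \<union> c' = {} then 0 else x * v)"
    if "A \<union> c \<noteq> {} \<Longrightarrow> u = v" for u v
    using that by auto
  have q: "(if c = {} \<and> A \<noteq> {} then 1 + t * x else 1) = (if c' = {} \<and> A' \<noteq> {} then 1 + t * x else 1)"
    using assms(1,2) by auto
  show ?thesis unfolding row.simps assms(3) q by (subst E[OF assms(4)]) (assumption, rule refl)
qed

text \<open>\<open>L\<close> is the set of labels present; the list is an ordered set partition of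
  \<open>L\<close> whose blocks may be empty.\<close>

primrec proper :: "nat set \<Rightarrow> nat set list \<Rightarrow> bool" where
  "proper L [] \<longleftrightarrow> L = {}"
| "proper L (G # Gs) \<longleftrightarrow> G \<subseteq> L \<and> proper (L - G) Gs"

lemma proper_Union: "proper L Gs \<Longrightarrow> \<Union>(set Gs) = L"
  by (induction Gs arbitrary: L) fastforce+

text \<open>A row only redistributes the labels of the state and the carrier, so a test function
  matters only on states with exactly these labels.\<close>

lemma row_cong:
  assumes "finite L" "proper L As" "finite c" "c \<inter> L = {}"
    and "\<And>Gs. proper (L \<union> c) Gs \<Longrightarrow> length Gs = length As \<Longrightarrow> \<phi> Gs = \<psi> Gs"
  shows "row t x c As \<phi> = row t x c As \<psi>"
  using assms
proof (induction As arbitrary: L c \<phi> \<psi>)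
  case Nil
  then show ?case by simp
next
  case (Cons A As)
  let ?m = "Min (A \<union> c)"
  have fin: "finite (A \<union> c)" using Cons.prems by (auto intro: finite_subset)
  have 1: "row t x {} As (\<lambda>Gs. \<phi> ((A \<union> c) # Gs)) = row t x {} As (\<lambda>Gs. \<psi> ((A \<union> c) # Gs))"
  proof (rule Cons.IH[where L = "L - A"])
    fix Gs assume "proper (L - A \<union> {}) Gs" "length Gs = length As"
    moreover have "L \<union> c - (A \<union> c) = L - A" using Cons.prems by auto
    ultimately show "\<phi> ((A \<union> c) # Gs) = \<psi> ((A \<union> c) # Gs)"
      using Cons.prems by (intro Cons.prems) auto
  qed (use Cons.prems in auto)
  have 2: "row t x {?m} As (\<lambda>Gs. \<phi> ((A \<union> c - {?m}) # Gs)) =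
      row t x {?m} As (\<lambda>Gs. \<psi> ((A \<union> c - {?m}) # Gs))" if "A \<union> c \<noteq> {}"
  proof -
    have m: "?m \<in> A \<union> c" using fin that by (rule Min_in)
    show ?thesis
    proof (rule Cons.IH[where L = "L - A"])
      fix Gs assume "proper (L - A \<union> {?m}) Gs" "length Gs = length As"
      moreover have "L \<union> c - (A \<union> c - {?m}) = L - A \<union> {?m}"
        using Cons.prems m by auto
      ultimately show "\<phi> ((A \<union> c - {?m}) # Gs) = \<psi> ((A \<union> c - {?m}) # Gs)"
        using Cons.prems by (intro Cons.prems) auto
    qed (use Cons.prems m in auto)
  qed
  show ?case by (rule row_Cons_eqI[OF refl refl 1 2])
qed

section \<open>Two consecutive rows, expanded one site at a time\<close>

definition row2 :: "'r::comm_ring_1 \<Rightarrow> 'r \<Rightarrow> 'r \<Rightarrow> nat set \<Rightarrow> nat set \<Rightarrow> nat set list \<Rightarrow>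
    (nat set list \<Rightarrow> 'r) \<Rightarrow> 'r" where
  "row2 t x y c1 c2 As \<phi> = row t y c1 As (\<lambda>Bs. row t x c2 Bs \<phi>)"

lemma row2_Nil: "row2 t x y c1 c2 [] \<phi> = (if c1 = {} \<and> c2 = {} then \<phi> [] else 0)"
  by (simp add: row2_def)

text \<open>At the current site the second row sees only the set \<open>B\<close> that the first row
  leaves there, so both rows can be moved past the site together.\<close>

lemma row2_step:
  "row t y c1 As (\<lambda>Bs. row t x c2 (B # Bs) \<phi>) =
     (if c2 = {} \<and> B \<noteq> {} then 1 + t * x else 1) *
     (row2 t x y c1 {} As (\<lambda>Gs. \<phi> ((B \<union> c2) # Gs)) +
      (if B \<union> c2 = {} then 0
       else x * row2 t x y c1 {Min (B \<union> c2)} As (\<lambda>Gs. \<phi> ((B \<union> c2 - {Min (B \<union> c2)}) # Gs))))"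
proof (cases "B \<union> c2 = {}")
  case False
  then have "row t x c2 (B # Bs) \<phi> = (if c2 = {} \<and> B \<noteq> {} then 1 + t * x else 1) *
     (row t x {} Bs (\<lambda>Gs. \<phi> ((B \<union> c2) # Gs)) +
      x * row t x {Min (B \<union> c2)} Bs (\<lambda>Gs. \<phi> ((B \<union> c2 - {Min (B \<union> c2)}) # Gs)))" for Bs
    by auto
  then show ?thesis using False by (simp only: row2_def row_scale row_add if_False)
qed (simp add: row2_def)

lemma row2_Cons:
  "row2 t x y c1 c2 (A # As) \<phi> =
     (if c1 = {} \<and> A \<noteq> {} then 1 + t * y else 1) *
     (row t y {} As (\<lambda>Bs. row t x c2 ((A \<union> c1) # Bs) \<phi>) +
      (if A \<union> c1 = {} then 0
       else y * row t y {Min (A \<union> c1)} As (\<lambda>Bs. row t x c2 ((A \<union> c1 - {Min (A \<union> c1)}) # Bs) \<phi>)))"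
  by (simp only: row2_def row.simps)

lemma row2_empty:
  "row2 t x y {} {} ({} # As) \<phi> = row2 t x y {} {} As (\<lambda>Gs. \<phi> ({} # Gs))"
  by (simp add: row2_Cons row2_step del: row.simps)

text \<open>This and the next four lemmas tabulate the local weights of a site crossed by two rows.
  They are sorted by the number of incoming carriers and by whether an incoming label is smaller
  than everything at the site.\<close>

lemma row2_none:
  assumes "finite A" "A \<noteq> {}" and m: "m = Min A" and m': "A - {m} \<noteq> {} \<Longrightarrow> m' = Min (A - {m})"
  shows "row2 t x y {} {} (A # As) \<phi> =
    (1 + t * y) * ((1 + t * x) * (row2 t x y {} {} As (\<lambda>Gs. \<phi> (A # Gs)) +
        x * row2 t x y {} {m} As (\<lambda>Gs. \<phi> ((A - {m}) # Gs))) +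
      y * ((if A - {m} = {} then 1 else 1 + t * x) * (row2 t x y {m} {} As (\<lambda>Gs. \<phi> ((A - {m}) # Gs)) +
        (if A - {m} = {} then 0
         else x * row2 t x y {m} {m'} As (\<lambda>Gs. \<phi> ((A - {m} - {m'}) # Gs))))))"
  using assms by (cases "A - {m} = {}") (simp_all add: row2_Cons row2_step del: row.simps Diff_eq_empty_iff)

lemma row2_one_small:
  assumes "finite A" and w: "Min (A \<union> {w}) = w" "w \<notin> A" and m: "A \<noteq> {} \<Longrightarrow> m = Min A"
  shows "row2 t x y {w} {} (A # As) \<phi> =
    (1 + t * x) * (row2 t x y {} {} As (\<lambda>Gs. \<phi> ((A \<union> {w}) # Gs)) +
        x * row2 t x y {} {w} As (\<lambda>Gs. \<phi> (A # Gs))) +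
      y * ((if A = {} then 1 else 1 + t * x) * (row2 t x y {w} {} As (\<lambda>Gs. \<phi> (A # Gs)) +
        (if A = {} then 0
         else x * row2 t x y {w} {m} As (\<lambda>Gs. \<phi> ((A - {m}) # Gs)))))" (is ?A)
    and "row2 t x y {} {w} (A # As) \<phi> =
    (if A = {} then 1 else 1 + t * y) * (row2 t x y {} {} As (\<lambda>Gs. \<phi> ((A \<union> {w}) # Gs)) +
        x * row2 t x y {} {w} As (\<lambda>Gs. \<phi> (A # Gs)) +
      (if A = {} then 0
       else y * (row2 t x y {m} {} As (\<lambda>Gs. \<phi> ((A \<union> {w} - {m}) # Gs)) +
          x * row2 t x y {m} {w} As (\<lambda>Gs. \<phi> ((A - {m}) # Gs)))))" (is ?B)
proof -
  have 1: "insert w A - {w} = A" using w by simp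
  show ?A
    using w m by (auto simp: row2_Cons row2_step 1 simp del: row.simps)
  have 2: "Min (insert w (A - {m})) = w" "insert w (A - {m}) - {w} = A - {m}" "insert w (A - {m}) = insert w A - {m}"
    if "A \<noteq> {}"
  proof -
    have le: "w \<le> v" if "v \<in> A" for v using assms(1) w(1) that
      by (metis Min_le Un_iff finite_Un finite.emptyI finite.insertI)
    then show "Min (insert w (A - {m})) = w" using assms(1) by (intro Min_eqI) auto
    show "insert w (A - {m}) - {w} = A - {m}" using w by auto
    show "insert w (A - {m}) = insert w A - {m}" using w m[OF that] Min_in[OF assms(1) that] by auto
  qed
  show ?B
  proof (cases "A = {}")
    case True then show ?thesis by (simp add: row2_Cons row2_step del: row.simps)
  next
    case False
    then have "w \<noteq> m" using w(2) m[OF False] Min_in[OF assms(1) False] by auto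
    moreover have "insert w A - {m} - {w} = A - {m}" using w by auto
    ultimately show ?thesis using w m[OF False] 2[OF False] False
      by (simp add: row2_Cons row2_step 1 del: row.simps)
  qed
qed

text \<open>A smaller label than \<open>w\<close> is already at the site, so both rows can emit the
  same labels whichever of them brings \<open>w\<close>. The two expansions differ only in which row
  pays the factor for an empty carrier.\<close>

lemma row2_one_large:
  assumes "finite A" "A \<noteq> {}" and m: "m = Min A" "m < w" "w \<notin> A" and m': "m' = Min (A \<union> {w} - {m})"
  shows "row2 t x y {w} {} (A # As) \<phi> =
    (1 + t * x) * (row2 t x y {} {} As (\<lambda>Gs. \<phi> ((A \<union> {w}) # Gs)) +
        x * row2 t x y {} {m} As (\<lambda>Gs. \<phi> ((A \<union> {w} - {m}) # Gs)) +
      y * (row2 t x y {m} {} As (\<lambda>Gs. \<phi> ((A \<union> {w} - {m}) # Gs)) +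
         x * row2 t x y {m} {m'} As (\<lambda>Gs. \<phi> ((A \<union> {w} - {m} - {m'}) # Gs))))" (is ?A)
    and "row2 t x y {} {w} (A # As) \<phi> =
    (1 + t * y) * (row2 t x y {} {} As (\<lambda>Gs. \<phi> ((A \<union> {w}) # Gs)) +
        x * row2 t x y {} {m} As (\<lambda>Gs. \<phi> ((A \<union> {w} - {m}) # Gs)) +
      y * (row2 t x y {m} {} As (\<lambda>Gs. \<phi> ((A \<union> {w} - {m}) # Gs)) +
         x * row2 t x y {m} {m'} As (\<lambda>Gs. \<phi> ((A \<union> {w} - {m} - {m'}) # Gs))))" (is ?B)
proof -
  have M: "Min (insert w A) = m" using assms by simp
  have 1: "insert w A - {m} \<noteq> {}" "insert w (A - {m}) = insert w A - {m}" using m by auto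
  show ?A
    using m' less_imp_neq[OF m(2)] by (simp add: row2_Cons row2_step M distrib_left del: row.simps)
  show ?B
    using m' assms(2) less_imp_neq[OF m(2)]
    by (simp add: row2_Cons row2_step M 1(2) del: row.simps flip: m(1))
qed

text \<open>Here the order of arrival matters: a smallest label \<open>v\<close> that enters with
  the first row can leave with the first row, but if it enters with the second row, the first row
  can only emit \<open>m'\<close>.\<close>

lemma row2_two_small:
  assumes "finite A" and v: "v < m'" "v \<noteq> w" "v \<notin> A" and m': "m' = Min (A \<union> {w})"
  shows "row2 t x y {v} {w} (A # As) \<phi> =
    row2 t x y {} {} As (\<lambda>Gs. \<phi> ((A \<union> {v, w}) # Gs)) +
        x * row2 t x y {} {v} As (\<lambda>Gs. \<phi> ((A \<union> {w}) # Gs)) +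
      y * (row2 t x y {v} {} As (\<lambda>Gs. \<phi> ((A \<union> {w}) # Gs)) +
         x * row2 t x y {v} {m'} As (\<lambda>Gs. \<phi> ((A \<union> {w} - {m'}) # Gs)))" (is ?A)
    and "row2 t x y {w} {v} (A # As) \<phi> =
    row2 t x y {} {} As (\<lambda>Gs. \<phi> ((A \<union> {v, w}) # Gs)) +
        x * row2 t x y {} {v} As (\<lambda>Gs. \<phi> ((A \<union> {w}) # Gs)) +
      y * (row2 t x y {m'} {} As (\<lambda>Gs. \<phi> ((A \<union> {v, w} - {m'}) # Gs)) +
         x * row2 t x y {m'} {v} As (\<lambda>Gs. \<phi> ((A \<union> {w} - {m'}) # Gs)))" (is ?B)
proof -
  have le: "v < u" if "u \<in> A \<union> {w}" for u
    using v(1) Min_le[OF _ that] assms(1) unfolding m' by (metis finite.emptyI finite_Un finite_insert order_less_le_trans)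
  have mi: "m' \<in> A \<union> {w}" unfolding m' using assms(1) by (intro Min_in) auto
  have M: "Min (insert v A) = v" "Min (insert w A) = m'" "Min (insert v (insert w A)) = v"
    "Min (insert w (insert v A)) = v"
    "Min (insert v (insert w A - {m'})) = v"
    using assms(1) less_imp_le[OF le] by (auto simp del: Min_insert simp: m' intro!: Min_eqI)
  have S: "insert v A - {v} = A" "insert w (insert v A) = insert v (insert w A)"
     "insert v (insert w A) - {v} = insert w A" "insert v (insert w A - {m'}) - {v} = insert w A - {m'}"
     "insert v (insert w A - {m'}) = insert v (insert w A) - {m'}"
    using v mi by auto
  show ?A
    by (simp add: row2_Cons row2_step M S(1-3) del: row.simps)
  show ?B
    using less_imp_neq[OF v(1)] S(4)[unfolded S(5)] M(5)[unfolded S(5)]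
    by (simp add: row2_Cons row2_step M(1-4) S(1-3) S(5) del: row.simps)
qed

text \<open>The right-hand side is symmetric in \<open>v\<close> and \<open>w\<close>: with a
  smaller label already at the site, the order of arrival is forgotten.\<close>

lemma row2_two_large:
  assumes "finite A" "A \<noteq> {}" and m: "m = Min A" "m < v" "m < w" and m': "m' = Min (A \<union> {v, w} - {m})"
  shows "row2 t x y {v} {w} (A # As) \<phi> =
    row2 t x y {} {} As (\<lambda>Gs. \<phi> ((A \<union> {v, w}) # Gs)) +
        x * row2 t x y {} {m} As (\<lambda>Gs. \<phi> ((A \<union> {v, w} - {m}) # Gs)) +
      y * (row2 t x y {m} {} As (\<lambda>Gs. \<phi> ((A \<union> {v, w} - {m}) # Gs)) +
         x * row2 t x y {m} {m'} As (\<lambda>Gs. \<phi> ((A \<union> {v, w} - {m} - {m'}) # Gs)))"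
proof -
  have M: "Min (insert v A) = m" "Min (insert w (insert v A)) = m" using assms by auto
  have S: "insert w (insert v A) = insert v (insert w A)"
    "insert w (insert v A - {m}) = insert v (insert w A) - {m}" using m by auto
  show ?thesis using m' M(2) less_imp_neq[OF m(2)] by (simp add: row2_Cons row2_step M(1) S(2) del: row.simps) (simp add: S(1))
qed

section \<open>Symmetry of a pair of rows under exchange of its two variables\<close>

locale swap_ring =
  fixes s :: "'r::idom \<Rightarrow> 'r" and t x y :: 'r
  assumes s_add [simp]: "s (p + q) = s p + s q"
    and s_mult [simp]: "s (p * q) = s p * s q"
    and s_one [simp]: "s 1 = 1"
    and s_x [simp]: "s x = y"
    and s_y [simp]: "s y = x"
    and s_t [simp]: "s t = t"
    and s_s [simp]: "s (s p) = p"
    and x_neq_y: "x \<noteq> y"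
begin

lemma s_zero [simp]: "s 0 = 0"
  using s_add[of 0 0] by (metis add_cancel_left_right)

text \<open>
  The three blocks are the cases of zero, one and two incoming carriers. The coefficients are the
  ones that make the conditions reproduce themselves from one site to the next.
\<close>

definition symmetric_row2 :: "nat set \<Rightarrow> nat set list \<Rightarrow> (nat set list \<Rightarrow> 'r) \<Rightarrow> bool" where
  "symmetric_row2 L As \<phi> \<longleftrightarrow>
     s (row2 t x y {} {} As \<phi>) = row2 t x y {} {} As \<phi> \<and>
     (\<forall>w. w \<notin> L \<longrightarrow>
        (1 + t * x) * s (row2 t x y {w} {} As \<phi>) = (1 + t * y) * row2 t x y {w} {} As \<phi> \<and>
        x * s (row2 t x y {w} {} As \<phi>) + y * s (row2 t x y {} {w} As \<phi>) = y * row2 t x y {w} {} As \<phi> + x * row2 t x y {} {w} As \<phi>) \<and>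
     (\<forall>v w. v \<notin> L \<longrightarrow> w \<notin> L \<longrightarrow> v < w \<longrightarrow>
        s (row2 t x y {v} {w} As \<phi>) = row2 t x y {v} {w} As \<phi> \<and>
        (1 + t * y) * x * s (row2 t x y {v} {w} As \<phi>) + (1 + t * x) * y * s (row2 t x y {w} {v} As \<phi>) =
        (1 + t * x) * y * row2 t x y {v} {w} As \<phi> + (1 + t * y) * x * row2 t x y {w} {v} As \<phi>)"

lemma symmetric_row2D:
  assumes "symmetric_row2 L As \<phi>"
  shows "s (row2 t x y {} {} As \<phi>) = row2 t x y {} {} As \<phi>"
    and "w \<notin> L \<Longrightarrow> (1 + t * x) * s (row2 t x y {w} {} As \<phi>) = (1 + t * y) * row2 t x y {w} {} As \<phi>"
    and "w \<notin> L \<Longrightarrow> x * s (row2 t x y {w} {} As \<phi>) + y * s (row2 t x y {} {w} As \<phi>) = y * row2 t x y {w} {} As \<phi> + x * row2 t x y {} {w} As \<phi>"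
    and "v \<notin> L \<Longrightarrow> w \<notin> L \<Longrightarrow> v < w \<Longrightarrow> s (row2 t x y {v} {w} As \<phi>) = row2 t x y {v} {w} As \<phi>"
    and "v \<notin> L \<Longrightarrow> w \<notin> L \<Longrightarrow> v < w \<Longrightarrow>
        (1 + t * y) * x * s (row2 t x y {v} {w} As \<phi>) + (1 + t * x) * y * s (row2 t x y {w} {v} As \<phi>) =
        (1 + t * x) * y * row2 t x y {v} {w} As \<phi> + (1 + t * y) * x * row2 t x y {w} {v} As \<phi>"
  using assms unfolding symmetric_row2_def by blast+

text \<open>Every condition says that \<open>s\<close> fixes some combination. With one carrier, and
  \<open>P\<close>, \<open>Q\<close> the sums where it enters in the first or second row, these are
  \<open>(1 + t * y) * P\<close> and \<open>y * P + x * Q\<close>. After the local expansion, each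
  condition for the longer state is an algebraic consequence of those for the tail. The set
  \<open>G\<close> left at the site is arbitrary because it is hidden in the test function.\<close>

lemma symmetric_row2_Cons:
  assumes "finite L" "A \<subseteq> L"
    and IH: "\<And>G. symmetric_row2 (L - A) As (\<lambda>Gs. \<phi> (G # Gs))"
  shows "symmetric_row2 L (A # As) \<phi>"
proof -
  let ?T = "row2 t x y"
  have fA: "finite A" using assms finite_subset by blast
  note D = symmetric_row2D[OF IH]
  have H0: "s (?T {} {} (A # As) \<phi>) = ?T {} {} (A # As) \<phi>"
  proof (cases "A = {}")
    case True
    then show ?thesis using D(1) by (simp add: row2_empty)
  next
    case False
    define m where "m = Min A"
    define m' where "m' = Min (A - {m})"
    have m: "m \<in> A" using fA False by (simp add: m_def)
    note E = row2_none[OF fA False m_def m'_def]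
    show ?thesis
    proof (cases "A - {m} = {}")
      case True
      \<comment> \<open>In these identities \<open>u\<close>, \<open>p\<close>, \<open>q\<close> are
        the tail sums in which no carrier leaves, one leaves in the first row, or one leaves in the
        second row; primes mark images under \<open>s\<close>. Below, \<open>r\<close> and
        \<open>z\<close> have two outgoing carriers in the two possible orders, and
        \<open>p2\<close> has the other label in the first row.\<close>
      have alg: "(1 + t * x) * ((1 + t * y) * (u + y * q') + x * p') =
          (1 + t * y) * ((1 + t * x) * (u + x * q) + y * p)"
        if "(1 + t * x) * p' = (1 + t * y) * p" "x * p' + y * q' = y * p + x * q" for u p q p' q' :: 'r
        using that by algebra
      show ?thesis using True D(1)[of A] alg[OF D(2,3)[of m "A - {m}"]] m
        unfolding E by simp
    next
      case False
      then have m': "m' \<in> A" "m < m'" using fA m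
        by (metis Diff_iff Min_in finite_Diff m'_def)
           (metis DiffD1 DiffD2 False Min_in Min_le fA finite_Diff insertI1 m'_def m_def nless_le)
      have alg: "(1 + t * x) * ((1 + t * y) * (u + y * q') + x * ((1 + t * y) * (p' + y * r))) =
          (1 + t * y) * ((1 + t * x) * (u + x * q) + y * ((1 + t * x) * (p + x * r)))"
        if "x * p' + y * q' = y * p + x * q" for u p q p' q' r :: 'r
        using that by algebra
      show ?thesis using False D(1)[of A] alg[OF D(3)[of m "A - {m}"]] m m'
         D(4)[of m m' "A - {m} - {m'}"] m
        unfolding E by (simp del: Diff_eq_empty_iff)
    qed
  qed
  have H1: "(1 + t * x) * s (?T {w} {} (A # As) \<phi>) = (1 + t * y) * ?T {w} {} (A # As) \<phi> \<and>
      x * s (?T {w} {} (A # As) \<phi>) + y * s (?T {} {w} (A # As) \<phi>) =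
      y * ?T {w} {} (A # As) \<phi> + x * ?T {} {w} (A # As) \<phi>" if "w \<notin> L" for w
  proof (cases "Min (A \<union> {w}) = w")
    case True
    define m where "m = Min A"
    have wA: "w \<notin> A" using that assms by auto
    note E = row2_one_small[OF fA True wA m_def]
    show ?thesis
    proof (cases "A = {}")
      case True
      have alg: "(1 + t * x) * ((1 + t * y) * (u + y * q') + x * p') = (1 + t * y) * ((1 + t * x) * (u + x * q) + y * p) \<and>
          x * ((1 + t * y) * (u + y * q') + x * p') + y * (u + y * q') =
          y * ((1 + t * x) * (u + x * q) + y * p) + x * (u + x * q)"
        if "(1 + t * x) * p' = (1 + t * y) * p" "x * p' + y * q' = y * p + x * q" for u p q p' q' :: 'r
        using that by (intro conjI) algebra+
      show ?thesis using True D(1)[of "{w}"] alg[OF D(2,3)[of w "{}"]] that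
        unfolding E by simp
    next
      case False
      then have m: "m \<in> A" by (simp add: fA m_def)
      then have "w < m" using True wA fA
        by (metis Min_le UnI1 finite.emptyI finite_Un finite_insert order_le_imp_less_or_eq)
      have alg: "(1 + t * x) * ((1 + t * y) * (u + y * q') + x * ((1 + t * y) * (p' + y * r))) =
           (1 + t * y) * ((1 + t * x) * (u + x * q) + y * ((1 + t * x) * (p + x * r))) \<and>
          x * ((1 + t * y) * (u + y * q') + x * ((1 + t * y) * (p' + y * r))) +
          y * ((1 + t * x) * (u + y * q' + x * (p2' + y * z'))) =
          y * ((1 + t * x) * (u + x * q) + y * ((1 + t * x) * (p + x * r))) +
          x * ((1 + t * y) * (u + x * q + y * (p2 + x * z)))"
        if "(1 + t * x) * p' = (1 + t * y) * p" "x * p' + y * q' = y * p + x * q"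
          "(1 + t * x) * p2' = (1 + t * y) * p2"
          "r' = r" "(1 + t * y) * x * r' + (1 + t * x) * y * z' = (1 + t * x) * y * r + (1 + t * y) * x * z"
        for u p q p' q' p2 p2' r r' z z' :: 'r
        using that by (intro conjI) algebra+
      show ?thesis using False \<open>w < m\<close> D(1)[of "A \<union> {w}"] D(4)[of w m "A - {m}"] that m
         alg[OF D(2,3)[of w A] D(2)[of m "A \<union> {w} - {m}"] D(4,5)[of w m "A - {m}"]]
        unfolding E by simp
    qed
  next
    case False
    define m where "m = Min A"
    define m' where "m' = Min (A \<union> {w} - {m})"
    have wA: "w \<notin> A" using that assms by auto
    have ne: "A \<noteq> {}" using False by auto
    have m: "m \<in> A" using ne fA by (simp add: m_def)
    have mw: "m < w"
    proof (rule ccontr)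
      assume "\<not> m < w"
      then have "w \<le> u" if "u \<in> A" for u using Min_le[OF fA that] by (simp add: m_def)
      then have "Min (A \<union> {w}) = w" using fA by (intro Min_eqI) auto
      then show False using False by simp
    qed
    have m': "m' \<in> A \<union> {w} - {m}" unfolding m'_def using fA mw by (intro Min_in) auto
    moreover have "m \<le> m'" using m' fA mw by (auto simp: m_def)
    ultimately have m'': "m < m'" "m' \<notin> L - A" using that by auto
    have alg: "(1 + t * x) * ((1 + t * y) * (u + y * q' + x * (p' + y * r))) =
         (1 + t * y) * ((1 + t * x) * (u + x * q + y * (p + x * r))) \<and>
        x * ((1 + t * y) * (u + y * q' + x * (p' + y * r))) + y * ((1 + t * x) * (u + y * q' + x * (p' + y * r))) =
        y * ((1 + t * x) * (u + x * q + y * (p + x * r))) + x * ((1 + t * y) * (u + x * q + y * (p + x * r)))"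
      if "x * p' + y * q' = y * p + x * q" for u p q p' q' r :: 'r
      using that by (intro conjI) algebra+
    show ?thesis using D(1)[of "A \<union> {w}"] alg[OF D(3)[of m "A \<union> {w} - {m}"]]
         D(4)[of m m' "A \<union> {w} - {m} - {m'}"] that m m''
      unfolding row2_one_large[OF fA ne m_def mw wA m'_def] by simp
  qed
  have H2: "s (?T {v} {w} (A # As) \<phi>) = ?T {v} {w} (A # As) \<phi> \<and>
        (1 + t * y) * x * s (?T {v} {w} (A # As) \<phi>) + (1 + t * x) * y * s (?T {w} {v} (A # As) \<phi>) =
        (1 + t * x) * y * ?T {v} {w} (A # As) \<phi> + (1 + t * y) * x * ?T {w} {v} (A # As) \<phi>"
    if vw: "v \<notin> L" "w \<notin> L" "v < w" for v w
  proof (cases "v < Min (A \<union> {w})")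
    case True
    define m' where "m' = Min (A \<union> {w})"
    have vm: "v < m'" using True m'_def by simp
    have v: "v \<noteq> w" "v \<notin> A" using vw assms by auto
    have m': "m' \<in> A \<union> {w}" unfolding m'_def using fA by (intro Min_in) auto
    then have "m' \<notin> L - A" using vw by auto
    moreover have alg: "u + y * q' + x * (p' + y * r) = u + x * q + y * (p + x * r) \<and>
         (1 + t * y) * x * (u + y * q' + x * (p' + y * r)) + (1 + t * x) * y * (u + y * q' + x * (p2' + y * z')) =
         (1 + t * x) * y * (u + x * q + y * (p + x * r)) + (1 + t * y) * x * (u + x * q + y * (p2 + x * z))"
      if "(1 + t * x) * p' = (1 + t * y) * p" "x * p' + y * q' = y * p + x * q"
        "(1 + t * x) * p2' = (1 + t * y) * p2"
        "r' = r" "(1 + t * y) * x * r' + (1 + t * x) * y * z' = (1 + t * x) * y * r + (1 + t * y) * x * z"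
      for u p q p' q' p2 p2' r r' z z' :: 'r
      using that by (intro conjI) algebra+
    ultimately show ?thesis using D(1)[of "A \<union> {v, w}"] D(4)[of v m' "A \<union> {w} - {m'}"] vw vm
         alg[OF D(2,3)[of v "A \<union> {w}"] D(2)[of m' "A \<union> {v,w} - {m'}"] D(4,5)[of v m' "A \<union> {w} - {m'}"]]
      unfolding row2_two_small[OF fA vm v m'_def] by simp
  next
    case False
    define m where "m = Min A"
    define m' where "m' = Min (A \<union> {v, w} - {m})"
    have ne: "A \<noteq> {}" using False vw by auto
    have m: "m \<in> A" using ne fA by (simp add: m_def)
    have mv: "m < v"
    proof -
      obtain u where "u \<in> A \<union> {w}" "u \<le> v"
        using False fA by (auto simp: Min_gr_iff not_less)
      then have "u \<in> A" using vw(3) by auto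
      then have "m \<le> v" using Min_le[OF fA] \<open>u \<le> v\<close> unfolding m_def by (meson order_trans)
      then show ?thesis using m vw(1) assms(2) by (metis order_le_imp_less_or_eq subsetD)
    qed
    then have mw: "m < w" using vw by simp
    have m': "m' \<in> A \<union> {v,w} - {m}" unfolding m'_def using fA mw by (intro Min_in) auto
    moreover have "m \<le> m'" using m' fA mw mv by (auto simp: m_def)
    ultimately have m'': "m < m'" "m' \<notin> L - A" using vw by auto
    have c: "m' = Min (A \<union> {w, v} - {m})" by (simp add: m'_def insert_commute)
    have alg: "u + y * q' + x * (p' + y * r) = u + x * q + y * (p + x * r) \<and>
         (1 + t * y) * x * (u + y * q' + x * (p' + y * r)) + (1 + t * x) * y * (u + y * q' + x * (p' + y * r)) =
         (1 + t * x) * y * (u + x * q + y * (p + x * r)) + (1 + t * y) * x * (u + x * q + y * (p + x * r))"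
      if "x * p' + y * q' = y * p + x * q" for u p q p' q' r :: 'r
      using that by (intro conjI) algebra+
    show ?thesis using D(1)[of "A \<union> {v, w}"] alg[OF D(3)[of m "A \<union> {v, w} - {m}"]]
         D(4)[of m m' "A \<union> {v, w} - {m} - {m'}"] m m''
      unfolding row2_two_large[OF fA ne m_def mv mw m'_def]
        row2_two_large[OF fA ne m_def mw mv c] insert_commute[of w v "{}"]
      by simp
  qed
  show ?thesis unfolding symmetric_row2_def using H0 H1 H2 by blast
qed

lemma symmetric_row2:
  assumes "finite L" "proper L As" "\<And>Gs. s (\<phi> Gs) = \<phi> Gs"
  shows "symmetric_row2 L As \<phi>"
  using assms
proof (induction As arbitrary: L \<phi>)
  case Nil
  then show ?case by (simp add: symmetric_row2_def row2_Nil)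
next
  case (Cons A As)
  then show ?case by (intro symmetric_row2_Cons Cons.IH) auto
qed

end

section \<open>Exchanging two adjacent labels\<close>

abbreviation swap_label :: "nat \<Rightarrow> nat \<Rightarrow> nat" where
  "swap_label i \<equiv> Transposition.transpose i (Suc i)"

abbreviation swap_state :: "nat \<Rightarrow> nat set list \<Rightarrow> nat set list" where
  "swap_state i \<equiv> map ((`) (swap_label i))"

lemma swap_label_image_id: "i \<in> B \<longleftrightarrow> Suc i \<in> B \<Longrightarrow> swap_label i ` B = B"
  by (rule transpose_image_eq)

text \<open>A transposition of neighbours preserves the order on any set that does not contain both
  of them.\<close>

lemma Min_swap_label:
  assumes "finite B" "B \<noteq> {}" "\<not> (i \<in> B \<and> Suc i \<in> B)"
  shows "Min (swap_label i ` B) = swap_label i (Min B)"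
proof (rule Min_eqI)
  have m: "Min B \<in> B" using assms by simp
  show "swap_label i (Min B) \<in> swap_label i ` B" using m by blast
  fix v assume "v \<in> swap_label i ` B"
  then obtain u where u: "u \<in> B" "v = swap_label i u" by blast
  have le: "Min B \<le> u" by (rule Min_le[OF assms(1) u(1)])
  have ne: "\<not> (Min B = i \<and> u = Suc i)" "\<not> (Min B = Suc i \<and> u = i)" using m u(1) assms(3) by metis+
  show "swap_label i (Min B) \<le> v"
    unfolding u(2) Transposition.transpose_def using le ne by (simp split: if_split) linarith?
qed (use assms(1) in simp)

text \<open>A row uses labels only through their order, and the relabelling is order preserving when
  at most one of \<open>i\<close>, \<open>i + 1\<close> occurs.\<close>

lemma row_swap_disjoint:
  assumes "finite (c \<union> \<Union>(set As))" "\<not> (i \<in> c \<union> \<Union>(set As) \<and> Suc i \<in> c \<union> \<Union>(set As))"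
  shows "row t x (swap_label i ` c) (swap_state i As) \<phi> = row t x c As (\<lambda>Gs. \<phi> (swap_state i Gs))"
  using assms
proof (induction As arbitrary: c \<phi>)
  case Nil
  then show ?case by simp
next
  case (Cons A As)
  let ?B = "A \<union> c"
  let ?m = "Min ?B"
  let ?s = "swap_label i"
  have un: "?s ` A \<union> ?s ` c = ?s ` ?B" by (rule image_Un[symmetric])
  have em: "?s ` c = {} \<longleftrightarrow> c = {}" "?s ` A = {} \<longleftrightarrow> A = {}" "?s ` ?B = {} \<longleftrightarrow> A \<union> c = {}" by auto
  have 1: "row t x {} (swap_state i As) (\<lambda>Gs. \<phi> (?s ` ?B # Gs)) =
      row t x {} As (\<lambda>Gs. \<phi> (swap_state i (?B # Gs)))"
  proof -
    have "finite ({} \<union> \<Union>(set As))" "\<not> (i \<in> {} \<union> \<Union>(set As) \<and> Suc i \<in> {} \<union> \<Union>(set As))"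
      using Cons.prems by auto
    from Cons.IH[OF this, of "\<lambda>Gs. \<phi> (?s ` ?B # Gs)"] show ?thesis
      by (simp only: image_empty list.map)
  qed
  have 2: "row t x {Min (?s ` ?B)} (swap_state i As)
        (\<lambda>Gs. \<phi> ((?s ` ?B - {Min (?s ` ?B)}) # Gs)) =
      row t x {?m} As (\<lambda>Gs. \<phi> (swap_state i ((A \<union> c - {?m}) # Gs)))" if "A \<union> c \<noteq> {}"
  proof -
    have fin: "finite ?B" using Cons.prems by auto
    have m: "?m \<in> A \<union> c" using fin that by (rule Min_in)
    have M: "Min (?s ` ?B) = ?s ?m"
      using fin that Cons.prems by (intro Min_swap_label) auto
    have D: "?s ` ?B - {?s ?m} = ?s ` (A \<union> c - {?m})"
      by (simp only: image_set_diff[OF inj_transpose] image_insert image_empty)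
    have "finite ({?m} \<union> \<Union>(set As))"
      "\<not> (i \<in> {?m} \<union> \<Union>(set As) \<and> Suc i \<in> {?m} \<union> \<Union>(set As))"
      using Cons.prems m by auto
    from Cons.IH[OF this, of "\<lambda>Gs. \<phi> (?s ` (A \<union> c - {?m}) # Gs)"] show ?thesis
      unfolding M D by (simp only: image_insert image_empty list.map)
  qed
  show ?case unfolding list.map
    by (rule row_Cons_eqI) (use em 1 2 in \<open>simp_all add: un del: row.simps image_Un\<close>)
qed

text \<open>Relabelling need not commute with a row once both labels meet at a site. But such a site
  is its own relabelling, and the rest of the state then contains neither label. While both labels
  are still ahead, the set left behind contains neither and is fixed; once at most one is ahead,
  relabelling commutes with the rest of the row and the invariance of \<open>\<psi>\<close>
  applies.\<close>

lemma row_swap_invariant: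
  assumes "finite L" "proper L As" "finite c" "c \<inter> L = {}"
    and "\<And>Gs. proper (L \<union> c) Gs \<Longrightarrow> \<psi> (swap_state i Gs) = \<psi> Gs"
  shows "row t x (swap_label i ` c) (swap_state i As) \<psi> = row t x c As \<psi>"
  using assms
proof (induction As arbitrary: L c \<psi>)
  case Nil
  then show ?case by simp
next
  case (Cons A As)
  let ?m = "Min (A \<union> c)"
  let ?s = "swap_label i"
  have A: "A \<subseteq> L" "proper (L - A) As" "finite (L - A)" "finite (A \<union> c)" "finite A"
    using Cons.prems by (auto intro: finite_subset)
  have un: "?s ` A \<union> ?s ` c = ?s ` (A \<union> c)" by (rule image_Un[symmetric])
  have em: "?s ` c = {} \<longleftrightarrow> c = {}" "?s ` A = {} \<longleftrightarrow> A = {}" "?s ` (A \<union> c) = {} \<longleftrightarrow> A \<union> c = {}" by auto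
  \<comment> \<open>\<open>H\<close> is what stays at the site and \<open>d\<close> is the outgoing
    carrier, so both outcomes of the site are covered at once.\<close>
  have tail: "row t x (?s ` d) (swap_state i As) (\<lambda>Gs. \<psi> (?s ` H # Gs)) = row t x d As (\<lambda>Gs. \<psi> (H # Gs))"
    if d: "d \<union> H = A \<union> c" "d \<inter> H = {}" for d H
  proof -
    have fin: "finite d" using d(1) A(4) by (metis finite_Un)
    have dL: "d \<inter> (L - A) = {}" using d Cons.prems by auto
    have L: "L \<union> c - H = L - A \<union> d" "H \<subseteq> L \<union> c" using d Cons.prems by auto
    have inv: "\<psi> (?s ` H # swap_state i Gs) = \<psi> (H # Gs)" if "proper (L - A \<union> d) Gs" for Gs
      using Cons.prems(5)[of "H # Gs"] L that by simp
    show ?thesis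
    proof (cases "i \<in> d \<union> (L - A) \<and> Suc i \<in> d \<union> (L - A)")
      case False
      have "row t x (?s ` d) (swap_state i As) (\<lambda>Gs. \<psi> (?s ` H # Gs)) =
          row t x d As (\<lambda>Gs. \<psi> (?s ` H # swap_state i Gs))"
        using False proper_Union[OF A(2)] A(3) fin by (intro row_swap_disjoint) auto
      also have "\<dots> = row t x d As (\<lambda>Gs. \<psi> (H # Gs))"
        using inv by (intro row_cong[OF A(3) A(2) fin dL]) auto
      finally show ?thesis .
    next
      case True
      then have "i \<notin> H" "Suc i \<notin> H" using d Cons.prems(4) A(1) by auto
      then have H: "?s ` H = H" by (intro swap_label_image_id) simp
      show ?thesis unfolding H
        using inv unfolding H by (intro Cons.IH[OF A(3) A(2) fin dL]) simp
    qed
  qed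
  show ?case
  proof (cases "i \<in> A \<union> c \<and> Suc i \<in> A \<union> c")
    case True
    then have 1: "?s ` (A \<union> c) = A \<union> c" by (intro swap_label_image_id) simp
    have "swap_state i As = As"
    proof (rule map_idI)
      fix B assume "B \<in> set As"
      then have "B \<subseteq> L - A" using proper_Union[OF A(2)] by auto
      then have "i \<notin> B" "Suc i \<notin> B" using True Cons.prems(4) by auto
      then show "?s ` B = B" by (intro swap_label_image_id) simp
    qed
    then show ?thesis unfolding list.map row.simps un em 1 by simp
  next
    case False
    have 2: "row t x {Min (?s ` (A \<union> c))} (swap_state i As)
        (\<lambda>Gs. \<psi> ((?s ` (A \<union> c) - {Min (?s ` (A \<union> c))}) # Gs)) =
      row t x {?m} As (\<lambda>Gs. \<psi> ((A \<union> c - {?m}) # Gs))" if "A \<union> c \<noteq> {}"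
    proof -
      have m: "?m \<in> A \<union> c" using A(4) that by (rule Min_in)
      have M: "Min (?s ` (A \<union> c)) = ?s ?m"
        using A(4) that False by (intro Min_swap_label) auto
      have D: "?s ` (A \<union> c) - {?s ?m} = ?s ` (A \<union> c - {?m})"
        by (simp only: image_set_diff[OF inj_transpose] image_insert image_empty)
      have "{?m} \<union> (A \<union> c - {?m}) = A \<union> c"
        "{?m} \<inter> (A \<union> c - {?m}) = {}" using m by auto
      from tail[OF this] show ?thesis unfolding M D by (simp only: image_insert image_empty)
    qed
    show ?thesis unfolding list.map
      by (rule row_Cons_eqI) (use em tail[of "{}" "A \<union> c"] 2 in \<open>simp_all add: un del: row.simps image_Un\<close>)
  qed
qed

text \<open>The tail from position \<open>k\<close> is column \<open>k\<close> of the key, so row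
  \<open>i + 1\<close> of the key is not longer than row \<open>i\<close>. At \<open>k = 0\<close>
  this also excludes states that contain \<open>i + 1\<close> but not \<open>i\<close>.\<close>

definition dominant :: "nat \<Rightarrow> nat set list \<Rightarrow> bool" where
  "dominant i Gs \<longleftrightarrow> (\<forall>k. Suc i \<in> \<Union>(set (drop k Gs)) \<longrightarrow> i \<in> \<Union>(set (drop k Gs)))"

lemma all_nat_iff: "(\<forall>k. P k) \<longleftrightarrow> P 0 \<and> (\<forall>k. P (Suc k))"
  by (metis nat.exhaust)

lemma dominant_Cons:
  "dominant i (A # As) \<longleftrightarrow> (Suc i \<in> A \<union> \<Union>(set As) \<longrightarrow> i \<in> A \<union> \<Union>(set As)) \<and> dominant i As"
  unfolding dominant_def by (subst all_nat_iff) simp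

lemma dominant_absent: "Suc i \<notin> \<Union>(set Gs) \<Longrightarrow> dominant i Gs"
  unfolding dominant_def by (meson UnionE UnionI in_set_dropD)

text \<open>A site emits its least label, so it emits \<open>i + 1\<close> only if \<open>i\<close>
  is not there. By the hypotheses \<open>i\<close> then lies further right, and the carrier
  \<open>i + 1\<close> cannot destroy dominance: only dominant states are reached.\<close>

lemma row_dominant:
  assumes "finite L" "proper L As" "finite c" "c \<inter> L = {}"
    and "dominant i As" "Suc i \<in> c \<union> L \<longrightarrow> i \<in> c \<union> L"
    and "\<And>Gs. proper (L \<union> c) Gs \<Longrightarrow> dominant i Gs \<Longrightarrow> \<phi> Gs = \<psi> Gs"
  shows "row t x c As \<phi> = row t x c As \<psi>"
  using assms
proof (induction As arbitrary: L c \<phi> \<psi>)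
  case Nil
  then show ?case by (simp add: dominant_def)
next
  case (Cons A As)
  let ?m = "Min (A \<union> c)"
  have A: "A \<subseteq> L" "proper (L - A) As" "finite (L - A)" "finite (A \<union> c)" "finite A"
    using Cons.prems by (auto intro: finite_subset)
  have dom: "dominant i As" using Cons.prems(5) by (simp add: dominant_Cons)
  have domL: "Suc i \<in> L - A \<longrightarrow> i \<in> L - A"
    using dom proper_Union[OF A(2)] unfolding dominant_def by (metis drop_0)
  have tail: "row t x d As (\<lambda>Gs. \<phi> (H # Gs)) = row t x d As (\<lambda>Gs. \<psi> (H # Gs))"
    if d: "d \<union> H = A \<union> c" "d \<inter> H = {}" and sd: "Suc i \<in> d \<Longrightarrow> i \<in> L - A" for d H
  proof -
    have fin: "finite d" using d(1) A(4) by (metis finite_Un)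
    have dL: "d \<inter> (L - A) = {}" using d Cons.prems by auto
    have L: "L \<union> c - H = L - A \<union> d" "H \<subseteq> L \<union> c" using d Cons.prems by auto
    show ?thesis
    proof (rule Cons.IH[OF A(3) A(2) fin dL dom])
      show "Suc i \<in> d \<union> (L - A) \<longrightarrow> i \<in> d \<union> (L - A)" using domL sd by auto
      fix Gs assume Gs: "proper (L - A \<union> d) Gs" "dominant i Gs"
      have "H \<union> \<Union>(set Gs) = L \<union> c" using proper_Union[OF Gs(1)] d A(1) by auto
      then show "\<phi> (H # Gs) = \<psi> (H # Gs)"
        using Gs L Cons.prems(6) by (intro Cons.prems(7)) (auto simp: dominant_Cons)
    qed
  qed
  have 2: "row t x {?m} As (\<lambda>Gs. \<phi> ((A \<union> c - {?m}) # Gs)) =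
      row t x {?m} As (\<lambda>Gs. \<psi> ((A \<union> c - {?m}) # Gs))" if "A \<union> c \<noteq> {}"
  proof -
    have m: "?m \<in> A \<union> c" using A(4) that by (rule Min_in)
    have "i \<notin> A \<union> c" if "Suc i = ?m"
      using Min_le[OF A(4), of i] that by (metis Suc_n_not_le_n)
    then show ?thesis using m Cons.prems(6) A(1) by (intro tail) auto
  qed
  show ?case
    by (rule row_Cons_eqI) (use tail[of "{}" "A \<union> c"] 2 in \<open>simp_all del: row.simps\<close>)
qed

text \<open>Models the indicators of the states below \<open>s_i \<alpha>\<close> and below
  \<open>\<alpha>\<close>. Arbitrary values are allowed because the rows below letter
  \<open>i\<close> turn indicators into weighted sums.\<close>

definition compatible :: "nat \<Rightarrow> nat set \<Rightarrow> (nat set list \<Rightarrow> 'r) \<Rightarrow> (nat set list \<Rightarrow> 'r) \<Rightarrow> bool" where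
  "compatible i L \<phi> \<psi> \<longleftrightarrow>
     (\<forall>Gs. proper L Gs \<longrightarrow> \<psi> (swap_state i Gs) = \<psi> Gs \<and> (dominant i Gs \<longrightarrow> \<phi> Gs = \<psi> Gs))"

lemma compatible_row:
  assumes "finite L" "u \<notin> L" "u < i" "compatible i (insert u L) \<phi> \<psi>"
  shows "compatible i L (\<lambda>As. row t x {u} As \<phi>) (\<lambda>As. row t x {u} As \<psi>)"
  unfolding compatible_def
proof (intro allI impI conjI)
  fix As assume As: "proper L As"
  have "swap_label i ` {u} = {u}" using assms(3) by simp
  then show "row t x {u} (swap_state i As) \<psi> = row t x {u} As \<psi>"
    using row_swap_invariant[OF assms(1) As, of "{u}" \<psi> i t x] assms by (auto simp: compatible_def)
  assume dom: "dominant i As"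
  then have "Suc i \<in> L \<longrightarrow> i \<in> L"
    using proper_Union[OF As] unfolding dominant_def by (metis drop_0)
  then show "row t x {u} As \<phi> = row t x {u} As \<psi>"
    using assms by (intro row_dominant[OF assms(1) As _ _ dom]) (auto simp: compatible_def)
qed

lemma row2_cong:
  assumes "finite L" "proper L As" "finite c1" "c1 \<inter> L = {}" "finite c2" "c2 \<inter> (L \<union> c1) = {}"
    and "\<And>Gs. proper (L \<union> c1 \<union> c2) Gs \<Longrightarrow> \<phi> Gs = \<psi> Gs"
  shows "row2 t x y c1 c2 As \<phi> = row2 t x y c1 c2 As \<psi>"
  unfolding row2_def
  by (rule row_cong[OF assms(1-4)], rule row_cong[where L = "L \<union> c1"]) (use assms in auto)

lemma row2_swap_disjoint:
  assumes "finite L" "proper L As" "finite c1" "c1 \<inter> L = {}" "finite c2"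
    "\<not> (i \<in> L \<union> c1 \<union> c2 \<and> Suc i \<in> L \<union> c1 \<union> c2)"
  shows "row2 t x y (swap_label i ` c1) (swap_label i ` c2) (swap_state i As) \<phi> =
    row2 t x y c1 c2 As (\<lambda>Gs. \<phi> (swap_state i Gs))"
proof -
  have "row2 t x y (swap_label i ` c1) (swap_label i ` c2) (swap_state i As) \<phi> =
     row t y c1 As (\<lambda>Bs. row t x (swap_label i ` c2) (swap_state i Bs) \<phi>)"
    unfolding row2_def using assms proper_Union[OF assms(2)] by (intro row_swap_disjoint) auto
  also have "\<dots> = row t y c1 As (\<lambda>Bs. row t x c2 Bs (\<lambda>Gs. \<phi> (swap_state i Gs)))"
  proof (rule row_cong[OF assms(1-4)])
    fix Bs assume "proper (L \<union> c1) Bs"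
    then show "row t x (swap_label i ` c2) (swap_state i Bs) \<phi> = row t x c2 Bs (\<lambda>Gs. \<phi> (swap_state i Gs))"
      using assms proper_Union by (intro row_swap_disjoint) auto
  qed
  finally show ?thesis unfolding row2_def .
qed

section \<open>The operator \<open>\<pi>\<^sub>i\<close> and sums over rows\<close>

context swap_ring
begin

text \<open>\<open>S = \<pi>\<^sub>i D\<close> with the denominator cleared.\<close>

definition demazure_pair :: "'r \<Rightarrow> 'r \<Rightarrow> bool" where
  "demazure_pair D S \<longleftrightarrow> (x - y) * S = x * (1 + t * y) * D - y * (1 + t * x) * s D"

lemma demazure_pair_add: "demazure_pair D S \<Longrightarrow> demazure_pair D' S' \<Longrightarrow> demazure_pair (D + D') (S + S')"
  unfolding demazure_pair_def s_add by (simp only: distrib_left) simp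

lemma demazure_pair_scale: "s k = k \<Longrightarrow> demazure_pair D S \<Longrightarrow> demazure_pair (k * D) (k * S)"
  unfolding demazure_pair_def s_mult by (simp add: right_diff_distrib mult.left_commute)

lemma demazure_pair_sym: "s f = f \<Longrightarrow> demazure_pair f f"
  unfolding demazure_pair_def by (simp add: algebra_simps)

text \<open>The weights of this row involve only \<open>t\<close> and \<open>z\<close>, which
  \<open>s\<close> fixes, and \<open>\<pi>\<^sub>i\<close> is linear over the elements fixed by
  \<open>s\<close>.\<close>

lemma demazure_pair_row:
  assumes "finite L" "proper L As" "finite c" "c \<inter> L = {}" "s z = z"
    and "\<And>Gs. proper (L \<union> c) Gs \<Longrightarrow> length Gs = length As \<Longrightarrow> demazure_pair (\<phi> Gs) (\<psi> Gs)"
  shows "demazure_pair (row t z c As \<phi>) (row t z c As \<psi>)"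
  using assms
proof (induction As arbitrary: L c \<phi> \<psi>)
  case Nil
  then show ?case by (auto simp: demazure_pair_sym)
next
  case (Cons A As)
  let ?m = "Min (A \<union> c)"
  have A: "A \<subseteq> L" "proper (L - A) As" "finite (L - A)" "finite (A \<union> c)" "finite A"
    using Cons.prems by (auto intro: finite_subset)
  have tail: "demazure_pair (row t z d As (\<lambda>Gs. \<phi> (H # Gs))) (row t z d As (\<lambda>Gs. \<psi> (H # Gs)))"
    if d: "d \<union> H = A \<union> c" "d \<inter> H = {}" for d H
  proof -
    have fin: "finite d" using d(1) A(4) by (metis finite_Un)
    have dL: "d \<inter> (L - A) = {}" using d Cons.prems by auto
    have L: "L \<union> c - H = L - A \<union> d" "H \<subseteq> L \<union> c" using d Cons.prems by auto
    show ?thesis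
      by (rule Cons.IH[OF A(3) A(2) fin dL Cons.prems(5)]) (use L in \<open>auto intro: Cons.prems(6)\<close>)
  qed
  have "demazure_pair (if A \<union> c = {} then 0 else z * row t z {?m} As (\<lambda>Gs. \<phi> ((A \<union> c - {?m}) # Gs)))
    (if A \<union> c = {} then 0 else z * row t z {?m} As (\<lambda>Gs. \<psi> ((A \<union> c - {?m}) # Gs)))"
  proof (cases "A \<union> c = {}")
    case False
    then have m: "?m \<in> A \<union> c" using A(4) by (intro Min_in)
    show ?thesis unfolding if_not_P[OF False]
      by (rule demazure_pair_scale[OF Cons.prems(5)], rule tail) (use m in auto)
  qed (simp add: demazure_pair_sym)
  then show ?case unfolding row.simps
    using Cons.prems(5) tail[of "{}" "A \<union> c"]
    by (intro demazure_pair_scale demazure_pair_add) auto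
qed

text \<open>
  The carriers \<open>i + 1\<close> and \<open>i\<close> travel together up to the site where one of them is absorbed. If it
  is \<open>i\<close>, the resulting states are not dominant and their \<open>\<phi>\<close>-sum is annihilated by \<open>\<pi>\<^sub>i\<close>.
\<close>

lemma demazure_pair_row2:
  assumes "finite L" "proper L As" "\<And>v. v \<in> L \<Longrightarrow> Suc i < v"
    and "compatible i (L \<union> {i, Suc i}) \<phi> \<psi>" "\<And>Gs. s (\<phi> Gs) = \<phi> Gs" "\<And>Gs. s (\<psi> Gs) = \<psi> Gs"
  shows "demazure_pair (row2 t x y {Suc i} {i} As \<phi>) (row2 t x y {Suc i} {i} As \<psi>)"
  using assms
proof (induction As arbitrary: L \<phi> \<psi>)
  case Nil
  then show ?case by (simp add: row2_Nil demazure_pair_sym)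
next
  case (Cons A As)
  let ?T = "row2 t x y"
  have A: "A \<subseteq> L" "proper (L - A) As" "finite (L - A)" "finite A"
    using Cons.prems by (auto intro: finite_subset)
  have iA: "i \<notin> L" "Suc i \<notin> L" using Cons.prems(3) by force+
  then have iA': "i \<notin> A" "Suc i \<notin> A" using A(1) by auto
  have mi: "Suc i = Min (A \<union> {Suc i})"
    using A(1,4) Cons.prems(3) by (intro Min_eqI[symmetric]) (auto simp: less_imp_le)
  \<comment> \<open>All labels of \<open>A\<close> exceed \<open>i + 1\<close>, so the first row can
    emit only \<open>i + 1\<close> and the second only \<open>i\<close>. The four terms are: both
    stay, only \<open>i + 1\<close> stays, only \<open>i\<close> stays, neither stays.\<close>
  have E: "?T {Suc i} {i} (A # As) \<chi> =
      ?T {} {} As (\<lambda>Gs. \<chi> ((A \<union> {i, Suc i}) # Gs)) +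
      x * ?T {} {i} As (\<lambda>Gs. \<chi> ((A \<union> {Suc i}) # Gs)) +
      (y * ?T {Suc i} {} As (\<lambda>Gs. \<chi> ((A \<union> {i}) # Gs)) +
       x * y * ?T {Suc i} {i} As (\<lambda>Gs. \<chi> (A # Gs)))" for \<chi>
  proof -
    have "A \<union> {i, Suc i} - {Suc i} = A \<union> {i}" "A \<union> {Suc i} - {Suc i} = A" using iA' by auto
    then show ?thesis
      using row2_two_small(2)[OF A(4) _ _ iA'(1) mi, of t x y As \<chi>] by (simp add: algebra_simps)
  qed
  have compat: "\<psi> (swap_state i Gs) = \<psi> Gs" "dominant i Gs \<Longrightarrow> \<phi> Gs = \<psi> Gs"
    if "proper (L \<union> {i, Suc i}) Gs" for Gs
    using Cons.prems(4) that unfolding compatible_def by auto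
  have disj: "L \<inter> {i, Suc i} = {}" using iA by auto
  note sym = symmetric_row2D[OF symmetric_row2[OF A(3,2)]]
  \<comment> \<open>With both labels at one site the state is dominant, so the two sums agree, and
    they are symmetric since no carrier is left.\<close>
  have 1: "demazure_pair (?T {} {} As (\<lambda>Gs. \<phi> ((A \<union> {i, Suc i}) # Gs)))
      (?T {} {} As (\<lambda>Gs. \<psi> ((A \<union> {i, Suc i}) # Gs)))"
  proof -
    have "?T {} {} As (\<lambda>Gs. \<phi> ((A \<union> {i, Suc i}) # Gs)) = ?T {} {} As (\<lambda>Gs. \<psi> ((A \<union> {i, Suc i}) # Gs))"
    proof (rule row2_cong[OF A(3,2)])
      fix Gs assume "proper (L - A \<union> {} \<union> {}) Gs"
      moreover have "L \<union> {i, Suc i} - (A \<union> {i, Suc i}) = L - A" using iA by auto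
      moreover have "dominant i ((A \<union> {i, Suc i}) # Gs)"
        unfolding dominant_Cons using iA proper_Union[OF calculation(1)]
        by (auto intro!: dominant_absent)
      ultimately show "\<phi> ((A \<union> {i, Suc i}) # Gs) = \<psi> ((A \<union> {i, Suc i}) # Gs)"
        using A(1) by (intro compat(2)) auto
    qed auto
    then show ?thesis using sym(1) Cons.prems(5,6) by (simp add: demazure_pair_sym)
  qed
  define p where "p = ?T {i} {} As (\<lambda>Gs. \<psi> ((A \<union> {Suc i}) # Gs))"
  define q where "q = ?T {} {i} As (\<lambda>Gs. \<psi> ((A \<union> {Suc i}) # Gs))"
  have q: "?T {} {i} As (\<lambda>Gs. \<phi> ((A \<union> {Suc i}) # Gs)) = q"
    unfolding q_def
  proof (rule row2_cong[OF A(3,2)])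
    fix Gs assume Gs: "proper (L - A \<union> {} \<union> {i}) Gs"
    have "L \<union> {i, Suc i} - (A \<union> {Suc i}) = insert i (L - A)" using iA iA' by auto
    moreover have "dominant i ((A \<union> {Suc i}) # Gs)"
    proof -
      have "Suc i \<notin> \<Union>(set Gs)" "i \<in> \<Union>(set Gs)" unfolding proper_Union[OF Gs] using iA by auto
      then show ?thesis unfolding dominant_Cons using dominant_absent by blast
    qed
    ultimately show "\<phi> ((A \<union> {Suc i}) # Gs) = \<psi> ((A \<union> {Suc i}) # Gs)"
      using A(1) Gs by (intro compat(2)) auto
  qed (use iA in auto)
  \<comment> \<open>The invariance of \<open>\<psi>\<close> exchanges the roles of the label that
    stays and the label that moves on.\<close>
  have p: "?T {Suc i} {} As (\<lambda>Gs. \<psi> ((A \<union> {i}) # Gs)) = p"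
  proof -
    have "swap_state i As = As"
    proof (rule map_idI)
      fix B assume "B \<in> set As"
      then have "B \<subseteq> L - A" using proper_Union[OF A(2)] by auto
      then have "i \<notin> B" "Suc i \<notin> B" using iA by auto
      then show "swap_label i ` B = B" by (intro swap_label_image_id) simp
    qed
    then have "?T {Suc i} {} As (\<lambda>Gs. \<psi> ((A \<union> {i}) # Gs)) =
        ?T {i} {} As (\<lambda>Gs. \<psi> ((A \<union> {i}) # swap_state i Gs))"
      using row2_swap_disjoint[OF A(3,2), of "{i}" "{}" i t x y "\<lambda>Gs. \<psi> ((A \<union> {i}) # Gs)"] iA by simp
    also have "\<dots> = p" unfolding p_def
    proof (rule row2_cong[OF A(3,2)])
      fix Gs assume Gs: "proper (L - A \<union> {i} \<union> {}) Gs"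
      have *: "L \<union> {i, Suc i} - (A \<union> {Suc i}) = insert i (L - A)" using iA iA' by auto
      have "swap_label i ` A = A" using iA' by (intro swap_label_image_id) simp
      then have "swap_label i ` (A \<union> {Suc i}) = A \<union> {i}" by (simp add: image_Un)
      then show "\<psi> ((A \<union> {i}) # swap_state i Gs) = \<psi> ((A \<union> {Suc i}) # Gs)"
        using compat(1)[of "(A \<union> {Suc i}) # Gs"] A(1) Gs * by auto
    qed (use iA in auto)
    finally show ?thesis .
  qed
  \<comment> \<open>Applied to the dominant term alone, \<open>\<pi>\<^sub>i\<close> produces the
    \<open>\<psi>\<close>-sum of the dominant term and of its non-dominant mirror image.\<close>
  have 2: "demazure_pair (x * q) (x * q + y * p)"
  proof -
    have "(1 + t * x) * s p = (1 + t * y) * p" "x * s p + y * s q = y * p + x * q"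
      unfolding p_def q_def using sym(2,3) iA Cons.prems(6) by auto
    then show ?thesis unfolding demazure_pair_def by simp algebra
  qed
  have 3: "demazure_pair (y * ?T {Suc i} {} As (\<lambda>Gs. \<phi> ((A \<union> {i}) # Gs))) 0"
  proof -
    define k where "k = ?T {Suc i} {} As (\<lambda>Gs. \<phi> ((A \<union> {i}) # Gs))"
    have "(1 + t * x) * s k = (1 + t * y) * k"
      unfolding k_def using sym(2) iA Cons.prems(5) by auto
    then show ?thesis unfolding demazure_pair_def k_def[symmetric] by simp
  qed
  have 4: "demazure_pair (x * y * ?T {Suc i} {i} As (\<lambda>Gs. \<phi> (A # Gs)))
    (x * y * ?T {Suc i} {i} As (\<lambda>Gs. \<psi> (A # Gs)))"
  proof (rule demazure_pair_scale)
    show "demazure_pair (?T {Suc i} {i} As (\<lambda>Gs. \<phi> (A # Gs))) (?T {Suc i} {i} As (\<lambda>Gs. \<psi> (A # Gs)))"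
    proof (rule Cons.IH[OF A(3,2)])
      show "compatible i (L - A \<union> {i, Suc i}) (\<lambda>Gs. \<phi> (A # Gs)) (\<lambda>Gs. \<psi> (A # Gs))"
        unfolding compatible_def
      proof (intro allI impI conjI)
        fix Gs assume Gs: "proper (L - A \<union> {i, Suc i}) Gs"
        have "L \<union> {i, Suc i} - A = L - A \<union> {i, Suc i}" using iA' by auto
        then have pr: "proper (L \<union> {i, Suc i}) (A # Gs)" using A(1) Gs by auto
        have "swap_label i ` A = A" using iA' by (intro swap_label_image_id) simp
        then show "\<psi> (A # swap_state i Gs) = \<psi> (A # Gs)" using compat(1)[OF pr] by simp
        assume "dominant i Gs"
        then have "dominant i (A # Gs)" using proper_Union[OF Gs] by (simp add: dominant_Cons)
        then show "\<phi> (A # Gs) = \<psi> (A # Gs)" by (rule compat(2)[OF pr])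
      qed
    qed (use Cons.prems in auto)
  qed (simp add: mult.commute)
  show ?case
    using demazure_pair_add[OF demazure_pair_add[OF 1 2] demazure_pair_add[OF 3 4]]
    unfolding E p q q_def[symmetric] by (simp add: algebra_simps)
qed

end

section \<open>The whole model, one row per letter\<close>

primrec rows :: "'r::comm_ring_1 \<Rightarrow> (nat \<Rightarrow> 'r) \<Rightarrow> nat \<Rightarrow> nat set list \<Rightarrow> (nat set list \<Rightarrow> 'r) \<Rightarrow> 'r" where
  "rows t z 0 As \<phi> = \<phi> As"
| "rows t z (Suc j) As \<phi> = row t (z (Suc j)) {Suc j} As (\<lambda>Bs. rows t z j Bs \<phi>)"

context swap_ring
begin

lemma s_row:
  assumes "s u = u" "\<And>Gs. s (\<phi> Gs) = \<phi> Gs"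
  shows "s (row t u c As \<phi>) = row t u c As \<phi>"
  using assms(2) by (induction As arbitrary: c \<phi>) (simp_all add: assms(1))

lemma s_rows:
  assumes "\<And>j. j \<le> m \<Longrightarrow> s (z j) = z j" "\<And>Gs. s (\<phi> Gs) = \<phi> Gs"
  shows "s (rows t z m As \<phi>) = rows t z m As \<phi>"
  using assms(1)
proof (induction m arbitrary: As)
  case (Suc m)
  show ?case unfolding rows.simps by (rule s_row) (use Suc in simp_all)
qed (simp add: assms(2))

lemma compatible_rows:
  assumes "compatible i {1..N} \<phi> \<psi>" "m < i" "i \<le> N"
  shows "compatible i {Suc m..N} (\<lambda>As. rows t z m As \<phi>) (\<lambda>As. rows t z m As \<psi>)"
  using assms(2)
proof (induction m)
  case 0
  then show ?case using assms by simp
next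
  case (Suc m)
  then have "insert (Suc m) {Suc (Suc m)..N} = {Suc m..N}" using assms(3) by auto
  then show ?case using Suc by (auto intro!: compatible_row)
qed

theorem demazure_pair_rows:
  assumes "1 \<le> i" "z i = x" "z (Suc i) = y" "\<And>j. j \<noteq> i \<Longrightarrow> j \<noteq> Suc i \<Longrightarrow> s (z j) = z j"
    and "compatible i {1..N} \<phi> \<psi>" "\<And>Gs. s (\<phi> Gs) = \<phi> Gs" "\<And>Gs. s (\<psi> Gs) = \<psi> Gs"
    and "Suc i \<le> m" "m \<le> N" "proper {Suc m..N} As"
  shows "demazure_pair (rows t z m As \<phi>) (rows t z m As \<psi>)"
  using assms(8,9,10)
proof (induction m arbitrary: As rule: dec_induct)
  case base
  obtain k where k: "i = Suc k" using assms(1) by (cases i) auto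
  have "insert i (insert (Suc i) {Suc (Suc i)..N}) = {Suc k..N}" using base k by auto
  then have "compatible i ({Suc (Suc i)..N} \<union> {i, Suc i}) (\<lambda>As. rows t z k As \<phi>) (\<lambda>As. rows t z k As \<psi>)"
    using compatible_rows[OF assms(5), of k z] base k by simp
  \<comment> \<open>The letters \<open>i + 1\<close> and \<open>i\<close> are treated as one
    \<open>row2\<close>; the rows of the letters from \<open>k\<close> down to 1 belong to the test
    functions.\<close>
  then have "demazure_pair (row2 t x y {Suc i} {i} As (\<lambda>As. rows t z k As \<phi>)) (row2 t x y {Suc i} {i} As (\<lambda>As. rows t z k As \<psi>))"
    using base(2) assms(4,6,7) k by (intro demazure_pair_row2) (auto intro!: s_rows)
  then show ?case using assms(2,3) unfolding k row2_def by simp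
next
  case (step m)
  have L: "{Suc (Suc m)..N} \<union> {Suc m} = {Suc m..N}" using step(4) by auto
  have disj: "{Suc m} \<inter> {Suc (Suc m)..N} = {}" by simp
  have sz: "s (z (Suc m)) = z (Suc m)" using step(1) by (intro assms(4)) linarith+
  have IH: "demazure_pair (rows t z m Gs \<phi>) (rows t z m Gs \<psi>)" if "proper {Suc m..N} Gs" for Gs
    by (rule step.IH[OF _ that]) (use step(4) in linarith)
  have "demazure_pair (row t (z (Suc m)) {Suc m} As (\<lambda>Bs. rows t z m Bs \<phi>))
      (row t (z (Suc m)) {Suc m} As (\<lambda>Bs. rows t z m Bs \<psi>))"
    by (rule demazure_pair_row[OF finite_atLeastAtMost step(5) _ disj sz]) (use L IH in simp_all)
  then show ?case by simp
qed

end

section \<open>The polynomial ring\<close>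

lemma lookup_swap_comp: "part (swap_comp i \<alpha>) k = part \<alpha> (swap_label i k)"
  by (simp add: swap_comp_def map_key.rep_eq[OF inj_transpose])

lemma swap_comp_swap_comp [simp]: "swap_comp i (swap_comp i \<alpha>) = \<alpha>"
  by (rule poly_mapping_eqI) (simp add: lookup_swap_comp)

lemma inj_swap_comp: "inj (swap_comp i)"
  by (metis injI swap_comp_swap_comp)

lemma swap_comp_add: "swap_comp i (\<alpha> + \<gamma>) = swap_comp i \<alpha> + swap_comp i \<gamma>"
  unfolding swap_comp_def by (rule map_key_plus[OF inj_transpose])

lemma swap_comp_zero [simp]: "swap_comp i 0 = 0"
  by (rule poly_mapping_eqI) (simp add: lookup_swap_comp)

lemma swap_comp_single: "swap_comp i (Poly_Mapping.single k n) = Poly_Mapping.single (swap_label i k) n"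
  by (rule poly_mapping_eqI) (auto simp: lookup_swap_comp lookup_single when_def)

lemma swap_poly_add: "swap_poly i (f + g) = swap_poly i f + swap_poly i g"
  unfolding swap_poly_def by (rule map_key_plus[OF inj_swap_comp])

lemma swap_poly_single: "swap_poly i (Poly_Mapping.single \<alpha> c) = Poly_Mapping.single (swap_comp i \<alpha>) c"
  unfolding swap_poly_def using map_key_single[OF inj_swap_comp, of i "swap_comp i \<alpha>" c] by simp

lemma swap_poly_zero: "swap_poly i 0 = 0"
  unfolding swap_poly_def by (rule map_key_zero[OF inj_swap_comp])

lemma mpoly_induct [case_names single add]:
  fixes f :: mpoly_beta
  assumes "\<And>\<alpha> c. P (Poly_Mapping.single \<alpha> c)" "\<And>f g. P f \<Longrightarrow> P g \<Longrightarrow> P (f + g)"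
  shows "P f"
proof (induction f rule: update_induct)
  case const
  show ?case using assms(1)[of 0 0] by simp
next
  case (update f a b)
  then have "Poly_Mapping.update a b f = f + Poly_Mapping.single a b"
    by (intro poly_mapping_eqI) (auto simp: lookup_update lookup_add lookup_single when_def in_keys_iff)
  then show ?case using update assms by simp
qed

lemma swap_poly_mult: "swap_poly i (f * g) = swap_poly i f * swap_poly i g"
proof (induction f rule: mpoly_induct)
  case (single \<alpha> c)
  show ?case
    by (induction g rule: mpoly_induct)
      (simp_all add: mult_single swap_poly_single swap_comp_add distrib_left swap_poly_add)
qed (simp add: distrib_right swap_poly_add)

lemma swap_poly_swap_poly: "swap_poly i (swap_poly i f) = f"
  by (induction f rule: mpoly_induct) (simp_all add: swap_poly_single swap_poly_add)

lemma swap_poly_X: "swap_poly i (X k) = X (swap_label i k)"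
  by (simp add: X_def swap_poly_single swap_comp_single)

lemma X_eq_iff: "X j = X k \<longleftrightarrow> j = k"
proof
  assume "X j = X k"
  then have "Poly_Mapping.lookup (X j) (Poly_Mapping.single j 1) = Poly_Mapping.lookup (X k) (Poly_Mapping.single j 1)" by simp
  then have "Poly_Mapping.single k 1 = (Poly_Mapping.single j 1 :: composition)"
    by (simp add: X_def lookup_single when_def split: if_splits)
  then have "part (Poly_Mapping.single k 1) j = part (Poly_Mapping.single j 1) j" by simp
  then show "j = k" by (auto simp: lookup_single when_def split: if_splits)
qed simp

interpretation swap_ring "swap_poly i" beta "X i" "X (Suc i)" for i
proof
  have "swap_poly i 1 = 1"
    using swap_poly_single[of i 0 1] by simp
  then show "swap_poly i 1 = 1" .
  show "swap_poly i beta = beta" by (simp add: beta_def swap_poly_single)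
qed (simp_all add: swap_poly_add swap_poly_mult swap_poly_swap_poly swap_poly_X X_eq_iff)

text \<open>The candidate \<open>S\<close> itself witnesses divisibility by
  \<open>X i - X (Suc i)\<close>, and cancellation in the integral domain makes it the only
  quotient.\<close>

lemma demazure_beta_eqI:
  assumes "demazure_pair i D S"
  shows "demazure_beta i D = S"
  unfolding demazure_beta_def divdiff_def
proof (rule the_equality)
  show eq: "(X i - X (Suc i)) * S = (1 + beta * X (Suc i)) * X i * D - swap_poly i ((1 + beta * X (Suc i)) * X i * D)"
    using assms unfolding demazure_pair_def by (simp add: mult.commute mult.left_commute)
  have "X i - X (Suc i) \<noteq> 0" using X_eq_iff[of i "Suc i"] by simp
  then show "g = S" if "(X i - X (Suc i)) * g = (1 + beta * X (Suc i)) * X i * D - swap_poly i ((1 + beta * X (Suc i)) * X i * D)" for g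
    using that eq by (metis mult_cancel_left)
qed

section \<open>The order on columns\<close>

text \<open>For columns of equal size the componentwise order is the pointwise order of these
  counting functions. In this form both the exchange of labels and the insertion of an entry are
  easy to follow.\<close>

definition cnt :: "nat set \<Rightarrow> nat \<Rightarrow> nat" where
  "cnt G t = card (G \<inter> {t..})"

lemma cnt_Suc: "finite G \<Longrightarrow> cnt G t = cnt G (Suc t) + (if t \<in> G then 1 else 0)"
proof -
  assume "finite G"
  moreover have "G \<inter> {t..} = (if t \<in> G then insert t (G \<inter> {Suc t..}) else G \<inter> {Suc t..})"
    by (auto simp: Suc_le_eq le_less)
  ultimately show ?thesis by (simp add: cnt_def)
qed

text \<open>The only threshold that separates \<open>i\<close> from \<open>i + 1\<close> is
  \<open>i + 1\<close>.\<close>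

lemma cnt_swap_label:
  assumes "finite G" "t \<noteq> Suc i"
  shows "cnt (swap_label i ` G) t = cnt G t"
proof -
  have "swap_label i ` {t..} = {t..}" using assms(2) by (intro swap_label_image_id) auto
  then have "swap_label i ` G \<inter> {t..} = swap_label i ` (G \<inter> {t..})"
    by (simp add: image_Int inj_transpose del: transpose_image_eq)
  then show ?thesis unfolding cnt_def by (simp add: card_image)
qed

lemma cnt_swap_label_Suc:
  assumes "finite G"
  shows "cnt (swap_label i ` G) (Suc i) = cnt G (Suc (Suc i)) + (if i \<in> G then 1 else 0)"
proof -
  have "Suc i \<in> swap_label i ` G \<longleftrightarrow> i \<in> G"
    by (metis imageE image_eqI transpose_apply_first transpose_involutory)
  then show ?thesis
    using cnt_Suc[of "swap_label i ` G" "Suc i"] cnt_swap_label[OF assms, of "Suc (Suc i)" i] assms by simp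
qed

definition column_le :: "nat set \<Rightarrow> nat set \<Rightarrow> bool" where
  "column_le G E \<longleftrightarrow> finite G \<and> card G = card E \<and> (\<forall>t. cnt G t \<le> cnt E t)"

text \<open>Only the threshold \<open>i + 1\<close> is affected. If \<open>i \<notin> E\<close>, the
  inequality at \<open>i\<close> gives the one needed there; if \<open>i \<in> E\<close>, then
  \<open>i + 1 \<in> E\<close> contributes one more to \<open>E\<close> on top of the inequality at
  \<open>i + 2\<close>.\<close>

lemma column_le_swap_left:
  assumes "finite E" "i \<in> E \<longrightarrow> Suc i \<in> E" "column_le G E"
  shows "column_le (swap_label i ` G) E"
proof -
  have G: "finite G" "card G = card E" "\<And>t. cnt G t \<le> cnt E t"
    using assms(3) by (auto simp: column_le_def)
  have "cnt (swap_label i ` G) t \<le> cnt E t" for t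
  proof (cases "t = Suc i")
    case True
    show ?thesis
      using True G(3)[of i] G(3)[of "Suc i"] G(3)[of "Suc (Suc i)"] cnt_swap_label_Suc[OF G(1), of i]
        cnt_Suc[OF G(1), of i] cnt_Suc[OF G(1), of "Suc i"]
        cnt_Suc[OF assms(1), of i] cnt_Suc[OF assms(1), of "Suc i"] assms(2)
      by (auto split: if_splits)
  qed (use G cnt_swap_label in simp)
  then show ?thesis using G by (simp add: column_le_def card_image)
qed

lemma column_le_swap_left_iff:
  assumes "finite E" "i \<in> E \<longrightarrow> Suc i \<in> E"
  shows "column_le (swap_label i ` G) E \<longleftrightarrow> column_le G E"
  using column_le_swap_left[OF assms, of G] column_le_swap_left[OF assms, of "swap_label i ` G"]
  by (auto simp: image_image)

text \<open>Exchanging the labels of \<open>E\<close> lowers its count at most by one, and only at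
  \<open>i + 1\<close>, in the case that \<open>E\<close> contains \<open>i + 1\<close> and not
  \<open>i\<close>. If \<open>i + 1 \<in> G\<close>, then also \<open>i \<in> G\<close> and the
  inequality at \<open>i\<close> leaves one to spare; otherwise the inequality at
  \<open>i + 2\<close> suffices.\<close>

lemma column_le_swap_right_iff:
  assumes "finite E" "i \<in> E \<longrightarrow> Suc i \<in> E" "Suc i \<in> G \<longrightarrow> i \<in> G"
  shows "column_le G (swap_label i ` E) \<longleftrightarrow> column_le G E"
proof (cases "finite G")
  case G: True
  have "cnt G (Suc i) \<le> cnt (swap_label i ` E) (Suc i) \<longleftrightarrow> cnt G (Suc i) \<le> cnt E (Suc i)"
    if "cnt G i \<le> cnt E i" "cnt G (Suc (Suc i)) \<le> cnt E (Suc (Suc i))"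
    using that cnt_swap_label_Suc[OF assms(1), of i] assms(2,3)
        cnt_Suc[OF G(1), of i] cnt_Suc[OF G(1), of "Suc i"]
        cnt_Suc[OF assms(1), of i] cnt_Suc[OF assms(1), of "Suc i"]
    by (auto split: if_splits)
  then have "(\<forall>t. cnt G t \<le> cnt (swap_label i ` E) t) \<longleftrightarrow> (\<forall>t. cnt G t \<le> cnt E t)"
    using cnt_swap_label[OF assms(1)] by (metis n_not_Suc_n)
  then show ?thesis by (simp add: column_le_def card_image)
qed (simp add: column_le_def)

definition key_columns :: "nat set list \<Rightarrow> nat \<Rightarrow> nat set" where
  "key_columns Gs k = \<Union>(set (drop k Gs))"

definition state_le :: "nat set list \<Rightarrow> composition \<Rightarrow> bool" where
  "state_le Gs \<alpha> \<longleftrightarrow> (\<forall>k\<ge>1. column_le (key_columns Gs k) (key_col \<alpha> k))"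

lemma finite_key_col: "1 \<le> k \<Longrightarrow> finite (key_col \<alpha> k)"
  by (rule finite_subset[OF _ finite_keys[of \<alpha>]]) (auto simp: key_col_def in_keys_iff)

lemma key_columns_swap_state: "key_columns (swap_state i Gs) k = swap_label i ` key_columns Gs k"
  by (auto simp: key_columns_def drop_map)

lemma key_col_swap_comp: "key_col (swap_comp i \<alpha>) k = swap_label i ` key_col \<alpha> k"
proof
  show "swap_label i ` key_col \<alpha> k \<subseteq> key_col (swap_comp i \<alpha>) k"
    by (auto simp: key_col_def lookup_swap_comp)
  show "key_col (swap_comp i \<alpha>) k \<subseteq> swap_label i ` key_col \<alpha> k"
  proof
    fix v assume "v \<in> key_col (swap_comp i \<alpha>) k"
    then have "swap_label i v \<in> key_col \<alpha> k" by (simp add: key_col_def lookup_swap_comp)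
    then show "v \<in> swap_label i ` key_col \<alpha> k" by (metis image_eqI transpose_involutory)
  qed
qed

text \<open>The initial state is empty because label \<open>j\<close> enters only as the carrier of
  row \<open>j\<close>. Rows of the key end at positions below \<open>n\<close>, so \<open>n\<close>
  is later taken larger than every part of \<open>\<alpha>\<close>.\<close>

definition state_sum :: "nat \<Rightarrow> nat \<Rightarrow> composition \<Rightarrow> mpoly_beta" where
  "state_sum N n \<alpha> = rows beta X N (replicate n {}) (\<lambda>Gs. if state_le Gs \<alpha> then 1 else 0)"

text \<open>Because of the ascent at \<open>i\<close>, every key column of \<open>\<alpha>\<close>
  that contains \<open>i\<close> also contains \<open>i + 1\<close>. The two requirements are then
  the two column lemmas applied to each column.\<close>

lemma compatible_state_le:
  assumes "part \<alpha> i < part \<alpha> (Suc i)"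
  shows "compatible i L (\<lambda>Gs. if state_le Gs (swap_comp i \<alpha>) then 1 else 0 :: mpoly_beta)
    (\<lambda>Gs. if state_le Gs \<alpha> then 1 else 0)"
proof -
  have 1: "i \<in> key_col \<alpha> k \<longrightarrow> Suc i \<in> key_col \<alpha> k" for k
    using assms by (auto simp: key_col_def)
  have "state_le (swap_state i Gs) \<alpha> \<longleftrightarrow> state_le Gs \<alpha>" for Gs
    unfolding state_le_def key_columns_swap_state using column_le_swap_left_iff[OF finite_key_col 1] by auto
  moreover have "state_le Gs (swap_comp i \<alpha>) \<longleftrightarrow> state_le Gs \<alpha>" if "dominant i Gs" for Gs
  proof -
    have "Suc i \<in> key_columns Gs k \<longrightarrow> i \<in> key_columns Gs k" for k
      using that unfolding dominant_def key_columns_def by blast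
    then show ?thesis
      unfolding state_le_def key_col_swap_comp using column_le_swap_right_iff[OF finite_key_col 1] by auto
  qed
  ultimately show ?thesis unfolding compatible_def by auto
qed

lemma proper_replicate: "proper {} (replicate n {})"
  by (induction n) auto

theorem demazure_beta_state_sum:
  assumes "1 \<le> i" "part \<alpha> i < part \<alpha> (Suc i)" "Suc i \<le> N"
  shows "demazure_beta i (state_sum N n (swap_comp i \<alpha>)) = state_sum N n \<alpha>"
  unfolding state_sum_def
proof (rule demazure_beta_eqI, rule demazure_pair_rows[where z = X, OF assms(1)])
  show "swap_poly i (X j) = X j" if "j \<noteq> i" "j \<noteq> Suc i" for j
    using that by (simp add: swap_poly_X)
  have "swap_poly i 1 = 1" by (rule s_one)
  then show "swap_poly i (if state_le Gs \<gamma> then 1 else 0) = (if state_le Gs \<gamma> then 1 else 0)" for Gs \<gamma>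
    by (simp add: swap_poly_zero)
  show "compatible i {1..N} (\<lambda>Gs. if state_le Gs (swap_comp i \<alpha>) then 1 else 0 :: mpoly_beta)
    (\<lambda>Gs. if state_le Gs \<alpha> then 1 else 0)"
    by (rule compatible_state_le[OF assms(2)])
qed (use assms(3) proper_replicate in auto)

section \<open>Row transfer as a sum over columns\<close>

text \<open>The bits \<open>es\<close> prescribe which sites emit, which makes the row
  deterministic. The outcome is meaningful only if \<open>emits\<close> holds: an emitting site has
  something to emit, and no carrier is left at the end.\<close>

fun run :: "nat set \<Rightarrow> nat set list \<Rightarrow> bool list \<Rightarrow> nat set list" where
  "run c (A # As) (e # es) =
     (A \<union> c - (if e then {Min (A \<union> c)} else {})) # run (if e then {Min (A \<union> c)} else {}) As es"
| "run _ _ _ = []"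

fun emits :: "bool \<Rightarrow> nat set list \<Rightarrow> bool list \<Rightarrow> bool" where
  "emits p (A # As) (e # es) \<longleftrightarrow> (e \<longrightarrow> p \<or> A \<noteq> {}) \<and> emits e As es"
| "emits p _ _ \<longleftrightarrow> \<not> p"

fun emit_weight :: "'r::comm_ring_1 \<Rightarrow> 'r \<Rightarrow> bool \<Rightarrow> nat set list \<Rightarrow> bool list \<Rightarrow> 'r" where
  "emit_weight t x p (A # As) (e # es) =
     (if \<not> p \<and> A \<noteq> {} then 1 + t * x else 1) * (if e then x else 1) * emit_weight t x e As es"
| "emit_weight t x p _ _ = 1"

lemma finite_bit_lists: "finite {es :: bool list. length es = n}"
  using finite_lists_length_eq[of "UNIV :: bool set" n] by simp

lemma sum_bit_lists_Suc:
  fixes f :: "bool list \<Rightarrow> 'a::comm_monoid_add"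
  shows "(\<Sum>es | length es = Suc n. f es) =
    (\<Sum>es | length es = n. f (False # es)) + (\<Sum>es | length es = n. f (True # es))"
proof -
  have S: "{es :: bool list. length es = Suc n} = (#) False ` {es. length es = n} \<union> (#) True ` {es. length es = n}"
    by (auto simp: length_Suc_conv)
  show ?thesis unfolding S
    by (subst sum.union_disjoint) (auto simp: finite_bit_lists sum.reindex inj_on_def)
qed

lemma row_eq_sum:
  "row t x c As \<phi> = (\<Sum>es | length es = length As.
     if emits (c \<noteq> {}) As es then emit_weight t x (c \<noteq> {}) As es * \<phi> (run c As es) else 0)"
proof (induction As arbitrary: c \<phi>)
  case Nil
  then show ?case by simp
next
  case (Cons A As)
  have 1: "(\<Sum>es | length es = length As. if emits (c \<noteq> {}) (A # As) (False # es)
        then emit_weight t x (c \<noteq> {}) (A # As) (False # es) * \<phi> (run c (A # As) (False # es)) else 0) =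
      (if c = {} \<and> A \<noteq> {} then 1 + t * x else 1) * row t x {} As (\<lambda>Gs. \<phi> ((A \<union> c) # Gs))"
    unfolding Cons.IH sum_distrib_left by (intro sum.cong) (auto simp: mult_ac)
  have 2: "(\<Sum>es | length es = length As. if emits (c \<noteq> {}) (A # As) (True # es)
        then emit_weight t x (c \<noteq> {}) (A # As) (True # es) * \<phi> (run c (A # As) (True # es)) else 0) =
      (if c = {} \<and> A \<noteq> {} then 1 + t * x else 1) * (if A \<union> c = {} then 0 else
        x * row t x {Min (A \<union> c)} As (\<lambda>Gs. \<phi> ((A \<union> c - {Min (A \<union> c)}) # Gs)))"
  proof (cases "A \<union> c = {}")
    case False
    then show ?thesis
      unfolding Cons.IH sum_distrib_left if_not_P[OF False] by (intro sum.cong) (auto simp: mult_ac)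
  qed simp
  show ?case
    unfolding row.simps list.size add.right_neutral add_Suc_right sum_bit_lists_Suc 1 2 distrib_left ..
qed

text \<open>A label emitted at position \<open>k\<close> reaches position \<open>k + 1\<close>, so
  bit \<open>k\<close> records whether the letter lies in column \<open>k + 1\<close>.\<close>

definition bits :: "nat \<Rightarrow> (nat \<Rightarrow> nat set) \<Rightarrow> nat \<Rightarrow> bool list" where
  "bits n C z = map (\<lambda>k. z \<in> C (Suc k)) [0..<n]"

lemma length_bits [simp]: "length (bits n C z) = n"
  by (simp add: bits_def)

lemma nth_bits [simp]: "k < n \<Longrightarrow> bits n C z ! k \<longleftrightarrow> z \<in> C (Suc k)"
  by (simp add: bits_def)

definition fillings :: "nat \<Rightarrow> nat \<Rightarrow> (nat \<Rightarrow> nat set) set" where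
  "fillings n m = {C. (\<forall>k. C k \<subseteq> {1..m}) \<and> (\<forall>k. k \<notin> {1..n} \<longrightarrow> C k = {})}"

fun final_state :: "nat \<Rightarrow> (nat \<Rightarrow> nat set) \<Rightarrow> nat \<Rightarrow> nat set list \<Rightarrow> nat set list" where
  "final_state n C 0 As = As"
| "final_state n C (Suc m) As = final_state n C m (run {Suc m} As (bits n C (Suc m)))"

fun admissible :: "nat \<Rightarrow> (nat \<Rightarrow> nat set) \<Rightarrow> nat \<Rightarrow> nat set list \<Rightarrow> bool" where
  "admissible n C 0 As \<longleftrightarrow> True"
| "admissible n C (Suc m) As \<longleftrightarrow>
     emits True As (bits n C (Suc m)) \<and> admissible n C m (run {Suc m} As (bits n C (Suc m)))"

fun filling_weight :: "'r::comm_ring_1 \<Rightarrow> (nat \<Rightarrow> 'r) \<Rightarrow> nat \<Rightarrow> (nat \<Rightarrow> nat set) \<Rightarrow> nat \<Rightarrow> nat set list \<Rightarrow> 'r" where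
  "filling_weight t x n C 0 As = 1"
| "filling_weight t x n C (Suc m) As =
     emit_weight t (x (Suc m)) True As (bits n C (Suc m)) *
     filling_weight t x n C m (run {Suc m} As (bits n C (Suc m)))"

lemma length_run: "length es = length As \<Longrightarrow> length (run c As es) = length As"
  by (induction c As es rule: run.induct) auto

definition add_letter :: "nat \<Rightarrow> nat \<Rightarrow> bool list \<Rightarrow> (nat \<Rightarrow> nat set) \<Rightarrow> nat \<Rightarrow> nat set" where
  "add_letter n z es C k = (if k \<in> {1..n} \<and> es ! (k - 1) then insert z (C k) else C k)"

lemma bits_add_letter:
  assumes "C \<in> fillings n m" "length es = n"
  shows "bits n (add_letter n (Suc m) es C) (Suc m) = es"
    and "j \<le> m \<Longrightarrow> bits n (add_letter n (Suc m) es C) j = bits n C j"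
proof -
  have "Suc m \<notin> C k" for k using assms(1) by (force simp: fillings_def)
  then show "bits n (add_letter n (Suc m) es C) (Suc m) = es"
    using assms(2) by (intro nth_equalityI) (auto simp: add_letter_def)
  show "bits n (add_letter n (Suc m) es C) j = bits n C j" if "j \<le> m"
    using that by (auto simp: bits_def add_letter_def)
qed

lemma filling_cong:
  assumes "\<And>j. 1 \<le> j \<Longrightarrow> j \<le> m \<Longrightarrow> bits n C j = bits n C' j"
  shows "final_state n C m As = final_state n C' m As"
    and "admissible n C m As = admissible n C' m As"
    and "filling_weight t x n C m As = filling_weight t x n C' m As"
  using assms by (induction m arbitrary: As) simp_all

text \<open>Peels off the largest letter, whose row comes first, to match the recursion of
  \<open>rows\<close>.\<close>

lemma bij_betw_add_letter:
  "bij_betw (\<lambda>(es, C). add_letter n (Suc m) es C) ({es. length es = n} \<times> fillings n m) (fillings n (Suc m))"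
proof (rule bij_betw_byWitness[where f' = "\<lambda>C. (bits n C (Suc m), \<lambda>k. C k - {Suc m})"])
  show "\<forall>p\<in>{es. length es = n} \<times> fillings n m.
     (\<lambda>C. (bits n C (Suc m), \<lambda>k. C k - {Suc m})) ((\<lambda>(es, C). add_letter n (Suc m) es C) p) = p"
  proof
    fix p :: "bool list \<times> (nat \<Rightarrow> nat set)"
    assume "p \<in> {es. length es = n} \<times> fillings n m"
    then obtain es C where p: "p = (es, C)" "length es = n" "C \<in> fillings n m" by auto
    have C: "Suc m \<notin> C k" for k using p(3) by (force simp: fillings_def)
    have "add_letter n (Suc m) es C k - {Suc m} = C k" for k
      using C[of k] by (auto simp: add_letter_def)
    then show "(\<lambda>C. (bits n C (Suc m), \<lambda>k. C k - {Suc m})) ((\<lambda>(es, C). add_letter n (Suc m) es C) p) = p"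
      using bits_add_letter(1)[OF p(3,2)] by (simp add: p(1))
  qed
  show "\<forall>C\<in>fillings n (Suc m). (\<lambda>(es, C). add_letter n (Suc m) es C) (bits n C (Suc m), \<lambda>k. C k - {Suc m}) = C"
    by (auto simp: add_letter_def fun_eq_iff fillings_def)
  show "(\<lambda>(es, C). add_letter n (Suc m) es C) ` ({es. length es = n} \<times> fillings n m) \<subseteq> fillings n (Suc m)"
    by (fastforce simp: add_letter_def fillings_def)
  show "(\<lambda>C. (bits n C (Suc m), \<lambda>k. C k - {Suc m})) ` fillings n (Suc m) \<subseteq> {es. length es = n} \<times> fillings n m"
    by (fastforce simp: fillings_def le_Suc_eq)
qed

lemma fillings_zero: "fillings n 0 = {\<lambda>_. {}}"
  by (auto simp: fillings_def)

lemma finite_fillings: "finite (fillings n m)"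
proof (induction m)
  case (Suc m)
  then show ?case
    using bij_betw_finite[OF bij_betw_add_letter, of n m] finite_bit_lists by simp
qed (simp add: fillings_zero)

lemma rows_eq_sum:
  assumes "length As = n"
  shows "rows t x m As \<phi> = (\<Sum>C\<in>fillings n m.
     if admissible n C m As then filling_weight t x n C m As * \<phi> (final_state n C m As) else 0)"
  using assms
proof (induction m arbitrary: As)
  case 0
  then show ?case by (simp add: fillings_zero)
next
  case (Suc m)
  define F where "F es C = (if emits True As es \<and> admissible n C m (run {Suc m} As es)
     then emit_weight t (x (Suc m)) True As es * filling_weight t x n C m (run {Suc m} As es) *
       \<phi> (final_state n C m (run {Suc m} As es)) else 0)" for es C
  define G where "G C = (if admissible n C (Suc m) As
     then filling_weight t x n C (Suc m) As * \<phi> (final_state n C (Suc m) As) else 0)" for C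
  have FG: "F es C = G (add_letter n (Suc m) es C)" if C: "C \<in> fillings n m" "length es = n" for es C
  proof -
    note b = bits_add_letter[OF C]
    have "final_state n (add_letter n (Suc m) es C) m Bs = final_state n C m Bs"
      "admissible n (add_letter n (Suc m) es C) m Bs = admissible n C m Bs"
      "filling_weight t x n (add_letter n (Suc m) es C) m Bs = filling_weight t x n C m Bs" for Bs
      by (rule filling_cong, simp add: b(2))+
    then show ?thesis using b(1) unfolding F_def G_def by simp
  qed
  have "rows t x (Suc m) As \<phi> = (\<Sum>es | length es = n. \<Sum>C\<in>fillings n m. F es C)"
    unfolding rows.simps row_eq_sum Suc.prems
  proof (intro sum.cong refl)
    fix es :: "bool list" assume "es \<in> {es. length es = n}"
    then have l: "length (run {Suc m} As es) = n" using Suc.prems by (simp add: length_run)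
    show "(if emits ({Suc m} \<noteq> {}) As es then emit_weight t (x (Suc m)) ({Suc m} \<noteq> {}) As es *
         rows t x m (run {Suc m} As es) \<phi> else 0) = (\<Sum>C\<in>fillings n m. F es C)"
      unfolding Suc.IH[OF l] F_def by (auto simp: sum_distrib_left mult.assoc intro!: sum.cong)
  qed
  also have "\<dots> = (\<Sum>(es, C)\<in>{es. length es = n} \<times> fillings n m. F es C)"
    by (rule sum.cartesian_product)
  also have "\<dots> = (\<Sum>p\<in>{es. length es = n} \<times> fillings n m. G ((\<lambda>(es, C). add_letter n (Suc m) es C) p))"
    by (rule sum.cong[OF refl]) (auto simp: FG)
  also have "\<dots> = sum G (fillings n (Suc m))"
    by (rule sum.reindex_bij_betw[OF bij_betw_add_letter])
  finally show ?case unfolding G_def .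
qed

section \<open>Left keys and parking\<close>

text \<open>A set with at most one element: a car that finds no spot leaves the set of occupied
  spots unchanged, which keeps \<open>park_step\<close> total.\<close>

definition first_free :: "nat set \<Rightarrow> nat \<Rightarrow> nat set \<Rightarrow> nat set" where
  "first_free C a P = {x \<in> C - P. a \<le> x \<and> (\<forall>y\<in>C - P. a \<le> y \<longrightarrow> x \<le> y)}"

definition park_step :: "nat set \<Rightarrow> nat \<Rightarrow> nat set \<Rightarrow> nat set" where
  "park_step C a P = P \<union> first_free C a P"

definition park :: "nat set \<Rightarrow> nat set \<Rightarrow> nat set" where
  "park C D = Finite_Set.fold (park_step C) {} D"

lemma first_free_eqI:
  assumes "x \<in> C" "x \<notin> P" "a \<le> x" "\<And>y. y \<in> C \<Longrightarrow> y \<notin> P \<Longrightarrow> a \<le> y \<Longrightarrow> x \<le> y"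
  shows "first_free C a P = {x}"
proof (rule set_eqI)
  fix y
  show "y \<in> first_free C a P \<longleftrightarrow> y \<in> {x}"
  proof
    assume "y \<in> first_free C a P"
    then have "y \<in> C" "y \<notin> P" "a \<le> y" "y \<le> x" using assms(1-3) unfolding first_free_def by blast+
    then show "y \<in> {x}" using assms(4)[of y] by simp
  next
    assume "y \<in> {x}"
    then show "y \<in> first_free C a P" using assms unfolding first_free_def by blast
  qed
qed

lemma first_free_cases:
  obtains "first_free C a P = {}" "\<And>y. y \<in> C \<Longrightarrow> y \<notin> P \<Longrightarrow> \<not> a \<le> y"
  | x where "first_free C a P = {x}" "x \<in> C" "x \<notin> P" "a \<le> x" "\<And>y. y \<in> C \<Longrightarrow> y \<notin> P \<Longrightarrow> a \<le> y \<Longrightarrow> x \<le> y"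
proof (cases "\<exists>y. y \<in> C \<and> y \<notin> P \<and> a \<le> y")
  case True
  define x where "x = (LEAST y. y \<in> C \<and> y \<notin> P \<and> a \<le> y)"
  have x: "x \<in> C \<and> x \<notin> P \<and> a \<le> x" unfolding x_def using True by (rule LeastI_ex)
  have le: "x \<le> y" if "y \<in> C" "y \<notin> P" "a \<le> y" for y
    unfolding x_def using that by (intro Least_le) simp
  have xs: "x \<in> C" "x \<notin> P" "a \<le> x" using x by auto
  show thesis by (rule that(2)[OF first_free_eqI[OF xs le] xs le])
next
  case False
  then show thesis by (intro that(1)) (auto simp: first_free_def)
qed

text \<open>Let \<open>r\<close> and \<open>s\<close> be the spots that \<open>a\<close> and
  \<open>b\<close> would take first. If they differ, then \<open>r < b\<close> and neither car
  disturbs the other. If they agree, no other free spot separates the two preferences, so whichever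
  car comes second looks for the same spot.\<close>

lemma park_step_commute_le:
  assumes "a \<le> b"
  shows "park_step C a (park_step C b P) = park_step C b (park_step C a P)"
proof (cases rule: first_free_cases[of C b P])
  case 1
  have "first_free C b Q = {}" if "P \<subseteq> Q" for Q
    using 1(2) that unfolding first_free_def by blast
  from this[of P] this[of "P \<union> first_free C a P"] show ?thesis unfolding park_step_def by simp
next
  case b: (2 s)
  show ?thesis
  proof (cases rule: first_free_cases[of C a P])
    case 1
    then show ?thesis using 1(2)[OF b(2,3)] order_trans[OF assms b(4)] by simp
  next
    case a: (2 r)
    show ?thesis
    proof (cases "r = s")
      case False
      have "r < b"
      proof (rule ccontr)
        assume "\<not> r < b"
        then have "s \<le> r" by (intro b(5)[OF a(2,3)]) simp
        moreover have "r \<le> s" by (rule a(5)[OF b(2,3) order_trans[OF assms b(4)]])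
        ultimately show False using False by simp
      qed
      have 1: "first_free C a (P \<union> {s}) = {r}"
        using a(3) False by (intro first_free_eqI[OF a(2) _ a(4) a(5)]) simp_all
      have 2: "first_free C b (P \<union> {r}) = {s}"
        using b(3) False by (intro first_free_eqI[OF b(2) _ b(4) b(5)]) simp_all
      show ?thesis unfolding park_step_def a(1) b(1) 1 2 by (simp add: insert_commute)
    next
      case True
      have iff: "a \<le> y \<longleftrightarrow> b \<le> y" if "y \<in> C - (P \<union> {s})" for y
      proof
        have y: "y \<in> C" "y \<notin> P" using that by auto
        show "b \<le> y" if "a \<le> y" using a(5)[OF y that] b(4) True by simp
        show "a \<le> y" if "b \<le> y" using that assms by simp
      qed
      have "first_free C a (P \<union> {s}) = first_free C b (P \<union> {s})"
        unfolding first_free_def by (intro Collect_cong conj_cong ball_cong refl) (simp_all add: iff)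
      then show ?thesis unfolding park_step_def a(1) b(1) True by simp
    qed
  qed
qed

lemma park_step_commute: "park_step C a (park_step C b P) = park_step C b (park_step C a P)"
  by (metis nle_le park_step_commute_le)

interpretation park: comp_fun_commute "park_step C" for C
  by standard (rule ext, unfold o_apply, rule park_step_commute)

lemma park_empty [simp]: "park C {} = {}"
  by (simp add: park_def)

lemma park_insert: "finite D \<Longrightarrow> a \<notin> D \<Longrightarrow> park C (insert a D) = park_step C a (park C D)"
  by (simp add: park_def)

lemma park_union:
  assumes "finite D" "finite E" "D \<inter> E = {}"
  shows "park C (D \<union> E) = Finite_Set.fold (park_step C) (park C D) E"
  using assms(2,1,3)
proof (induction E rule: finite_induct)
  case (insert e E)
  then have "park C (insert e (D \<union> E)) = park_step C e (park C (D \<union> E))"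
    by (intro park_insert) auto
  then show ?case using insert by simp
qed simp

lemma fold_park_step_bounds:
  assumes "finite E" "\<And>e. e \<in> E \<Longrightarrow> a \<le> e"
  shows "P \<subseteq> Finite_Set.fold (park_step C) P E"
    and "x \<in> Finite_Set.fold (park_step C) P E \<Longrightarrow> x \<in> P \<or> x \<in> C \<and> a \<le> x"
proof -
  have "P \<subseteq> Finite_Set.fold (park_step C) P E \<and>
    (\<forall>x\<in>Finite_Set.fold (park_step C) P E. x \<in> P \<or> x \<in> C \<and> a \<le> x)"
    using assms
  proof (induction E rule: finite_induct)
    case (insert e E)
    let ?Q = "Finite_Set.fold (park_step C) P E"
    have Q: "P \<subseteq> ?Q" "\<And>x. x \<in> ?Q \<Longrightarrow> x \<in> P \<or> x \<in> C \<and> a \<le> x"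
      using insert by auto
    have "a \<le> e" using insert.prems by simp
    then have "x \<in> ?Q \<or> x \<in> C \<and> a \<le> x" if "x \<in> park_step C e ?Q" for x
      using that unfolding park_step_def first_free_def by (auto intro: order_trans)
    moreover have "?Q \<subseteq> park_step C e ?Q" by (auto simp: park_step_def)
    moreover have "Finite_Set.fold (park_step C) P (insert e E) = park_step C e ?Q"
      using insert.hyps by (rule park.fold_insert)
    ultimately show ?case using Q by blast
  qed simp
  then show "P \<subseteq> Finite_Set.fold (park_step C) P E"
    and "x \<in> Finite_Set.fold (park_step C) P E \<Longrightarrow> x \<in> P \<or> x \<in> C \<and> a \<le> x" by auto
qed

text \<open>Hall's condition for parking: from every threshold on there are at least as many spots
  as cars.\<close>

definition dominates :: "nat set \<Rightarrow> nat set \<Rightarrow> bool" where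
  "dominates C D \<longleftrightarrow> finite C \<and> finite D \<and> (\<forall>t. cnt D t \<le> cnt C t)"

lemma cnt_insert: "finite D \<Longrightarrow> a \<notin> D \<Longrightarrow> cnt (insert a D) t = cnt D t + (if t \<le> a then 1 else 0)"
  by (simp add: cnt_def Int_insert_left)

lemma cnt_mono: "finite C \<Longrightarrow> D \<subseteq> C \<Longrightarrow> cnt D t \<le> cnt C t"
  unfolding cnt_def by (intro card_mono) auto

lemma dominates_subset: "dominates C D \<Longrightarrow> E \<subseteq> D \<Longrightarrow> dominates C E"
  unfolding dominates_def using cnt_mono by (meson finite_subset le_trans)

text \<open>Cars park in decreasing order of their preferences, so a free spot above the next
  preference exists by counting.\<close>

lemma park_properties:
  assumes "dominates C D"
  shows "park C D \<subseteq> C" "card (park C D) = card D" "cnt D t \<le> cnt (park C D) t"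
    "\<And>a. (\<forall>d\<in>D. a \<le> d) \<Longrightarrow> (\<forall>d\<in>park C D. a \<le> d)"
proof -
  have fin: "finite D" "finite C" using assms by (auto simp: dominates_def)
  have "dominates C D \<Longrightarrow> park C D \<subseteq> C \<and> card (park C D) = card D \<and> (\<forall>t. cnt D t \<le> cnt (park C D) t) \<and>
      (\<forall>a. (\<forall>d\<in>D. a \<le> d) \<longrightarrow> (\<forall>d\<in>park C D. a \<le> d))"
    using fin(1)
  proof (induction D rule: finite_linorder_min_induct)
    case empty
    then show ?case by (simp add: cnt_def)
  next
    case (insert a D)
    have IH: "park C D \<subseteq> C" "card (park C D) = card D" "\<And>t. cnt D t \<le> cnt (park C D) t"
      "\<And>u. (\<forall>d\<in>D. u \<le> d) \<Longrightarrow> (\<forall>d\<in>park C D. u \<le> d)"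
      using insert.IH dominates_subset[OF insert.prems] by blast+
    have aD: "a \<notin> D" using insert by auto
    have fp: "finite (park C D)" using IH(1) fin(2) finite_subset by blast
    have low: "\<forall>d\<in>park C D. a \<le> d" using IH(4)[of a] insert(2) by (simp add: less_imp_le)
    show ?case
    proof (cases rule: first_free_cases[of C a "park C D"])
      case 1
      have "C \<inter> {a..} \<subseteq> park C D" using 1(2) by auto
      then have "cnt C a \<le> card (park C D)" unfolding cnt_def by (intro card_mono fp)
      moreover have "cnt (insert a D) a = Suc (card D)"
      proof -
        have "insert a D \<inter> {a..} = insert a D" using insert(2) by (auto simp: less_imp_le)
        then show ?thesis using aD insert(1) by (simp add: cnt_def)
      qed
      ultimately show ?thesis using insert.prems IH(2) unfolding dominates_def by (metis Suc_n_not_le_n le_trans)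
    next
      case (2 x)
      have P: "park C (insert a D) = insert x (park C D)"
        using park_insert[OF insert(1) aD] 2 by (simp add: park_step_def)
      show ?thesis unfolding P
      proof (intro conjI allI impI)
        show "insert x (park C D) \<subseteq> C" using 2 IH by simp
        show "card (insert x (park C D)) = card (insert a D)" using 2 IH fp aD insert(1) by simp
        show "cnt (insert a D) t \<le> cnt (insert x (park C D)) t" for t
          using cnt_insert[OF insert(1) aD, of t] cnt_insert[OF fp 2(3), of t] IH(3)[of t] 2(4)
          by (auto split: if_splits)
        show "\<forall>d\<in>insert x (park C D). u \<le> d" if "\<forall>d\<in>insert a D. u \<le> d" for u
          using that 2(4) low by auto
      qed
    qed
  qed
  then show "park C D \<subseteq> C" "card (park C D) = card D" "cnt D t \<le> cnt (park C D) t"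
    "\<And>a. (\<forall>d\<in>D. a \<le> d) \<Longrightarrow> (\<forall>d\<in>park C D. a \<le> d)" using assms by blast+
qed

text \<open>The first two hypotheses say that no free spot lies between \<open>a\<close> and the
  previous choice \<open>b\<close>. Hence the demand of exceeding \<open>b\<close> is equivalent to
  the demand that the spot be free.\<close>

lemma pick_first_free:
  assumes "\<forall>x\<in>C. a \<le> x \<longrightarrow> x \<le> b \<longrightarrow> x \<in> P" "\<forall>x\<in>P. x \<le> b"
    and "finite D" "\<forall>t. cnt (insert a D) t \<le> cnt (C - P) t"
  defines "x \<equiv> LEAST x. x \<in> C \<and> a \<le> x \<and> b < x"
  shows "x \<in> C" "a \<le> x" "b < x" "x \<notin> P" "\<And>y. y \<in> C \<Longrightarrow> a \<le> y \<Longrightarrow> b < y \<Longrightarrow> x \<le> y"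
    "first_free C a P = {x}"
proof -
  have e: "\<exists>x. x \<in> C - P \<and> a \<le> x"
  proof (rule ccontr)
    assume "\<not> ?thesis"
    then have "(C - P) \<inter> {a..} = {}" by auto
    then have "insert a D \<inter> {a..} = {}" using assms(4)[rule_format, of a] assms(3) by (simp add: cnt_def)
    then show False by auto
  qed
  then obtain y where y: "y \<in> C" "y \<notin> P" "a \<le> y" by auto
  then have "y \<in> C \<and> a \<le> y \<and> b < y" using assms(1) by (meson not_le)
  then have x: "x \<in> C \<and> a \<le> x \<and> b < x" unfolding x_def by (rule LeastI)
  then show xs: "x \<in> C" "a \<le> x" "b < x" by simp_all
  then show xP: "x \<notin> P" using assms(2) by (meson not_le)
  show le: "x \<le> y" if "y \<in> C" "a \<le> y" "b < y" for y
    unfolding x_def using that by (intro Least_le) simp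
  show "first_free C a P = {x}"
  proof (rule first_free_eqI[OF xs(1) xP xs(2)])
    fix y assume y: "y \<in> C" "y \<notin> P" "a \<le> y"
    then have "b < y" using assms(1) by (meson not_le)
    then show "x \<le> y" using y le by simp
  qed
qed

text \<open>When the cars park in increasing order of preference, the greedy rule of the left key
  picks exactly their spots. The induction carries the occupied spots \<open>P\<close> and Hall's
  condition for the free ones.\<close>

lemma pick_eq_fold:
  assumes "sorted_wrt (<) (a # as)" "finite C"
    and "\<forall>x\<in>C. a \<le> x \<longrightarrow> x \<le> b \<longrightarrow> x \<in> P" "\<forall>x\<in>P. x \<le> b"
    and "\<forall>t. cnt (set (a # as)) t \<le> cnt (C - P) t"
  shows "P \<union> set (pick C b (a # as)) = Finite_Set.fold (park_step C) P (set (a # as))"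
  using assms
proof (induction as arbitrary: a b P)
  case Nil
  define x where "x = (LEAST x. x \<in> C \<and> a \<le> x \<and> b < x)"
  have "first_free C a P = {x}" unfolding x_def
    by (rule pick_first_free(6)[OF Nil(3,4) finite.emptyI]) (use Nil(5) in simp_all)
  then show ?case by (simp add: park_step_def x_def Let_def)
next
  case (Cons a' as)
  define x where "x = (LEAST x. x \<in> C \<and> a \<le> x \<and> b < x)"
  have dom: "\<forall>t. cnt (insert a (set (a' # as))) t \<le> cnt (C - P) t"
    using Cons.prems(5) by simp
  note x = pick_first_free[OF Cons.prems(3,4) finite_set dom, folded x_def]
  have aa: "a < a'" "a \<notin> set (a' # as)" using Cons.prems(1) by auto
  have "insert x P \<union> set (pick C x (a' # as)) = Finite_Set.fold (park_step C) (insert x P) (set (a' # as))"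
  proof (rule Cons.IH)
    show "sorted_wrt (<) (a' # as)" using Cons.prems(1) by simp
    show "\<forall>y\<in>C. a' \<le> y \<longrightarrow> y \<le> x \<longrightarrow> y \<in> insert x P"
    proof (intro ballI impI)
     fix y assume y: "y \<in> C" "a' \<le> y" "y \<le> x"
     show "y \<in> insert x P"
     proof (cases "y \<le> b")
      case True
      then show ?thesis using Cons.prems(3) y(1,2) aa(1) by simp
    next
      case False
      then have "x \<le> y" using x(5)[OF y(1)] y(2) aa(1) by simp
      then show ?thesis using y(3) by simp
     qed
    qed
    show "\<forall>y\<in>insert x P. y \<le> x"
      using Cons.prems(4) x(3) by (metis insertE less_imp_le le_trans order_refl)
    have c1: "cnt (set (a # a' # as)) t = cnt (set (a' # as)) t + (if t \<le> a then 1 else 0)" for t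
      using cnt_insert[OF _ aa(2), of t] by simp
    have c2: "cnt (C - P) t = cnt (C - insert x P) t + (if t \<le> x then 1 else 0)" for t
    proof -
      have "insert x (C - insert x P) = C - P" using x(1,4) by blast
      then show ?thesis using cnt_insert[of "C - insert x P" x t] assms(2) by simp
    qed
    \<comment> \<open>Between \<open>a\<close> and \<open>x\<close> nothing is free, so for
      thresholds in this range the free spots are those counted at \<open>a\<close>, and there the
      departure of the car \<open>a\<close> makes up for the loss of the spot
      \<open>x\<close>.\<close>
    have "cnt (set (a' # as)) t \<le> cnt (C - insert x P) t" for t
    proof (cases "a < t \<and> t \<le> x")
      case True
      have "t \<le> y" if "y \<in> C" "y \<notin> P" "a \<le> y" for y
      proof -
        have "\<not> y \<le> b" using Cons.prems(3) that by blast
        then show ?thesis using x(5)[OF that(1,3)] True by simp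
      qed
      then have "(C - P) \<inter> {t..} = (C - P) \<inter> {a..}" using True by force
      then have "cnt (C - P) t = cnt (C - P) a" by (simp add: cnt_def)
      moreover have "cnt (set (a' # as)) t \<le> cnt (set (a' # as)) a"
        unfolding cnt_def using True by (intro card_mono) auto
      ultimately show ?thesis using Cons.prems(5)[rule_format, of a] c1[of a] c2[of t] True by simp
    next
      case False
      then show ?thesis using Cons.prems(5)[rule_format, of t] c1[of t] c2[of t] x(2) by (simp split: if_splits)
    qed
    then show "\<forall>t. cnt (set (a' # as)) t \<le> cnt (C - insert x P) t" by blast
  qed (rule assms(2))
  moreover have "Finite_Set.fold (park_step C) P (set (a # a' # as)) =
     Finite_Set.fold (park_step C) (park_step C a P) (set (a' # as))"
    using park.fold_insert2[OF finite_set aa(2), of C P] by simp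
  moreover have "park_step C a P = insert x P" using x(6) by (simp add: park_step_def)
  moreover have "P \<union> set (pick C b (a # a' # as)) = insert x P \<union> set (pick C x (a' # as))"
    unfolding pick.simps(2)[of C b] Let_def[of "LEAST x. x \<in> C \<and> a \<le> x \<and> b < x"] x_def[symmetric] by simp
  ultimately show ?case by simp
qed

lemma tri_eq_park:
  assumes "dominates C D" "0 \<notin> C"
  shows "C \<lhd>\<^sub>k D = park C D"
proof -
  have fin: "finite D" "finite C" and dom: "\<And>t. cnt D t \<le> cnt C t" using assms by (auto simp: dominates_def)
  show ?thesis
  proof (cases "sorted_list_of_set D")
    case Nil
    then show ?thesis using fin by (simp add: tri_def)
  next
    case (Cons a as)
    have D: "set (a # as) = D" using fin Cons by (metis set_sorted_list_of_set)
    have "{} \<union> set (pick C 0 (a # as)) = Finite_Set.fold (park_step C) {} (set (a # as))"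
    proof (rule pick_eq_fold)
      show "sorted_wrt (<) (a # as)" unfolding Cons[symmetric] by (rule strict_sorted_list_of_set)
      show "\<forall>x\<in>C. a \<le> x \<longrightarrow> x \<le> 0 \<longrightarrow> x \<in> {}" using assms(2) by (metis le_zero_eq)
      show "\<forall>t. cnt (set (a # as)) t \<le> cnt (C - {}) t" using dom D by simp
    qed (use fin in simp_all)
    then show ?thesis using D Cons by (simp add: tri_def park_def)
  qed
qed

text \<open>Park the cars of \<open>D\<close>, then \<open>Min (F - D)\<close>, then the rest of
  \<open>F\<close>. The middle car takes the least free spot \<open>x\<close> from its preference
  on. Later cars have larger preferences, so all further new spots lie above
  \<open>x\<close>.\<close>

lemma park_insert_Min:
  assumes "dominates C F" "D \<subseteq> F" "F \<noteq> D"
  defines "Q \<equiv> park C D" and "R \<equiv> park C F"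
  shows "Q \<subseteq> R" "R \<noteq> Q" "park C (insert (Min (F - D)) D) = insert (Min (R - Q)) Q"
proof -
  have fin: "finite F" "finite C" "finite D" "finite (F - D)" using assms finite_subset by (auto simp: dominates_def)
  define a where "a = Min (F - D)"
  have ne: "F - D \<noteq> {}" using assms by auto
  have a: "a \<in> F - D" unfolding a_def using fin ne by (intro Min_in)
  have low: "a \<le> e" if "e \<in> F - D" for e unfolding a_def using fin that by (intro Min_le)
  have F: "F = insert a D \<union> (F - insert a D)" using a assms(2) by auto
  have domD: "dominates C D" "dominates C (insert a D)"
    using dominates_subset[OF assms(1)] assms(2) a by auto
  have step: "park C (insert a D) = park_step C a Q"
    unfolding Q_def using a fin by (intro park_insert) auto
  have cardQ: "card (park C (insert a D)) = Suc (card Q)"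
    unfolding Q_def using park_properties(2)[OF domD(1)] park_properties(2)[OF domD(2)] a fin by simp
  obtain x where x: "first_free C a Q = {x}" "x \<in> C" "x \<notin> Q" "a \<le> x"
    "\<And>y. y \<in> C \<Longrightarrow> y \<notin> Q \<Longrightarrow> a \<le> y \<Longrightarrow> x \<le> y"
  proof (cases rule: first_free_cases[of C a Q])
    case 1
    then show ?thesis using cardQ step by (simp add: park_step_def)
  next
    case (2 x)
    then show ?thesis by (rule that)
  qed
  have ins: "park C (insert a D) = insert x Q" using step x by (simp add: park_step_def)
  have R: "R = Finite_Set.fold (park_step C) (insert x Q) (F - insert a D)"
    unfolding R_def by (subst F, subst park_union) (use fin ins in auto)
  have sub: "insert x Q \<subseteq> R"
    unfolding R using fin low by (intro fold_park_step_bounds(1)[where a = a]) auto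
  have bd: "y \<in> insert x Q \<or> y \<in> C \<and> a \<le> y" if "y \<in> R" for y
    using that unfolding R by (intro fold_park_step_bounds(2)) (use fin low in auto)
  have finR: "finite R" using park_properties(1)[OF assms(1)] fin finite_subset unfolding R_def by blast
  have "Min (R - Q) = x"
  proof (rule Min_eqI)
    fix y assume y: "y \<in> R - Q"
    then have "y = x \<or> y \<in> C \<and> a \<le> y" using bd[of y] by auto
    then show "x \<le> y" using x(5)[of y] y by auto
  qed (use finR sub x(3) in auto)
  then show "Q \<subseteq> R" "R \<noteq> Q" "park C (insert (Min (F - D)) D) = insert (Min (R - Q)) Q"
    using sub x ins unfolding a_def by auto
qed

section \<open>Left keys by iterated parking\<close>

definition lkey :: "(nat \<Rightarrow> nat set) \<Rightarrow> nat \<Rightarrow> nat \<Rightarrow> nat set" where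
  "lkey C j k = foldr park (map C [j..<k]) (C k)"

lemma lkey_refl [simp]: "lkey C k k = C k"
  by (simp add: lkey_def)

lemma lkey_less: "j < k \<Longrightarrow> lkey C j k = park (C j) (lkey C (Suc j) k)"
  by (simp add: lkey_def upt_conv_Cons)

definition dominance_chain :: "(nat \<Rightarrow> nat set) \<Rightarrow> bool" where
  "dominance_chain C \<longleftrightarrow> (\<forall>k\<ge>1. dominates (C k) (C (Suc k)))"

lemma lkey_properties:
  assumes "dominance_chain C" "1 \<le> j" "j \<le> k"
  shows "lkey C j k \<subseteq> C j \<and> card (lkey C j k) = card (C k) \<and> (\<forall>t. cnt (C k) t \<le> cnt (lkey C j k) t) \<and>
    (\<forall>a. (\<forall>d\<in>C k. a \<le> d) \<longrightarrow> (\<forall>d\<in>lkey C j k. a \<le> d))"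
  using assms(3,2)
proof (induction j rule: inc_induct)
  case base
  then show ?case by simp
next
  case (step j)
  then have IH: "lkey C (Suc j) k \<subseteq> C (Suc j)" "card (lkey C (Suc j) k) = card (C k)"
    "\<forall>t. cnt (C k) t \<le> cnt (lkey C (Suc j) k) t"
    "\<And>a. (\<forall>d\<in>C k. a \<le> d) \<Longrightarrow> (\<forall>d\<in>lkey C (Suc j) k. a \<le> d)" by auto
  have "dominates (C j) (C (Suc j))" using assms(1) step by (simp add: dominance_chain_def)
  then have dom: "dominates (C j) (lkey C (Suc j) k)" using IH(1) by (rule dominates_subset)
  show ?case unfolding lkey_less[OF step(2)]
    using park_properties[OF dom] IH(2-4) by (metis le_trans)
qed

lemma dominates_lkey:
  assumes "dominance_chain C" "1 \<le> j" "j < k"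
  shows "dominates (C j) (lkey C (Suc j) k)"
proof -
  have "dominates (C j) (C (Suc j))" using assms by (simp add: dominance_chain_def)
  then show ?thesis using lkey_properties[OF assms(1), of "Suc j" k] assms by (auto intro: dominates_subset)
qed

lemma foldr_tri_eq_lkey:
  assumes "dominance_chain C" "1 \<le> j" "j \<le> k" "\<And>k. 0 \<notin> C k"
  shows "foldr (\<lhd>\<^sub>k) (map C [j..<k]) (C k) = lkey C j k"
  using assms(3,2)
proof (induction j rule: inc_induct)
  case base
  then show ?case by simp
next
  case (step j)
  then have "foldr (\<lhd>\<^sub>k) (map C [j..<k]) (C k) = C j \<lhd>\<^sub>k lkey C (Suc j) k"
    by (simp add: upt_conv_Cons)
  also have "\<dots> = lkey C j k"
    using tri_eq_park[OF dominates_lkey[OF assms(1) step(4,2)] assms(4)] lkey_less[OF step(2)] by simp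
  finally show ?case .
qed

section \<open>Left keys of the letters that have arrived so far\<close>

definition trunc :: "nat \<Rightarrow> (nat \<Rightarrow> nat set) \<Rightarrow> nat \<Rightarrow> nat set" where
  "trunc z C k = C k \<inter> {z..}"

lemma trunc_step: "trunc z C k = (if z \<in> C k then insert z (trunc (Suc z) C k) else trunc (Suc z) C k)"
  by (auto simp: trunc_def Suc_le_eq le_less)

text \<open>No car takes a spot below its preference, so the newest and smallest letter is of no use
  as a spot to the cars that came before it.\<close>

lemma park_insert_small:
  assumes "finite D" "\<forall>d\<in>D. z < d"
  shows "park (insert z C) D = park C D"
  using assms
proof (induction D rule: finite_induct)
  case (insert a D)
  have "z < a" using insert.prems by simp
  then have "first_free (insert z C) a P = first_free C a P" for P
    unfolding first_free_def by auto
  then show ?case using insert by (simp add: park_insert park_step_def)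
qed simp

lemma park_trunc:
  assumes "finite D" "\<forall>d\<in>D. z < d"
  shows "park (trunc z C k) D = park (trunc (Suc z) C k) D"
  using park_insert_small[OF assms] trunc_step[of z C k] by simp

lemma lkey_trunc_large:
  assumes "dominance_chain (trunc (Suc z) C)" "1 \<le> j" "j \<le> k"
  shows "finite (lkey (trunc (Suc z) C) j k)" "\<forall>d\<in>lkey (trunc (Suc z) C) j k. z < d"
proof -
  have "lkey (trunc (Suc z) C) j k \<subseteq> trunc (Suc z) C j" using lkey_properties[OF assms] by blast
  moreover have "finite (trunc (Suc z) C j)"
    using assms(1,2) unfolding dominance_chain_def dominates_def by blast
  ultimately show "finite (lkey (trunc (Suc z) C) j k)" "\<forall>d\<in>lkey (trunc (Suc z) C) j k. z < d"
    using finite_subset by (blast, auto simp: trunc_def)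
qed

lemma lkey_step_absent:
  assumes "dominance_chain (trunc (Suc z) C)" "z \<notin> C k" "1 \<le> j" "j \<le> k"
  shows "lkey (trunc z C) j k = lkey (trunc (Suc z) C) j k"
  using assms(4,3)
proof (induction j rule: inc_induct)
  case base
  then show ?case using trunc_step[of z C k] assms(2) by simp
next
  case (step j)
  then show ?case
    using park_trunc[OF lkey_trunc_large[OF assms(1), of "Suc j" k], of C j] by (simp add: lkey_less)
qed

text \<open>Induction on \<open>j\<close> downwards from \<open>k\<close>. At \<open>j = k\<close>
  the letter \<open>z\<close> is a new car whose preference is below all spots, so it takes the
  least free one. Every column further left transports the statement by
  \<open>park_insert_Min\<close>; the strict inclusion guarantees that the minimum exists.\<close>

lemma lkey_step_present:
  assumes "dominance_chain (trunc (Suc z) C)" "dominance_chain (trunc z C)" "z \<in> C (Suc k)" "1 \<le> j" "j \<le> k"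
  shows "lkey (trunc (Suc z) C) j (Suc k) \<subset> lkey (trunc z C) j k \<and>
    lkey (trunc z C) j (Suc k) =
      insert (Min (lkey (trunc z C) j k - lkey (trunc (Suc z) C) j (Suc k))) (lkey (trunc (Suc z) C) j (Suc k))"
  using assms(5,4)
proof (induction j rule: inc_induct)
  case base
  let ?D = "trunc (Suc z) C (Suc k)" and ?F = "trunc z C k"
  have D: "finite ?D" "z \<notin> ?D" "\<forall>d\<in>?D. z < d"
    using lkey_trunc_large[OF assms(1), of "Suc k" "Suc k"] by (auto simp: trunc_def)
  have F: "finite ?F" "\<forall>d\<in>?F. z \<le> d"
    using assms(2) base unfolding dominance_chain_def dominates_def by (auto simp: trunc_def)
  have Q: "lkey (trunc (Suc z) C) k (Suc k) = park ?F ?D"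
    using park_trunc[OF D(1,3)] by (simp add: lkey_less)
  have C1: "trunc z C (Suc k) = insert z ?D" using trunc_step[of z C "Suc k"] assms(3) by simp
  have dom: "dominates ?F (insert z ?D)"
    using assms(2) base unfolding dominance_chain_def C1[symmetric] by blast
  have ins: "lkey (trunc z C) k (Suc k) = park_step ?F z (park ?F ?D)"
    using park_insert[OF D(1,2)] C1 by (simp add: lkey_less)
  have "card (park ?F (insert z ?D)) = Suc (card (park ?F ?D))"
    using park_properties(2)[OF dom] park_properties(2)[OF dominates_subset[OF dom subset_insertI]] D by simp
  moreover have "card (park ?F (insert z ?D)) \<noteq> card (park ?F ?D)" using calculation by simp
  ultimately have ne: "first_free ?F z (park ?F ?D) \<noteq> {}"
    using park_insert[OF D(1,2), of ?F] by (auto simp: park_step_def)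
  obtain x where x: "first_free ?F z (park ?F ?D) = {x}" "x \<in> ?F" "x \<notin> park ?F ?D"
    "\<And>y. y \<in> ?F \<Longrightarrow> y \<notin> park ?F ?D \<Longrightarrow> z \<le> y \<Longrightarrow> x \<le> y"
    using ne by (cases rule: first_free_cases[of ?F z "park ?F ?D"]) auto
  have "Min (?F - park ?F ?D) = x"
  proof (rule Min_eqI)
    fix y assume "y \<in> ?F - park ?F ?D"
    then show "x \<le> y" using x(4)[of y] F(2) by blast
  qed (use F x(2,3) in auto)
  moreover have "park ?F ?D \<subset> ?F"
    using park_properties(1)[OF dominates_subset[OF dom subset_insertI]] x(2,3) by blast
  ultimately show ?case using ins x(1) by (simp add: Q park_step_def)
next
  case (step j)
  let ?C0 = "trunc (Suc z) C" and ?C1 = "trunc z C"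
  have IH: "lkey ?C0 (Suc j) (Suc k) \<subset> lkey ?C1 (Suc j) k"
    "lkey ?C1 (Suc j) (Suc k) =
      insert (Min (lkey ?C1 (Suc j) k - lkey ?C0 (Suc j) (Suc k))) (lkey ?C0 (Suc j) (Suc k))"
    using step by auto
  have dom: "dominates (?C1 j) (lkey ?C1 (Suc j) k)"
    using dominates_lkey[OF assms(2)] step by simp
  have Q: "lkey ?C0 j (Suc k) = park (?C1 j) (lkey ?C0 (Suc j) (Suc k))"
    using park_trunc[OF lkey_trunc_large[OF assms(1), of "Suc j" "Suc k"], of C j] step
    by (simp add: lkey_less)
  have R: "lkey ?C1 j k = park (?C1 j) (lkey ?C1 (Suc j) k)"
    "lkey ?C1 j (Suc k) = park (?C1 j) (lkey ?C1 (Suc j) (Suc k))"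
    using step by (simp_all add: lkey_less)
  have ne: "lkey ?C1 (Suc j) k \<noteq> lkey ?C0 (Suc j) (Suc k)" using IH(1) by auto
  show ?case
    unfolding R Q IH(2) using park_insert_Min[OF dom psubset_imp_subset[OF IH(1)] ne] by auto
qed

text \<open>The labels at site \<open>k\<close> before the emission are the difference between the
  updated column \<open>k\<close> and the old column \<open>k + 1\<close>. Emitting the least of
  them is therefore the update rule of the left key.\<close>

lemma key_columns_run:
  assumes "length es = length As" "proper L As" "finite L" "finite c" "c \<inter> L = {}" "emits (c \<noteq> {}) As es"
  shows "key_columns (run c As es) 0 = c \<union> L"
    and "key_columns (run c As es) (Suc k) =
      (if k < length As \<and> es ! k
       then insert (Min (key_columns (run c As es) k - key_columns As (Suc k))) (key_columns As (Suc k))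
       else key_columns As (Suc k))"
    and "proper (c \<union> L) (run c As es)"
  using assms
proof (induction c As es arbitrary: L k rule: run.induct)
  case (1 c A As e es)
  let ?o = "if e then {Min (A \<union> c)} else {}"
  { fix L assume prems: "length (e # es) = length (A # As)" "proper L (A # As)" "finite L" "finite c"
      "c \<inter> L = {}" "emits (c \<noteq> {}) (A # As) (e # es)"
    have A: "A \<subseteq> L" "proper (L - A) As" "finite (L - A)" "finite (A \<union> c)"
      using prems by (auto intro: finite_subset)
    have o: "?o \<subseteq> A \<union> c" using prems(6) Min_in[OF A(4)] by auto
    have "?o \<inter> (L - A) = {}" "finite ?o" "emits (?o \<noteq> {}) As es" "length es = length As"
      using o prems A by auto
    note * = A o this } note * = this
  { case 1
    note p = *[OF this]
    show ?case using "1.IH"(1)[OF p(9,2,3,7,6,8)] p(1,5) by (auto simp: key_columns_def)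
  next
    case 2
    note p = *[OF this]
    show ?case
    proof (cases k)
      case 0
      have U: "\<Union>(set As) = L - A" using proper_Union[OF p(2)] .
      have kc0: "key_columns (run c (A # As) (e # es)) 0 = c \<union> L"
        using "1.IH"(1)[OF p(9,2,3,7,6,8)] p(1,5) by (auto simp: key_columns_def)
      have diff: "c \<union> L - (L - A) = A \<union> c" using 2 p(1) by auto
      have kc1: "key_columns (run c (A # As) (e # es)) (Suc 0) = ?o \<union> (L - A)"
        using "1.IH"(1)[OF p(9,2,3,7,6,8)] by (simp add: key_columns_def)
      have kcA: "key_columns (A # As) (Suc 0) = L - A" using U by (simp add: key_columns_def)
      show ?thesis unfolding 0 kc0 kc1 kcA diff by simp
    next
      case (Suc k')
      show ?thesis using "1.IH"(2)[OF p(9,2,3,7,6,8), of k'] unfolding Suc by (simp add: key_columns_def)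
    qed
  next
    case 3
    note p = *[OF this]
    have "c \<union> L - (A \<union> c - ?o) = ?o \<union> (L - A)" using p(1,5) 3 by auto
    moreover have "proper (?o \<union> (L - A)) (run ?o As es)" by (rule "1.IH"(3)[OF p(9,2,3,7,6,8)])
    ultimately show ?case using p(1) by auto
  }
next
  case ("2_1" c es)
  { case 1 then show ?case by (simp add: key_columns_def)
  next case 2 then show ?case by (simp add: key_columns_def)
  next case 3 then show ?case by simp }
next
  case ("2_2" c As)
  { case 1 then show ?case by (simp add: key_columns_def)
  next case 2 then show ?case by (simp add: key_columns_def)
  next case 3 then show ?case by simp }
qed

lemma emits_iff:
  assumes "length es = length As"
  shows "emits p As es \<longleftrightarrow>
    (\<forall>k<length As. es ! k \<longrightarrow> As ! k \<noteq> {} \<or> (if k = 0 then p else es ! (k - 1))) \<and>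
    (if As = [] then \<not> p else \<not> last es)"
  using assms
proof (induction p As es rule: emits.induct)
  case (1 p A As e es)
  then have l: "length es = length As" by simp
  have "(\<forall>k<length (A # As). (e # es) ! k \<longrightarrow> (A # As) ! k \<noteq> {} \<or> (if k = 0 then p else (e # es) ! (k - 1))) \<longleftrightarrow>
     (e \<longrightarrow> A \<noteq> {} \<or> p) \<and> (\<forall>k<length As. es ! k \<longrightarrow> As ! k \<noteq> {} \<or> (if k = 0 then e else es ! (k - 1)))"
    by (subst all_nat_iff) (auto simp: nth_Cons split: nat.splits)
  moreover have "(if As = [] then \<not> e else \<not> last es) \<longleftrightarrow> \<not> last (e # es)" using l by (cases As) auto
  ultimately show ?case using 1(1)[OF l] by auto
qed auto

lemma emit_weight_eq_prod:
  assumes "length es = length As"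
  shows "emit_weight t x p As es = (\<Prod>k<length As.
    (if \<not> (if k = 0 then p else es ! (k - 1)) \<and> As ! k \<noteq> {} then 1 + t * x else 1) * (if es ! k then x else 1))"
  using assms
proof (induction t x p As es rule: emit_weight.induct)
  case (1 t x p A As e es)
  then have l: "length es = length As" by simp
  have "(\<Prod>k<length As. (if \<not> (if Suc k = 0 then p else (e # es) ! (Suc k - 1)) \<and> (A # As) ! Suc k \<noteq> {}
        then 1 + t * x else 1) * (if (e # es) ! Suc k then x else 1)) =
    (\<Prod>k<length As. (if \<not> (if k = 0 then e else es ! (k - 1)) \<and> As ! k \<noteq> {}
        then 1 + t * x else 1) * (if es ! k then x else 1))"
    by (intro prod.cong) (auto simp: nth_Cons split: nat.splits)
  then show ?case using 1(1)[OF l] by (simp add: prod.lessThan_Suc_shift del: prod.lessThan_Suc)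
qed auto

text \<open>The dominance condition at the single threshold \<open>z\<close>. The exclusion of
  \<open>z\<close> from column \<open>n\<close> says that no carrier leaves the last site.\<close>

definition letter_ok :: "nat \<Rightarrow> (nat \<Rightarrow> nat set) \<Rightarrow> nat \<Rightarrow> bool" where
  "letter_ok n C z \<longleftrightarrow> (\<forall>k\<ge>1. cnt (C (Suc k)) z \<le> cnt (C k) z) \<and> z \<notin> C n"

text \<open>For \<open>k < n\<close> the inequality says that site \<open>k\<close> holds a label
  when \<open>z\<close> arrives, that is, the current key has a row of length exactly
  \<open>k\<close>.\<close>

definition letter_weight :: "'r::comm_ring_1 \<Rightarrow> 'r \<Rightarrow> nat \<Rightarrow> (nat \<Rightarrow> nat set) \<Rightarrow> nat \<Rightarrow> 'r" where
  "letter_weight t x n C z = (\<Prod>k\<in>{1..n}. (if z \<in> C k then x else 1) *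
     (if z \<notin> C k \<and> cnt (C (Suc k)) (Suc z) < cnt (C k) (Suc z) then 1 + t * x else 1))"

lemma cnt_trunc: "cnt (trunc z C k) t = cnt (C k) (max z t)"
  unfolding cnt_def trunc_def by (rule arg_cong[where f = card]) auto

text \<open>The invariant after the rows of the letters from \<open>N\<close> down to
  \<open>m + 1\<close>.\<close>

definition key_state :: "nat \<Rightarrow> nat \<Rightarrow> (nat \<Rightarrow> nat set) \<Rightarrow> nat \<Rightarrow> nat set list \<Rightarrow> bool" where
  "key_state n N C m As \<longleftrightarrow> length As = n \<and> proper {Suc m..N} As \<and>
     dominance_chain (trunc (Suc m) C) \<and> (\<forall>k\<ge>1. key_columns As k = lkey (trunc (Suc m) C) 1 k)"

lemma nth_eq_empty_iff:
  assumes "proper L As" "finite L" "k < length As"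
  shows "As ! k \<noteq> {} \<longleftrightarrow> card (key_columns As (Suc k)) < card (key_columns As k)"
  using assms
proof (induction As arbitrary: L k)
  case (Cons A As)
  show ?case
  proof (cases k)
    case 0
    have U: "\<Union>(set As) = L - A" using proper_Union[of "L - A" As] Cons.prems by simp
    have A: "A \<subseteq> L" "finite A" using Cons.prems by (auto intro: finite_subset)
    have "A \<noteq> {} \<longleftrightarrow> L - A \<subset> L" using A(1) by auto
    also have "\<dots> \<longleftrightarrow> card (L - A) < card L"
    proof
      show "card (L - A) < card L" if "L - A \<subset> L" using Cons.prems(2) that by (rule psubset_card_mono)
      show "L - A \<subset> L" if "card (L - A) < card L" using that by (intro psubsetI) auto
    qed
    finally show ?thesis unfolding 0 using U A(1) by (simp add: key_columns_def Un_absorb1)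
  next
    case (Suc k')
    then show ?thesis using Cons.IH[of "L - A" k'] Cons.prems by (simp add: key_columns_def)
  qed
qed simp

section \<open>The model follows the left key of a fixed filling\<close>

context
  fixes n N :: nat and C :: "nat \<Rightarrow> nat set"
  assumes C: "C \<in> fillings n N" and n: "1 \<le> n"
begin

lemma finite_filling: "finite (C k)"
  using C by (auto simp: fillings_def intro: finite_subset)

lemma filling_beyond: "n < k \<Longrightarrow> C k = {}"
  using C by (auto simp: fillings_def)

lemma key_stateD:
  assumes "key_state n N C m As"
  shows "length As = n" "proper {Suc m..N} As" "dominance_chain (trunc (Suc m) C)"
    "1 \<le> k \<Longrightarrow> key_columns As k = lkey (trunc (Suc m) C) 1 k"
  using assms unfolding key_state_def by blast+

lemma card_key_columns:
  assumes "key_state n N C m As" "1 \<le> k"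
  shows "card (key_columns As k) = cnt (C k) (Suc m)"
proof -
  have "card (lkey (trunc (Suc m) C) 1 k) = card (trunc (Suc m) C k)"
    using lkey_properties[OF key_stateD(3)[OF assms(1)] order_refl assms(2)] by blast
  then show ?thesis unfolding key_stateD(4)[OF assms] by (simp only: trunc_def cnt_def)
qed

lemma key_state_last:
  assumes "key_state n N C m As"
  shows "trunc (Suc m) C n = {}"
proof -
  have "key_columns As n = {}" using key_stateD(1)[OF assms] by (simp add: key_columns_def)
  then have "cnt (C n) (Suc m) = 0" using card_key_columns[OF assms n] by simp
  then show ?thesis using finite_filling[of n] unfolding cnt_def trunc_def by simp
qed

lemma nth_state_iff:
  assumes "key_state n N C m As" "1 \<le> k" "k < n"
  shows "As ! k \<noteq> {} \<longleftrightarrow> cnt (C (Suc k)) (Suc m) < cnt (C k) (Suc m)"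
proof -
  have k: "k < length As" using assms(3) key_stateD(1)[OF assms(1)] by simp
  show ?thesis
    unfolding nth_eq_empty_iff[OF key_stateD(2)[OF assms(1)] finite_atLeastAtMost k]
    using card_key_columns[OF assms(1), of k] card_key_columns[OF assms(1), of "Suc k"] assms(2) by simp
qed

text \<open>From threshold \<open>z + 1\<close> to \<open>z\<close> a count grows by at most one.
  Dominance can thus fail only where \<open>z\<close> joins column \<open>k + 1\<close> but not
  column \<open>k\<close> and the counts were equal before, which is an emission from an empty site
  without carrier.\<close>

lemma emits_iff_letter_ok:
  assumes st: "key_state n N C z As"
  shows "emits True As (bits n C z) \<longleftrightarrow> letter_ok n C z"
proof -
  have len: "length As = n" using st by (simp add: key_state_def)
  have chain: "cnt (C (Suc k)) (Suc z) \<le> cnt (C k) (Suc z)" if "1 \<le> k" for k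
  proof -
    have "cnt (trunc (Suc z) C (Suc k)) 0 \<le> cnt (trunc (Suc z) C k) 0"
      using st that unfolding key_state_def dominance_chain_def dominates_def by blast
    then show ?thesis by (simp add: cnt_trunc)
  qed
  have lst: "last (bits n C z) \<longleftrightarrow> z \<in> C n"
    using n by (simp add: bits_def last_map)
  have 1: "(bits n C z ! k \<longrightarrow> As ! k \<noteq> {} \<or> (if k = 0 then True else bits n C z ! (k - 1))) \<longleftrightarrow>
      (1 \<le> k \<longrightarrow> cnt (C (Suc k)) z \<le> cnt (C k) z)" if k: "k < n" for k
  proof (cases "k = 0")
    case False
    then show ?thesis
      using k nth_state_iff[OF st, of k] chain[of k]
        cnt_Suc[OF finite_filling, of k z] cnt_Suc[OF finite_filling, of "Suc k" z]
      by auto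
  qed simp
  have 2: "cnt (C (Suc k)) z \<le> cnt (C k) z" if "n \<le> k" for k
    using filling_beyond[of "Suc k"] that by (simp add: cnt_def)
  have "emits True As (bits n C z) \<longleftrightarrow>
      (\<forall>k<n. bits n C z ! k \<longrightarrow> As ! k \<noteq> {} \<or> (if k = 0 then True else bits n C z ! (k - 1))) \<and> z \<notin> C n"
    unfolding emits_iff[of "bits n C z" As True, unfolded length_bits, OF len[symmetric]] len lst
    using len n by (cases As) simp_all
  also have "\<dots> \<longleftrightarrow> (\<forall>k<n. 1 \<le> k \<longrightarrow> cnt (C (Suc k)) z \<le> cnt (C k) z) \<and> z \<notin> C n"
    using 1 by (simp only: cong: conj_cong imp_cong)
  also have "(\<forall>k<n. 1 \<le> k \<longrightarrow> cnt (C (Suc k)) z \<le> cnt (C k) z) \<longleftrightarrow>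
      (\<forall>k\<ge>1. cnt (C (Suc k)) z \<le> cnt (C k) z)"
  proof
    assume *: "\<forall>k<n. 1 \<le> k \<longrightarrow> cnt (C (Suc k)) z \<le> cnt (C k) z"
    show "\<forall>k\<ge>1. cnt (C (Suc k)) z \<le> cnt (C k) z"
    proof (intro allI impI)
      fix k :: nat assume "1 \<le> k"
      then show "cnt (C (Suc k)) z \<le> cnt (C k) z" using * 2[of k] by (cases "k < n") simp_all
    qed
  qed simp
  finally show ?thesis unfolding letter_ok_def .
qed

text \<open>Two indexings meet here: an emission at site \<open>k\<close> pays for column
  \<open>k + 1\<close>, while the factor \<open>1 + t * x\<close> at site \<open>k\<close> belongs
  to column \<open>k\<close>. Both ends are neutral, as site 0 always receives the carrier and
  column \<open>n\<close> has no entry above \<open>z\<close>.\<close>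

lemma emit_weight_eq_letter_weight:
  assumes st: "key_state n N C z As"
  shows "emit_weight t x True As (bits n C z) = letter_weight t x n C z"
proof -
  have len: "length As = n" using st by (simp add: key_state_def)
  define f where "f k = (if z \<notin> C k \<and> cnt (C (Suc k)) (Suc z) < cnt (C k) (Suc z) then 1 + t * x else 1)" for k
  define g where "g k = (if z \<in> C k then x else 1)" for k
  have "emit_weight t x True As (bits n C z) = (\<Prod>k<n. (if k = 0 then 1 else f k) * g (Suc k))"
    unfolding emit_weight_eq_prod[of "bits n C z" As, unfolded length_bits, OF len[symmetric]] len
    by (intro prod.cong refl) (use nth_state_iff[OF st] in \<open>auto simp: f_def g_def\<close>)
  also have "\<dots> = (\<Prod>k<n. if k = 0 then 1 else f k) * (\<Prod>k<n. g (Suc k))"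
    by (rule prod.distrib)
  also have "(\<Prod>k<n. g (Suc k)) = (\<Prod>k\<in>{1..n}. g k)"
    by (rule prod.reindex_bij_witness[of _ "\<lambda>k. k - 1" Suc]) auto
  also have "(\<Prod>k<n. if k = 0 then 1 else f k) = (\<Prod>k\<in>{1..n}. f k)"
  proof (rule prod.mono_neutral_cong)
    have "trunc (Suc z) C n = {}" by (rule key_state_last[OF st])
    then have "f n = 1" by (simp add: f_def cnt_def trunc_def)
    then show "f k = 1" if "k \<in> {1..n} - {..<n}" for k
      using that by (cases "k = n") auto
  qed auto
  finally show ?thesis unfolding letter_weight_def f_def g_def prod.distrib by (simp add: mult.commute)
qed

lemma key_state_step:
  assumes st: "key_state n N C (Suc m) As" and ok: "letter_ok n C (Suc m)" and mN: "Suc m \<le> N"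
  shows "key_state n N C m (run {Suc m} As (bits n C (Suc m)))"
proof -
  let ?z = "Suc m"
  let ?es = "bits n C ?z"
  let ?Bs = "run {?z} As ?es"
  have len: "length As = n" and pr: "proper {Suc ?z..N} As"
    and ch: "dominance_chain (trunc (Suc ?z) C)"
    and key: "\<And>k. 1 \<le> k \<Longrightarrow> key_columns As k = lkey (trunc (Suc ?z) C) 1 k"
    using st by (auto simp: key_state_def)
  have em: "emits ({?z} \<noteq> {}) As ?es" using emits_iff_letter_ok[OF st] ok by simp
  have l: "length ?es = length As" using len by simp
  have dj: "{?z} \<inter> {Suc ?z..N} = {}" by simp
  have un: "{?z} \<union> {Suc ?z..N} = {?z..N}" using mN by auto
  note kc = key_columns_run[OF l pr finite_atLeastAtMost _ dj em, unfolded un, simplified]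
  have ch': "dominance_chain (trunc ?z C)"
    unfolding dominance_chain_def dominates_def cnt_trunc
  proof (intro allI impI conjI)
    fix k t :: nat assume k: "1 \<le> k"
    show "cnt (C (Suc k)) (max ?z t) \<le> cnt (C k) (max ?z t)"
    proof (cases "t \<le> ?z")
      case True
      then show ?thesis using ok k by (simp add: letter_ok_def max_absorb1)
    next
      case False
      have "cnt (trunc (Suc ?z) C (Suc k)) t \<le> cnt (trunc (Suc ?z) C k) t"
        using ch k by (simp add: dominance_chain_def dominates_def)
      then show ?thesis using False by (simp add: cnt_trunc max_absorb2)
    qed
  qed (use finite_filling in \<open>auto simp: trunc_def\<close>)
  have keys: "key_columns ?Bs k = lkey (trunc ?z C) 1 k" if "1 \<le> k" for k
    using that
  proof (induction k rule: dec_induct)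
    case base
    show ?case
    proof (cases "?z \<in> C 1")
      case True
      have "key_columns As 1 = trunc (Suc ?z) C 1" using key[of 1] by simp
      moreover have "Min ({?z..N} - trunc (Suc ?z) C 1) = ?z"
        using mN by (intro Min_eqI) (auto simp: trunc_def)
      ultimately show ?thesis
        using kc(2)[of 0] kc(1) True n len trunc_step[of ?z C 1] by simp
    next
      case False
      then show ?thesis
        using kc(2)[of 0] n len trunc_step[of ?z C 1] key[of 1] by simp
    qed
  next
    case (step k)
    have k1: "k < n" if "?z \<in> C (Suc k)" using that filling_beyond[of "Suc k"] by (metis empty_iff not_less_eq)
    show ?case
    proof (cases "?z \<in> C (Suc k)")
      case True
      then show ?thesis
        using kc(2)[of k] k1 len step(3) key[of "Suc k"] step(1)
          lkey_step_present[OF ch ch' True, of 1] by simp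
    next
      case False
      then have "\<not> (k < length As \<and> ?es ! k)" using len by simp
      then have "key_columns ?Bs (Suc k) = key_columns As (Suc k)" using kc(2)[of k] by (simp only: if_False)
      then show ?thesis
        using key[of "Suc k"] lkey_step_absent[OF ch False, of 1] by simp
    qed
  qed
  show ?thesis unfolding key_state_def
    using length_run[OF l, of "{?z}"] len kc(3) ch' keys by simp
qed

lemma key_state_final:
  assumes "key_state n N C m As" "m \<le> N"
  shows "admissible n C m As \<longleftrightarrow> (\<forall>z\<in>{1..m}. letter_ok n C z)" (is ?P1)
    and "admissible n C m As \<Longrightarrow> key_state n N C 0 (final_state n C m As)"
    and "admissible n C m As \<Longrightarrow> filling_weight t x n C m As = (\<Prod>z\<in>{1..m}. letter_weight t (x z) n C z)"
proof -
  have "(admissible n C m As \<longleftrightarrow> (\<forall>z\<in>{1..m}. letter_ok n C z)) \<and>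
    (admissible n C m As \<longrightarrow> key_state n N C 0 (final_state n C m As) \<and>
      filling_weight t x n C m As = (\<Prod>z\<in>{1..m}. letter_weight t (x z) n C z))"
    using assms
  proof (induction m arbitrary: As)
    case 0
    then show ?case by simp
  next
    case (Suc m)
    have iff: "emits True As (bits n C (Suc m)) \<longleftrightarrow> letter_ok n C (Suc m)"
      by (rule emits_iff_letter_ok[OF Suc.prems(1)])
    have S: "{1..Suc m} = insert (Suc m) {1..m}" by auto
    show ?case
    proof (cases "letter_ok n C (Suc m)")
      case True
      have "key_state n N C m (run {Suc m} As (bits n C (Suc m)))"
        by (rule key_state_step[OF Suc.prems(1) True Suc.prems(2)])
      from Suc.IH[OF this] Suc.prems(2) True iff show ?thesis
        unfolding S by (simp add: emit_weight_eq_letter_weight[OF Suc.prems(1)])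
    qed (use iff S in auto)
  qed
  then show ?P1
    and "admissible n C m As \<Longrightarrow> key_state n N C 0 (final_state n C m As)"
    and "admissible n C m As \<Longrightarrow> filling_weight t x n C m As = (\<Prod>z\<in>{1..m}. letter_weight t (x z) n C z)"
    by auto
qed

lemma key_state_init: "key_state n N C N (replicate n {})"
proof -
  have e: "trunc (Suc N) C = (\<lambda>_. {})"
  proof
    fix k
    have "C k \<subseteq> {1..N}" using C by (simp add: fillings_def)
    then show "trunc (Suc N) C k = {}" by (auto simp: trunc_def)
  qed
  have d: "dominance_chain (\<lambda>_. {})" by (simp add: dominance_chain_def dominates_def)
  have l: "lkey (\<lambda>_. {}) 1 k = {}" if "1 \<le> k" for k
    using lkey_properties[OF d, of 1 k] that by blast
  have "key_columns (replicate n {}) k = {}" for k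
    by (simp add: key_columns_def)
  then show ?thesis
    unfolding key_state_def e using proper_replicate[of n] d l by simp
qed

end

section \<open>Evaluating the state sum\<close>

definition key_fillings :: "nat \<Rightarrow> nat \<Rightarrow> composition \<Rightarrow> (nat \<Rightarrow> nat set) set" where
  "key_fillings n N \<alpha> = {C \<in> fillings n N. dominance_chain C \<and> C n = {} \<and>
     (\<forall>k\<ge>1. column_le (lkey C 1 k) (key_col \<alpha> k))}"

definition extras :: "nat \<Rightarrow> nat \<Rightarrow> (nat \<Rightarrow> nat set) \<Rightarrow> (nat \<times> nat) set" where
  "extras n N C = {(k, z). k \<in> {1..n} \<and> z \<in> {1..N} \<and> z \<notin> C k \<and>
     cnt (C (Suc k)) (Suc z) < cnt (C k) (Suc z)}"

definition entries :: "(nat \<Rightarrow> nat set) \<Rightarrow> (nat \<times> nat) set" where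
  "entries C = {(k, z). z \<in> C k}"

lemma fillings_mem:
  assumes "C \<in> fillings n N" "z \<in> C k"
  shows "k \<in> {1..n}" "z \<in> {1..N}"
  using assms unfolding fillings_def by blast+

lemma finite_entries:
  assumes "C \<in> fillings n N"
  shows "finite (entries C)"
proof (rule finite_subset)
  show "entries C \<subseteq> {1..n} \<times> {1..N}" using fillings_mem[OF assms] by (auto simp: entries_def)
qed simp

lemma finite_extras: "finite (extras n N C)"
  by (rule finite_subset[of _ "{1..n} \<times> {1..N}"]) (auto simp: extras_def)

lemma trunc_1:
  assumes "C \<in> fillings n N"
  shows "trunc (Suc 0) C = C"
proof
  show "trunc (Suc 0) C k = C k" for k using fillings_mem(2)[OF assms, of _ k] by (auto simp: trunc_def)
qed

text \<open>Each letter checks dominance at its own threshold; threshold 0 agrees with threshold 1,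
  and beyond \<open>N\<close> nothing is counted.\<close>

lemma letter_ok_iff:
  assumes C: "C \<in> fillings n N"
  shows "(\<forall>z\<in>{1..N}. letter_ok n C z) \<longleftrightarrow> dominance_chain C \<and> C n = {}"
proof
  assume ok: "\<forall>z\<in>{1..N}. letter_ok n C z"
  have sub: "C k \<subseteq> {1..N}" for k using C by (simp add: fillings_def)
  have fin: "finite (C k)" for k using sub finite_subset by blast
  have 0: "cnt (C k) 0 = cnt (C k) 1" for k
    using cnt_Suc[OF fin, of k 0] sub[of k] by auto
  have "cnt (C (Suc k)) t \<le> cnt (C k) t" if k: "1 \<le> k" for k t
  proof (cases "t \<in> {1..N}")
    case True
    then show ?thesis using ok k by (simp add: letter_ok_def)
  next
    case False
    show ?thesis
    proof (cases "t = 0")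
      case True
      show ?thesis
      proof (cases "1 \<le> N")
        case True
        then have "cnt (C (Suc k)) 1 \<le> cnt (C k) 1" using ok k by (simp add: letter_ok_def)
        then show ?thesis using 0 \<open>t = 0\<close> by simp
      next
        case False
        then show ?thesis using sub[of "Suc k"] by (simp add: cnt_def)
      qed
    next
      case False
      then have "C (Suc k) \<inter> {t..} = {}" using sub[of "Suc k"] \<open>t \<notin> {1..N}\<close> by fastforce
      then show ?thesis by (simp add: cnt_def)
    qed
  qed
  then have "dominance_chain C" using fin by (simp add: dominance_chain_def dominates_def)
  moreover have "C n = {}" using ok sub[of n] by (auto simp: letter_ok_def)
  ultimately show "dominance_chain C \<and> C n = {}" ..
next
  assume "dominance_chain C \<and> C n = {}"
  then show "\<forall>z\<in>{1..N}. letter_ok n C z"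
    by (simp add: letter_ok_def dominance_chain_def dominates_def)
qed

lemma prod_letter_weight:
  fixes t :: "'r::comm_ring_1"
  assumes C: "C \<in> fillings n N"
  shows "(\<Prod>z\<in>{1..N}. letter_weight t (x z) n C z) =
    (\<Sum>Y\<in>Pow (extras n N C). (\<Prod>(k, z)\<in>entries C. x z) * (\<Prod>(k, z)\<in>Y. t * x z))"
proof -
  let ?I = "{1..N} \<times> {1..n}"
  have "(\<Prod>z\<in>{1..N}. letter_weight t (x z) n C z) =
      (\<Prod>(z, k)\<in>?I. if z \<in> C k then x z else 1) *
      (\<Prod>(z, k)\<in>?I. if z \<notin> C k \<and> cnt (C (Suc k)) (Suc z) < cnt (C k) (Suc z) then 1 + t * x z else 1)"
    unfolding letter_weight_def prod.distrib by (simp add: prod.cartesian_product)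
  also have "(\<Prod>(z, k)\<in>?I. if z \<in> C k then x z else 1) = (\<Prod>(z, k)\<in>{(z, k). z \<in> C k}. x z)"
  proof (rule prod.mono_neutral_cong_right)
    show "{(z, k). z \<in> C k} \<subseteq> ?I" using fillings_mem[OF C] by auto
  qed (auto split: if_splits)
  also have "\<dots> = (\<Prod>(k, z)\<in>entries C. x z)"
    by (rule prod.reindex_bij_witness[of _ prod.swap prod.swap]) (auto simp: entries_def)
  also have "(\<Prod>(z, k)\<in>?I. if z \<notin> C k \<and> cnt (C (Suc k)) (Suc z) < cnt (C k) (Suc z) then 1 + t * x z else 1) =
      (\<Prod>(z, k)\<in>{(z, k). (k, z) \<in> extras n N C}. 1 + t * x z)"
    by (rule prod.mono_neutral_cong_right) (auto simp: extras_def split: if_splits)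
  also have "\<dots> = (\<Prod>p\<in>extras n N C. (t * x (snd p)) + 1)"
    by (rule prod.reindex_bij_witness[of _ prod.swap prod.swap]) (auto simp: add.commute)
  also have "\<dots> = (\<Sum>Y\<in>Pow (extras n N C). (\<Prod>(k, z)\<in>Y. t * x z))"
    by (simp add: prod_add[OF finite_extras] case_prod_unfold)
  finally show ?thesis by (simp add: sum_distrib_left)
qed

lemma state_sum_eq:
  assumes n: "1 \<le> n"
  shows "state_sum N n \<alpha> = (\<Sum>C\<in>key_fillings n N \<alpha>. \<Sum>Y\<in>Pow (extras n N C).
    (\<Prod>(k, z)\<in>entries C. X z) * (\<Prod>(k, z)\<in>Y. beta * X z))"
proof -
  let ?As = "replicate n {} :: nat set list"
  have "state_sum N n \<alpha> = (\<Sum>C\<in>fillings n N. if admissible n C N ?As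
      then filling_weight beta X n C N ?As * (if state_le (final_state n C N ?As) \<alpha> then 1 else 0) else 0)"
    unfolding state_sum_def by (rule rows_eq_sum) simp
  also have "\<dots> = (\<Sum>C\<in>fillings n N. if C \<in> key_fillings n N \<alpha>
      then (\<Prod>z\<in>{1..N}. letter_weight beta (X z) n C z) else 0)"
  proof (rule sum.cong[OF refl])
    fix C assume C: "C \<in> fillings n N"
    note st = key_state_init[OF C n]
    note fin = key_state_final[OF C n st order_refl]
    show "(if admissible n C N ?As
        then filling_weight beta X n C N ?As * (if state_le (final_state n C N ?As) \<alpha> then 1 else 0) else 0) =
      (if C \<in> key_fillings n N \<alpha> then (\<Prod>z\<in>{1..N}. letter_weight beta (X z) n C z) else 0)"
    proof (cases "admissible n C N ?As")
      case True
      then have "dominance_chain C" "C n = {}" using fin(1) letter_ok_iff[OF C] by simp_all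
      moreover have "key_columns (final_state n C N ?As) k = lkey C 1 k" if "1 \<le> k" for k
        using key_stateD(4)[OF C n fin(2)[OF True] that] trunc_1[OF C] by simp
      ultimately have "state_le (final_state n C N ?As) \<alpha> \<longleftrightarrow> C \<in> key_fillings n N \<alpha>"
        unfolding state_le_def key_fillings_def using C by auto
      then show ?thesis using True fin(3)[OF True, of beta X] by simp
    next
      case False
      then have "\<not> (dominance_chain C \<and> C n = {})" using fin(1) letter_ok_iff[OF C] by blast
      then have "C \<notin> key_fillings n N \<alpha>" unfolding key_fillings_def by blast
      then show ?thesis using False by simp
    qed
  qed
  also have "\<dots> = (\<Sum>C\<in>key_fillings n N \<alpha>. \<Prod>z\<in>{1..N}. letter_weight beta (X z) n C z)"
    by (rule sum.mono_neutral_cong_right) (auto simp: finite_fillings key_fillings_def)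
  also have "\<dots> = (\<Sum>C\<in>key_fillings n N \<alpha>. \<Sum>Y\<in>Pow (extras n N C).
    (\<Prod>(k, z)\<in>entries C. X z) * (\<Prod>(k, z)\<in>Y. beta * X z))"
    by (rule sum.cong[OF refl], rule prod_letter_weight) (simp add: key_fillings_def)
  finally show ?thesis .
qed

lemma prod_pairs:
  fixes Q :: "(nat \<times> nat) set"
  assumes "finite Q" "\<And>i. part w i = card {k. (k, i) \<in> Q}"
  shows "xpow w = (\<Prod>(k, z)\<in>Q. X z)" and "csize w = card Q"
proof -
  have fin: "finite {k. (k, i) \<in> Q}" for i
    using finite_subset[of "{k. (k, i) \<in> Q}" "fst ` Q"] assms(1) by force
  have keys: "Poly_Mapping.keys w = snd ` Q"
  proof (rule set_eqI)
    fix i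
    have "i \<in> Poly_Mapping.keys w \<longleftrightarrow> {k. (k, i) \<in> Q} \<noteq> {}"
      using fin[of i] by (simp add: in_keys_iff assms(2))
    then show "i \<in> Poly_Mapping.keys w \<longleftrightarrow> i \<in> snd ` Q" by force
  qed
  have Q: "bij_betw (\<lambda>(i, k). (k, i)) (Sigma (snd ` Q) (\<lambda>i. {k. (k, i) \<in> Q})) Q"
    by (rule bij_betw_byWitness[where f' = prod.swap]) force+
  have "(\<Prod>(k, z)\<in>Q. X z) = (\<Prod>(i, k)\<in>Sigma (snd ` Q) (\<lambda>i. {k. (k, i) \<in> Q}). X i)"
    by (subst prod.reindex_bij_betw[OF Q, symmetric]) (simp add: case_prod_unfold)
  also have "\<dots> = (\<Prod>i\<in>snd ` Q. \<Prod>k\<in>{k. (k, i) \<in> Q}. X i)"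
    using assms(1) fin by (intro prod.Sigma[symmetric]) auto
  also have "\<dots> = xpow w" by (simp add: xpow_def keys assms(2))
  finally show "xpow w = (\<Prod>(k, z)\<in>Q. X z)" by simp
  have "card Q = card (Sigma (snd ` Q) (\<lambda>i. {k. (k, i) \<in> Q}))"
    using bij_betw_same_card[OF Q] by simp
  also have "\<dots> = csize w" using assms(1) fin by (simp add: csize_def keys assms(2))
  finally show "csize w = card Q" by simp
qed

section \<open>The base case: partitions\<close>

lemma park_subset:
  assumes "finite D" "D \<subseteq> C"
  shows "park C D = D"
  using assms
proof (induction D rule: finite_induct)
  case (insert a D)
  have "first_free C a D = {a}" by (rule first_free_eqI) (use insert in auto)
  then show ?case using insert by (simp add: park_insert park_step_def)
qed simp

lemma cnt_atLeastAtMost: "m < t \<Longrightarrow> cnt {1..m} t = 0"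
  by (simp add: cnt_def)

text \<open>The key columns of a partition are the segments \<open>{1..h k}\<close>, the least sets
  of their sizes. Since passing to the left key only raises the counts, \<open>D\<close> is the only
  filling that remains. An extra entry would be a letter missing from its column below some leading
  entry, which segments do not allow.\<close>

lemma state_sum_partition:
  assumes part: "is_partition \<alpha>" and N: "Poly_Mapping.keys \<alpha> \<subseteq> {1..N}" and n: "\<And>i. part \<alpha> i < n"
  shows "state_sum N n \<alpha> = xpow \<alpha>"
proof -
  have n1: "1 \<le> n" using n[of 0] by simp
  have anti: "part \<alpha> j \<le> part \<alpha> i" if "1 \<le> i" "i \<le> j" for i j
    using that(2,1) part by (induction j rule: dec_induct) (auto simp: is_partition_def intro: order_trans)
  define h where "h k = card (key_col \<alpha> k)" for k
  have key: "key_col \<alpha> k = {1..h k}" if k: "1 \<le> k" for k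
  proof -
    have fin: "finite (key_col \<alpha> k)" by (rule finite_key_col[OF k])
    have down: "\<exists>m. key_col \<alpha> k = {1..m}"
    proof (cases "key_col \<alpha> k = {}")
      case True
      then show ?thesis by (intro exI[of _ 0]) simp
    next
      case False
      have "0 \<notin> key_col \<alpha> k" using part k by (simp add: key_col_def is_partition_def is_composition_def)
      moreover have "i \<in> key_col \<alpha> k" if "1 \<le> i" "i \<le> Max (key_col \<alpha> k)" for i
        using Max_in[OF fin False] anti[OF that] by (simp add: key_col_def)
      ultimately have "key_col \<alpha> k = {1..Max (key_col \<alpha> k)}"
        using Max_ge[OF fin] by (metis atLeastAtMost_iff less_one linorder_not_le subsetI subset_antisym)
      then show ?thesis by blast
    qed
    then show ?thesis unfolding h_def by force
  qed
  define D where "D k = (if k \<in> {1..n} then {1..h k} else {})" for k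
  have hn: "h k = 0" if "n \<le> k" for k
  proof -
    have "key_col \<alpha> k = {}" using n that by (auto simp: key_col_def not_le intro: less_le_trans)
    then show ?thesis by (simp add: h_def)
  qed
  have D: "D k = {1..h k}" if "1 \<le> k" for k
    using that hn[of k] by (auto simp: D_def)
  have hN: "h k \<le> N" if "1 \<le> k" for k
  proof -
    have "key_col \<alpha> k \<subseteq> {1..N}" using N that by (auto simp: key_col_def in_keys_iff subset_iff)
    then show ?thesis unfolding h_def using card_mono[of "{1..N}"] by fastforce
  qed
  have DF: "D \<in> fillings n N" using hN by (auto simp: fillings_def D_def)
  have sub: "D (Suc k) \<subseteq> D k" if "1 \<le> k" for k
  proof -
    have "key_col \<alpha> (Suc k) \<subseteq> key_col \<alpha> k" by (auto simp: key_col_def)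
    then show ?thesis using key[of k] key[of "Suc k"] D[of k] D[of "Suc k"] that by simp
  qed
  have sub': "D k \<subseteq> D j" if "1 \<le> j" "j \<le> k" for j k
    using that(2)
  proof (induction k rule: dec_induct)
    case (step m)
    then show ?case using sub[of m] that(1) by (meson le_trans subset_trans)
  qed simp
  have finD: "finite (D k)" for k by (simp add: D_def)
  have chain: "dominance_chain D"
    unfolding dominance_chain_def dominates_def using finD cnt_mono sub by auto
  have lk: "lkey D j k = D k" if "1 \<le> j" "j \<le> k" for j k
    using that(2,1)
  proof (induction j rule: inc_induct)
    case (step j)
    have "D k \<subseteq> D j" using sub' step by simp
    then show ?case using step park_subset[OF finD] by (simp add: lkey_less)
  qed simp
  have "D \<in> key_fillings n N \<alpha>"
  proof -
    have "column_le (lkey D 1 k) (key_col \<alpha> k)" if "1 \<le> k" for k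
      unfolding lk[OF order_refl that] D[OF that] key[OF that] by (simp add: column_le_def)
    moreover have "D n = {}" using D[OF n1] hn[of n] by simp
    ultimately show ?thesis unfolding key_fillings_def using DF chain by simp
  qed
  moreover have "C = D" if C: "C \<in> key_fillings n N \<alpha>" for C
  proof
    fix k
    have CF: "C \<in> fillings n N" "dominance_chain C" "\<And>k. 1 \<le> k \<Longrightarrow> column_le (lkey C 1 k) (key_col \<alpha> k)"
      using C by (auto simp: key_fillings_def)
    show "C k = D k"
    proof (cases "1 \<le> k")
      case True
      have p: "card (lkey C 1 k) = card (C k)" "cnt (C k) t \<le> cnt (lkey C 1 k) t" for t
        using lkey_properties[OF CF(2) order_refl True] by auto
      have q: "card (lkey C 1 k) = h k" "cnt (lkey C 1 k) t \<le> cnt {1..h k} t" for t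
        using CF(3)[OF True] key[OF True] by (auto simp: column_le_def)
      have fin: "finite (C k)" "C k \<subseteq> {1..N}" using CF(1) by (auto simp: fillings_def intro: finite_subset)
      have "cnt (C k) (Suc (h k)) = 0" using p(2)[of "Suc (h k)"] q(2)[of "Suc (h k)"] cnt_atLeastAtMost[of "h k"] by simp
      then have "C k \<inter> {Suc (h k)..} = {}" using fin by (simp add: cnt_def)
      then have "C k \<subseteq> {1..h k}" using fin(2) by (metis Int_iff atLeastAtMost_iff atLeast_iff empty_iff not_less_eq_eq subset_iff)
      then have "C k = {1..h k}" using p(1) q(1) by (intro card_subset_eq) auto
      then show ?thesis using D[OF True] by simp
    next
      case False
      then show ?thesis using CF(1) DF by (simp add: fillings_def)
    qed
  qed
  ultimately have kf: "key_fillings n N \<alpha> = {D}" by blast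
  have no_extras: "extras n N D = {}"
  proof -
    have "p \<notin> extras n N D" for p
    proof
      assume "p \<in> extras n N D"
      then obtain k z where z: "1 \<le> k" "1 \<le> z" "z \<notin> D k" "cnt (D (Suc k)) (Suc z) < cnt (D k) (Suc z)"
        by (auto simp: extras_def)
      then have "h k < Suc z" using D[OF z(1)] by simp
      then show False using z(4) cnt_atLeastAtMost D[OF z(1)] by simp
    qed
    then show ?thesis by blast
  qed
  have "part \<alpha> i = card {k. (k, i) \<in> entries D}" for i
  proof -
    have "{k. (k, i) \<in> entries D} = {1..part \<alpha> i}"
    proof (rule set_eqI)
      fix k
      show "k \<in> {k. (k, i) \<in> entries D} \<longleftrightarrow> k \<in> {1..part \<alpha> i}"
      proof (cases "1 \<le> k")
        case True
        have "i \<in> D k \<longleftrightarrow> k \<le> part \<alpha> i" unfolding D[OF True] key[OF True, symmetric] key_col_def by simp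
        then show ?thesis using True by (simp add: entries_def)
      next
        case False
        then show ?thesis by (simp add: entries_def D_def)
      qed
    qed
    then show ?thesis by simp
  qed
  then have "xpow \<alpha> = (\<Prod>(k, z)\<in>entries D. X z)"
    by (rule prod_pairs(1)[OF finite_entries[OF DF]])
  then show ?thesis unfolding state_sum_eq[OF n1] kf by (simp add: no_extras)
qed

section \<open>Compositions and their key tableaux\<close>

text \<open>Conjugation of a weakly decreasing list. The default 0 covers places past the end
  because \<open>k\<close> is positive.\<close>

lemma le_nth_default_iff:
  assumes "sorted_wrt (\<ge>) ys" "1 \<le> (k :: nat)"
  shows "k \<le> nth_default 0 ys r \<longleftrightarrow> r < length (filter (\<lambda>x. k \<le> x) ys)"
  using assms(1)
proof (induction ys arbitrary: r)
  case Nil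
  then show ?case using assms(2) by (simp add: nth_default_def)
next
  case (Cons y ys)
  show ?case
  proof (cases "k \<le> y")
    case True
    then show ?thesis using Cons by (cases r) (simp_all add: nth_default_Cons_0 nth_default_Cons_Suc)
  next
    case False
    then have "filter (\<lambda>x. k \<le> x) (y # ys) = []" using Cons.prems by (auto simp: filter_empty_conv)
    moreover have "nth_default 0 (y # ys) r < k"
      using Cons False calculation by (cases r) (auto simp: nth_default_Cons_0 nth_default_Cons_Suc not_le[symmetric])
    ultimately show ?thesis by simp
  qed
qed

text \<open>Sorting rearranges the rows but keeps the column heights, so the sorted shape is the
  conjugate of the sequence of key column sizes.\<close>

lemma le_part_sort_comp_iff:
  assumes "1 \<le> k" "1 \<le> r"
  shows "k \<le> part (sort_comp \<alpha>) r \<longleftrightarrow> r \<le> card (key_col \<alpha> k)"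
proof -
  obtain r' where r: "r = Suc r'" using assms(2) by (cases r) auto
  let ?xs = "map (part \<alpha>) (sorted_list_of_set (Poly_Mapping.keys \<alpha>))"
  have s: "sorted_wrt (\<ge>) (rev (sort ?xs))"
    by (simp add: sorted_wrt_rev)
  have "length (filter (\<lambda>x. k \<le> x) (rev (sort ?xs))) = length (filter (\<lambda>x. k \<le> x) ?xs)"
    by (metis filter_sort length_rev length_sort rev_filter)
  also have "\<dots> = length (filter (\<lambda>i. k \<le> part \<alpha> i) (sorted_list_of_set (Poly_Mapping.keys \<alpha>)))"
    by (simp add: filter_map o_def)
  also have "\<dots> = card {i \<in> Poly_Mapping.keys \<alpha>. k \<le> part \<alpha> i}"
    by (subst distinct_card[symmetric]) (auto intro!: arg_cong[where f = card])
  also have "{i \<in> Poly_Mapping.keys \<alpha>. k \<le> part \<alpha> i} = key_col \<alpha> k"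
    using assms(1) by (auto simp: key_col_def in_keys_iff)
  finally show ?thesis
    using le_nth_default_iff[OF s assms(1), of r'] unfolding r
    by (simp add: sort_comp_def nth_default_Cons_Suc less_eq_Suc_le)
qed

lemma part_sort_comp_0: "part (sort_comp \<alpha>) 0 = 0"
  by (simp add: sort_comp_def nth_default_Cons_0)

lemma sort_comp_eq_iff:
  "sort_comp \<alpha> = sort_comp \<gamma> \<longleftrightarrow> (\<forall>k\<ge>1. card (key_col \<alpha> k) = card (key_col \<gamma> k))"
proof
  assume eq: "sort_comp \<alpha> = sort_comp \<gamma>"
  show "\<forall>k\<ge>1. card (key_col \<alpha> k) = card (key_col \<gamma> k)"
  proof (intro allI impI)
    fix k :: nat assume k: "1 \<le> k"
    have "r \<le> card (key_col \<alpha> k) \<longleftrightarrow> r \<le> card (key_col \<gamma> k)" if "1 \<le> r" for r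
      using le_part_sort_comp_iff[OF k that] eq by metis
    from this[of "card (key_col \<alpha> k)"] this[of "card (key_col \<gamma> k)"]
    show "card (key_col \<alpha> k) = card (key_col \<gamma> k)" by linarith
  qed
next
  assume eq: "\<forall>k\<ge>1. card (key_col \<alpha> k) = card (key_col \<gamma> k)"
  show "sort_comp \<alpha> = sort_comp \<gamma>"
  proof (rule poly_mapping_eqI)
    fix r
    show "part (sort_comp \<alpha>) r = part (sort_comp \<gamma>) r"
    proof (cases "1 \<le> r")
      case True
      have "k \<le> part (sort_comp \<alpha>) r \<longleftrightarrow> k \<le> part (sort_comp \<gamma>) r" for k
        using le_part_sort_comp_iff[OF _ True, of k] eq by (cases "1 \<le> k") auto
      from this[of "part (sort_comp \<alpha>) r"] this[of "part (sort_comp \<gamma>) r"] show ?thesis by simp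
    next
      case False
      then show ?thesis by (simp add: part_sort_comp_0 not_less_eq_eq)
    qed
  qed
qed

section \<open>The componentwise order as a comparison of counts\<close>

lemma cnt_eq_card_nth:
  assumes "finite A"
  shows "cnt A t = card {r. r < card A \<and> t \<le> sorted_list_of_set A ! r}"
proof -
  let ?l = "sorted_list_of_set A"
  have l: "x \<in> A \<longleftrightarrow> (\<exists>r<card A. ?l ! r = x)" for x
    using in_set_conv_nth[of x ?l] assms by simp
  have "A \<inter> {t..} = (!) ?l ` {r. r < card A \<and> t \<le> ?l ! r}"
  proof (rule set_eqI)
    fix x
    show "x \<in> A \<inter> {t..} \<longleftrightarrow> x \<in> (!) ?l ` {r. r < card A \<and> t \<le> ?l ! r}"
    proof
      assume x: "x \<in> A \<inter> {t..}"
      then obtain r where "r < card A" "?l ! r = x" using l[of x] by auto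
      then show "x \<in> (!) ?l ` {r. r < card A \<and> t \<le> ?l ! r}" using x by (intro image_eqI[of _ _ r]) auto
    next
      assume "x \<in> (!) ?l ` {r. r < card A \<and> t \<le> ?l ! r}"
      then obtain r where "r < card A" "t \<le> ?l ! r" "x = ?l ! r" by auto
      then show "x \<in> A \<inter> {t..}" using l[of x] by auto
    qed
  qed
  moreover have "inj_on ((!) (sorted_list_of_set A)) {r. r < card A \<and> t \<le> sorted_list_of_set A ! r}"
    using assms by (intro inj_on_nth) auto
  ultimately show ?thesis unfolding cnt_def by (simp add: card_image)
qed

lemma sorted_nth_le_iff_cnt_le:
  assumes "finite A" "finite B" "card A = card B"
  shows "(\<forall>r<card A. sorted_list_of_set A ! r \<le> sorted_list_of_set B ! r) \<longleftrightarrow> (\<forall>t. cnt A t \<le> cnt B t)"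
proof
  assume le: "\<forall>r<card A. sorted_list_of_set A ! r \<le> sorted_list_of_set B ! r"
  have "{r. r < card A \<and> t \<le> sorted_list_of_set A ! r} \<subseteq> {r. r < card B \<and> t \<le> sorted_list_of_set B ! r}" for t
    using le assms(3) le_trans by (smt (verit, best) mem_Collect_eq subsetI)
  then show "\<forall>t. cnt A t \<le> cnt B t"
    unfolding cnt_eq_card_nth[OF assms(1)] cnt_eq_card_nth[OF assms(2)]
    by (intro allI card_mono) auto
next
  assume le: "\<forall>t. cnt A t \<le> cnt B t"
  show "\<forall>r<card A. sorted_list_of_set A ! r \<le> sorted_list_of_set B ! r"
  proof (intro allI impI, rule ccontr)
    fix r assume r: "r < card A" "\<not> sorted_list_of_set A ! r \<le> sorted_list_of_set B ! r"
    \<comment> \<open>At the first offending threshold, \<open>card A - r\<close> entries of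
      \<open>A\<close> reach \<open>t\<close>, but the entries of \<open>B\<close> up to place
      \<open>r\<close> do not.\<close>
    let ?t = "sorted_list_of_set A ! r"
    have "{r..<card A} \<subseteq> {q. q < card A \<and> ?t \<le> sorted_list_of_set A ! q}"
      using assms(1) by (auto intro!: sorted_nth_mono)
    then have "card {r..<card A} \<le> cnt A ?t"
      unfolding cnt_eq_card_nth[OF assms(1)] by (intro card_mono) auto
    moreover have "{q. q < card B \<and> ?t \<le> sorted_list_of_set B ! q} \<subseteq> {Suc r..<card A}"
    proof
      fix q assume q: "q \<in> {q. q < card B \<and> ?t \<le> sorted_list_of_set B ! q}"
      have "\<not> q \<le> r"
      proof
        assume "q \<le> r"
        then have "sorted_list_of_set B ! q \<le> sorted_list_of_set B ! r"
          using r(1) assms by (intro sorted_nth_mono) auto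
        then show False using q r(2) by simp
      qed
      then show "q \<in> {Suc r..<card A}" using q assms(3) by simp
    qed
    then have "cnt B ?t \<le> card {Suc r..<card A}"
      unfolding cnt_eq_card_nth[OF assms(2)] by (intro card_mono) auto
    ultimately have "card {r..<card A} \<le> card {Suc r..<card A}" using le by (meson le_trans)
    then show False using r(1) by simp
  qed
qed

lemma comp_le_iff: "\<gamma> \<le>\<^sub>k \<alpha> \<longleftrightarrow> (\<forall>k\<ge>1. column_le (key_col \<gamma> k) (key_col \<alpha> k))"
  unfolding comp_le_def sort_comp_eq_iff column_le_def
proof -
  have "(\<forall>r<card (key_col \<gamma> k). sorted_list_of_set (key_col \<gamma> k) ! r \<le> sorted_list_of_set (key_col \<alpha> k) ! r) \<longleftrightarrow>
      (\<forall>t. cnt (key_col \<gamma> k) t \<le> cnt (key_col \<alpha> k) t)"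
    if "1 \<le> k" "card (key_col \<gamma> k) = card (key_col \<alpha> k)" for k
    by (rule sorted_nth_le_iff_cnt_le[OF finite_key_col[OF that(1)] finite_key_col[OF that(1)] that(2)])
  then show "(\<forall>k\<ge>1. card (key_col \<gamma> k) = card (key_col \<alpha> k)) \<and>
      (\<forall>j\<ge>1. \<forall>r<card (key_col \<gamma> j). sorted_list_of_set (key_col \<gamma> j) ! r \<le> sorted_list_of_set (key_col \<alpha> j) ! r) \<longleftrightarrow>
      (\<forall>k\<ge>1. finite (key_col \<gamma> k) \<and> card (key_col \<gamma> k) = card (key_col \<alpha> k) \<and>
        (\<forall>t. cnt (key_col \<gamma> k) t \<le> cnt (key_col \<alpha> k) t))"
    using finite_key_col by blast
qed

section \<open>Nested columns and their weight\<close>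

lemma park_mono:
  assumes "finite F" "D \<subseteq> F"
  shows "park C D \<subseteq> park C F"
proof -
  have "park C (D \<union> (F - D)) = Finite_Set.fold (park_step C) (park C D) (F - D)"
    using assms finite_subset by (intro park_union) auto
  then show ?thesis
    using fold_park_step_bounds(1)[of "F - D" 0 "park C D" C] assms by (simp add: Un_absorb1)
qed

text \<open>This makes the left key a key tableau, so that it can be recovered from its
  weight.\<close>

lemma lkey_antimono:
  assumes "dominance_chain C" "1 \<le> j" "j \<le> k"
  shows "lkey C j (Suc k) \<subseteq> lkey C j k"
  using assms(3,2)
proof (induction j rule: inc_induct)
  case base
  then show ?case using lkey_properties[OF assms(1), of k "Suc k"] by simp
next
  case (step j)
  then have "finite (lkey C (Suc j) k)"
    using dominates_lkey[OF assms(1), of j k] by (simp add: dominates_def)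
  then show ?case using step by (simp add: lkey_less park_mono)
qed

text \<open>In nested columns a label occupies an initial run of column indices, so the number of
  its columns is the index of the last one. Column 0 has to be empty because \<open>col_wt\<close>
  counts it too.\<close>

lemma key_col_col_wt:
  assumes "\<And>k. 1 \<le> k \<Longrightarrow> K (Suc k) \<subseteq> K k" "K 0 = {}" "finite (K 1)" "K n = {}" "1 \<le> n" "1 \<le> k"
  shows "key_col (col_wt K) k = K k"
proof -
  have sub: "K l \<subseteq> K j" if "1 \<le> j" "j \<le> l" for j l
    using that(2)
  proof (induction l rule: dec_induct)
    case (step m)
    then show ?case using assms(1)[of m] that(1) by (meson le_trans subset_trans)
  qed simp
  have fin: "finite {j. i \<in> K j}" for i
  proof (rule finite_subset)
    show "{j. i \<in> K j} \<subseteq> {..n}"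
    proof
      fix j assume j: "j \<in> {j. i \<in> K j}"
      have "\<not> n \<le> j"
      proof
        assume "n \<le> j"
        then show False using sub[OF assms(5), of j] j assms(4) by blast
      qed
      then show "j \<in> {..n}" by simp
    qed
  qed simp
  have "{i. card {j. i \<in> K j} \<noteq> 0} \<subseteq> K 1"
  proof
    fix i assume "i \<in> {i. card {j. i \<in> K j} \<noteq> 0}"
    then have "{j. i \<in> K j} \<noteq> {}" unfolding mem_Collect_eq by (metis card.empty)
    then obtain j where j: "i \<in> K j" by blast
    then have "1 \<le> j" using assms(2) by (cases j) simp_all
    then show "i \<in> K 1" using sub[OF order_refl, of j] j by blast
  qed
  then have "finite {i. card {j. i \<in> K j} \<noteq> 0}" using assms(3) finite_subset by blast
  then have part: "part (col_wt K) i = card {j. i \<in> K j}" for i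
    unfolding col_wt_def by (rule fun_cong[OF lookup_Abs_poly_mapping])
  have "i \<in> K k \<longleftrightarrow> k \<le> card {j. i \<in> K j}" for i
  proof
    assume "i \<in> K k"
    have "{1..k} \<subseteq> {j. i \<in> K j}"
    proof
      fix j assume "j \<in> {1..k}"
      then have "K k \<subseteq> K j" by (intro sub) simp_all
      then show "j \<in> {j. i \<in> K j}" using \<open>i \<in> K k\<close> by blast
    qed
    then have "card {1..k} \<le> card {j. i \<in> K j}" by (rule card_mono[OF fin])
    then show "k \<le> card {j. i \<in> K j}" by simp
  next
    assume k: "k \<le> card {j. i \<in> K j}"
    show "i \<in> K k"
    proof (rule ccontr)
      assume "i \<notin> K k"
      have "{j. i \<in> K j} \<subseteq> {1..<k}"
      proof
        fix j assume j: "j \<in> {j. i \<in> K j}"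
        have "j \<noteq> 0" using j assms(2) by (cases j) simp_all
        moreover have "\<not> k \<le> j"
        proof
          assume "k \<le> j"
          then show False using sub[OF assms(6), of j] j \<open>i \<notin> K k\<close> by blast
        qed
        ultimately show "j \<in> {1..<k}" by simp
      qed
      then have "card {j. i \<in> K j} \<le> card {1..<k}" by (intro card_mono) auto
      then show False using k assms(6) by simp
    qed
  qed
  then show ?thesis unfolding key_col_def part by blast
qed

section \<open>Set-valued tableaux as columns with extra entries\<close>

definition extra_pairs :: "(nat \<times> nat \<Rightarrow> nat set) \<Rightarrow> (nat \<times> nat) set" where
  "extra_pairs T = {(k, z). \<exists>r. z \<in> T (r, k) \<and> z < Max (T (r, k))}"

text \<open>In a column, every entry \<open>z\<close>, extra or not, lies in the row that is the number of
  leading entries \<open>\<ge> z\<close>.\<close>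

definition rebuild :: "(nat \<Rightarrow> nat set) \<Rightarrow> (nat \<times> nat) set \<Rightarrow> nat \<times> nat \<Rightarrow> nat set" where
  "rebuild C Y = (\<lambda>(r, k). {z. (z \<in> C k \<or> (k, z) \<in> Y) \<and> cnt (C k) z = r})"

lemma part_le_csize: "part \<alpha> i \<le> csize \<alpha>"
  using member_le_sum[of i "Poly_Mapping.keys \<alpha>" "part \<alpha>"]
  by (cases "i \<in> Poly_Mapping.keys \<alpha>") (auto simp: csize_def in_keys_iff)

lemma boxes_sort_comp_iff:
  "(r, k) \<in> boxes (sort_comp \<alpha>) \<longleftrightarrow> 1 \<le> r \<and> 1 \<le> k \<and> r \<le> card (key_col \<alpha> k)"
  using le_part_sort_comp_iff[of k r \<alpha>] by (auto simp: boxes_def)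

lemma card_key_col_Suc: "1 \<le> k \<Longrightarrow> card (key_col \<alpha> (Suc k)) \<le> card (key_col \<alpha> k)"
  by (rule card_mono[OF finite_key_col]) (auto simp: key_col_def)

section \<open>From a set-valued tableau to its columns and extra entries\<close>

context
  fixes \<alpha> :: composition and T :: "nat \<times> nat \<Rightarrow> nat set"
  assumes T: "T \<in> RSVT (sort_comp \<alpha>)"
begin

abbreviation cols where "cols \<equiv> column (leading T)"
abbreviation height where "height k \<equiv> card (key_col \<alpha> k)"
abbreviation lead where "lead r k \<equiv> Max (T (r, k))"

lemma RSVT_mem: "z \<in> T (r, k) \<Longrightarrow> 1 \<le> r \<and> 1 \<le> k \<and> r \<le> height k \<and> 1 \<le> z"
  using T boxes_sort_comp_iff[of r k \<alpha>] unfolding RSVT_def by (cases "(r, k) \<in> boxes (sort_comp \<alpha>)") auto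

lemma RSVT_box: "1 \<le> r \<Longrightarrow> 1 \<le> k \<Longrightarrow> r \<le> height k \<Longrightarrow> finite (T (r, k)) \<and> T (r, k) \<noteq> {}"
  using T boxes_sort_comp_iff[of r k \<alpha>] unfolding RSVT_def by blast

lemma RSVT_finite: "finite (T s)"
proof -
  obtain r k where s: "s = (r, k)" by (cases s)
  show ?thesis using RSVT_mem[of _ r k] RSVT_box[of r k] unfolding s by (cases "T (r, k) = {}") auto
qed

lemma RSVT_Max: "z \<in> T s \<Longrightarrow> Max (T s) \<in> T s" "z \<in> T s \<Longrightarrow> z \<le> Max (T s)"
  using RSVT_finite[of s] Max_in Max_ge by blast+

lemma RSVT_row:
  assumes "z \<in> T (r, k)" "w \<in> T (r, Suc k)"
  shows "w \<le> z"
proof -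
  have "(r, k) \<in> boxes (sort_comp \<alpha>)" "(r, Suc k) \<in> boxes (sort_comp \<alpha>)"
    using RSVT_mem assms boxes_sort_comp_iff by blast+
  then have "Max (T (r, Suc k)) \<le> Min (T (r, k))" using T unfolding RSVT_def by blast
  then show ?thesis
    using Min_le[OF RSVT_finite assms(1)] Max_ge[OF RSVT_finite assms(2)] by linarith
qed

lemma RSVT_col:
  assumes "z \<in> T (r, k)" "w \<in> T (r', k)" "r < r'"
  shows "w < z"
proof -
  have "\<forall>w\<in>T (r', k). w < z" using less_imp_Suc_add[OF assms(3)] assms(2)
  proof (elim exE)
    fix d assume "r' = Suc (r + d)"
    moreover have "\<forall>w\<in>T (Suc (r + d), k). w < z" if "Suc (r + d) \<le> height k"
      using that
    proof (induction d)
      case 0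
      have "(r, k) \<in> boxes (sort_comp \<alpha>)" "(Suc r, k) \<in> boxes (sort_comp \<alpha>)"
        using RSVT_mem[OF assms(1)] 0 boxes_sort_comp_iff by auto
      then have "Max (T (Suc r, k)) < Min (T (r, k))" using T unfolding RSVT_def by blast
      then show ?case using Min_le[OF RSVT_finite assms(1)] Max_ge[OF RSVT_finite, of _ "(Suc r, k)"]
        by fastforce
    next
      case (Suc d)
      have b: "1 \<le> Suc (r + d)" "1 \<le> k" "Suc (r + d) \<le> height k"
        using RSVT_mem[OF assms(1)] Suc.prems by auto
      then obtain v where v: "v \<in> T (Suc (r + d), k)" using RSVT_box by blast
      have "(Suc (r + d), k) \<in> boxes (sort_comp \<alpha>)" "(Suc (Suc (r + d)), k) \<in> boxes (sort_comp \<alpha>)"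
        using b Suc.prems boxes_sort_comp_iff by auto
      then have "Max (T (Suc (Suc (r + d)), k)) < Min (T (Suc (r + d), k))" using T unfolding RSVT_def by blast
      then have "u < v" if "u \<in> T (Suc (Suc (r + d)), k)" for u
        using Min_le[OF RSVT_finite v] Max_ge[OF RSVT_finite that] by linarith
      then show ?case using Suc.IH v b(3) by fastforce
    qed
    ultimately show ?thesis using RSVT_mem[OF assms(2)] by simp
  qed
  then show ?thesis using assms(2) by blast
qed

lemma column_leading:
  "cols k = (if k = 0 then {} else (\<lambda>r. lead r k) ` {1..height k})"
proof -
  have nz: "leading T (r, k) \<noteq> 0 \<longleftrightarrow> T (r, k) \<noteq> {}" for r
    using RSVT_Max(1)[of _ "(r, k)"] RSVT_mem[of "lead r k" r k] by (auto simp: leading_def)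
  have iff: "T (r, k) \<noteq> {} \<longleftrightarrow> k \<noteq> 0 \<and> r \<in> {1..height k}" for r
    using RSVT_mem[of _ r k] RSVT_box[of r k] by (auto simp: Suc_le_eq)
  have "cols k = {lead r k | r. T (r, k) \<noteq> {}}"
    unfolding column_def nz by (auto simp: leading_def)
  also have "\<dots> = (if k = 0 then {} else (\<lambda>r. lead r k) ` {1..height k})"
    unfolding iff by auto
  finally show ?thesis .
qed

lemma lead_mem: "1 \<le> k \<Longrightarrow> r \<in> {1..height k} \<Longrightarrow> lead r k \<in> T (r, k)"
  using RSVT_box[of r k] Max_in by auto

lemma lead_less:
  "1 \<le> k \<Longrightarrow> r \<in> {1..height k} \<Longrightarrow> r' \<in> {1..height k} \<Longrightarrow> r < r' \<Longrightarrow> lead r' k < lead r k"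
  using RSVT_col lead_mem by blast

lemma inj_on_lead: "1 \<le> k \<Longrightarrow> inj_on (\<lambda>r. lead r k) {1..height k}"
  by (rule linorder_inj_onI') (use lead_less in \<open>metis less_irrefl\<close>)

lemma column_mem_iff: "z \<in> cols k \<longleftrightarrow> (\<exists>r. z \<in> T (r, k) \<and> z = lead r k)"
proof
  assume z: "z \<in> cols k"
  then have "1 \<le> k" unfolding column_leading by (cases k) auto
  then obtain r where "r \<in> {1..height k}" "z = lead r k"
    using z unfolding column_leading by auto
  then show "\<exists>r. z \<in> T (r, k) \<and> z = lead r k" using lead_mem[OF \<open>1 \<le> k\<close>] by metis
next
  assume "\<exists>r. z \<in> T (r, k) \<and> z = lead r k"
  then obtain r where r: "z \<in> T (r, k)" "z = lead r k" by blast
  then show "z \<in> cols k" using RSVT_mem[OF r(1)] unfolding column_leading by auto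
qed

lemma cnt_column:
  assumes "z \<in> T (r, k)"
  shows "cnt (cols k) z = r"
proof -
  have b: "1 \<le> r" "1 \<le> k" "r \<le> height k" using RSVT_mem[OF assms] by auto
  have "cols k \<inter> {z..} = (\<lambda>r. lead r k) ` {1..r}"
  proof (rule set_eqI)
    fix u
    show "u \<in> cols k \<inter> {z..} \<longleftrightarrow> u \<in> (\<lambda>r. lead r k) ` {1..r}"
    proof
      assume "u \<in> cols k \<inter> {z..}"
      then obtain r' where r': "u \<in> T (r', k)" "u = lead r' k" "z \<le> u" unfolding Int_iff column_mem_iff by auto
      then have "\<not> r < r'" using RSVT_col[OF assms r'(1)] by auto
      then show "u \<in> (\<lambda>r. lead r k) ` {1..r}" using RSVT_mem[OF r'(1)] r'(2) by auto
    next
      assume "u \<in> (\<lambda>r. lead r k) ` {1..r}"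
      then obtain r' where r': "r' \<in> {1..r}" "u = lead r' k" by auto
      then have u: "u \<in> T (r', k)" using lead_mem[OF b(2), of r'] b(3) by auto
      have "z \<le> u"
      proof (cases "r' = r")
        case True
        then show ?thesis using RSVT_Max(2)[OF assms] r'(2) by simp
      next
        case False
        then show ?thesis using RSVT_col[OF u assms] r'(1) by simp
      qed
      then show "u \<in> cols k \<inter> {z..}" using u r'(2) column_mem_iff by auto
    qed
  qed
  moreover have "inj_on (\<lambda>r. lead r k) {1..r}"
    using inj_on_lead[OF b(2)] b(3) by (auto intro: inj_on_subset)
  ultimately show ?thesis unfolding cnt_def by (simp add: card_image)
qed

lemma card_column: "1 \<le> k \<Longrightarrow> card (cols k) = height k"
  unfolding column_leading using card_image[OF inj_on_lead] by simp

lemma finite_column: "finite (cols k)"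
  unfolding column_leading by simp

text \<open>Passing to the left neighbour maps the leading entries of column \<open>k + 1\<close>
  injectively to leading entries of column \<open>k\<close> that are at least as large.\<close>

lemma dominance_chain_column: "dominance_chain cols"
  unfolding dominance_chain_def dominates_def
proof (intro allI impI conjI finite_column)
  fix k t :: nat assume k: "1 \<le> k"
  define S where "S = {r \<in> {1..height (Suc k)}. t \<le> lead r (Suc k)}"
  have S: "S \<subseteq> {1..height k}" using card_key_col_Suc[OF k, of \<alpha>] by (auto simp: S_def)
  have fin: "finite S" by (simp add: S_def)
  have "cols (Suc k) \<inter> {t..} = (\<lambda>r. lead r (Suc k)) ` S"
    unfolding column_leading S_def by auto
  then have "cnt (cols (Suc k)) t \<le> card S"
    unfolding cnt_def using card_image_le[OF fin] by simp
  also have "\<dots> = card ((\<lambda>r. lead r k) ` S)"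
    using inj_on_subset[OF inj_on_lead[OF k] S] by (simp add: card_image)
  also have "\<dots> \<le> cnt (cols k) t"
    unfolding cnt_def
  proof (rule card_mono)
    show "(\<lambda>r. lead r k) ` S \<subseteq> cols k \<inter> {t..}"
    proof
      fix u assume "u \<in> (\<lambda>r. lead r k) ` S"
      then obtain r where r: "r \<in> S" "u = lead r k" by blast
      have "lead r (Suc k) \<in> T (r, Suc k)" using r(1) by (intro lead_mem) (auto simp: S_def)
      moreover have u: "u \<in> T (r, k)" using lead_mem[OF k] S r by auto
      ultimately have "lead r (Suc k) \<le> u" using RSVT_row by blast
      then have "t \<le> u" using r(1) by (simp add: S_def)
      then show "u \<in> cols k \<inter> {t..}" using u r(2) column_mem_iff by auto
    qed
  qed (simp add: finite_column)
  finally show "cnt (cols (Suc k)) t \<le> cnt (cols k) t" .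
qed

text \<open>By the row and column conditions, all entries of column \<open>k + 1\<close> in rows
  from \<open>r\<close> on are at most \<open>z\<close>. So fewer than \<open>r\<close> of its
  leading entries exceed \<open>z\<close>, whereas column \<open>k\<close> has exactly
  \<open>r\<close> of them.\<close>

lemma extra_properties:
  assumes "z \<in> T (r, k)" "z < lead r k"
  shows "z \<notin> cols k"
    "cnt (cols (Suc k)) (Suc z) < cnt (cols k) (Suc z)" (is ?P1)
proof -
  show notin: "z \<notin> cols k"
  proof
    assume "z \<in> cols k"
    then obtain r' where "z \<in> T (r', k)" "z = lead r' k" using column_mem_iff by blast
    then show False using cnt_column[OF assms(1)] cnt_column[of z r' k] assms(2) by simp
  qed
  have r: "1 \<le> r" "1 \<le> k" using RSVT_mem[OF assms(1)] by auto
  have "cols (Suc k) \<inter> {Suc z..} \<subseteq> (\<lambda>q. lead q (Suc k)) ` {1..<r}"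
  proof
    fix u assume "u \<in> cols (Suc k) \<inter> {Suc z..}"
    then obtain q where q: "u \<in> T (q, Suc k)" "u = lead q (Suc k)" "z < u"
      unfolding Int_iff column_mem_iff by auto
    have b: "1 \<le> q" "q \<le> height k"
      using RSVT_mem[OF q(1)] card_key_col_Suc[OF r(2), of \<alpha>] by auto
    have "\<not> r \<le> q"
    proof
      assume "r \<le> q"
      have m: "lead q k \<in> T (q, k)" using b by (intro lead_mem[OF r(2)]) auto
      show False
      proof (cases "r = q")
        case True
        then show ?thesis using RSVT_row[OF assms(1)] q(1,3) by fastforce
      next
        case False
        then have "lead q k < z" using RSVT_col[OF assms(1) m] \<open>r \<le> q\<close> by simp
        then show ?thesis using RSVT_row[OF m q(1)] q(3) by simp
      qed
    qed
    then show "u \<in> (\<lambda>q. lead q (Suc k)) ` {1..<r}" using q(2) b(1) by auto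
  qed
  then have "cnt (cols (Suc k)) (Suc z) \<le> card ((\<lambda>q. lead q (Suc k)) ` {1..<r})"
    unfolding cnt_def by (intro card_mono) auto
  also have "\<dots> \<le> card {1..<r}" by (rule card_image_le) simp
  also have "\<dots> < r" using r(1) by simp
  also have "r = cnt (cols k) (Suc z)"
    using cnt_column[OF assms(1)] cnt_Suc[OF finite_column, of k z] notin by simp
  finally show ?P1 .
qed

lemma mem_row_iff: "z \<in> cols k \<or> (k, z) \<in> extra_pairs T \<longleftrightarrow> (\<exists>r. z \<in> T (r, k))"
proof
  assume "\<exists>r. z \<in> T (r, k)"
  then obtain r where r: "z \<in> T (r, k)" by blast
  then have "z = lead r k \<or> z < lead r k" using RSVT_Max(2)[OF r] by auto
  then show "z \<in> cols k \<or> (k, z) \<in> extra_pairs T"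
    using r column_mem_iff[of z k] unfolding extra_pairs_def by blast
qed (use column_mem_iff[of z k] in \<open>auto simp: extra_pairs_def\<close>)

lemma rebuild_column: "rebuild cols (extra_pairs T) = T"
proof
  fix s :: "nat \<times> nat"
  obtain r k where s: "s = (r, k)" by (cases s)
  show "rebuild cols (extra_pairs T) s = T s"
  proof (rule set_eqI)
    fix z
    have "(\<exists>r. z \<in> T (r, k)) \<and> cnt (cols k) z = r \<longleftrightarrow> z \<in> T (r, k)"
      using cnt_column by metis
    then show "z \<in> rebuild cols (extra_pairs T) s \<longleftrightarrow> z \<in> T s"
      unfolding s rebuild_def using mem_row_iff[of z k] by simp
  qed
qed

lemma zero_notin_column: "0 \<notin> cols k"
  by (auto simp: column_def)

lemma left_key_leading: "1 \<le> k \<Longrightarrow> left_key (leading T) k = lkey cols 1 k"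
  unfolding left_key_def
  by (rule foldr_tri_eq_lkey[OF dominance_chain_column order_refl _ zero_notin_column])

lemma left_key_comp_le_iff:
  "left_key_comp (leading T) \<le>\<^sub>k \<alpha> \<longleftrightarrow> (\<forall>k\<ge>1. column_le (lkey cols 1 k) (key_col \<alpha> k))"
proof -
  define n where "n = Suc (csize \<alpha>)"
  have n: "1 \<le> n" "key_col \<alpha> n = {}"
    using part_le_csize[of \<alpha>] by (auto simp: n_def key_col_def not_less_eq_eq)
  let ?K = "left_key (leading T)"
  have "key_col (col_wt ?K) k = ?K k" if k: "1 \<le> k" for k
  proof (rule key_col_col_wt[OF _ _ _ _ n(1) k])
    show "?K (Suc k) \<subseteq> ?K k" if "1 \<le> k" for k
      using lkey_antimono[OF dominance_chain_column order_refl that] left_key_leading that by simp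
    show "?K 0 = {}" using column_leading[of 0] by (simp add: left_key_def)
    show "finite (?K 1)" using left_key_leading[of 1] finite_column by simp
    have "card (?K n) = 0"
      using left_key_leading[OF n(1)] lkey_properties[OF dominance_chain_column order_refl n(1)]
        card_column[OF n(1)] n(2) by simp
    moreover have "finite (?K n)"
      using left_key_leading[OF n(1)] lkey_properties[OF dominance_chain_column order_refl n(1)]
        finite_column[of 1] finite_subset by metis
    ultimately show "?K n = {}" by simp
  qed
  then show ?thesis unfolding comp_le_iff left_key_comp_def using left_key_leading by simp
qed

lemma weight_eq:
  fixes t :: mpoly_beta
  defines "Q \<equiv> entries cols \<union> extra_pairs T"
  assumes fin: "finite Q" and n: "\<And>k. n < k \<Longrightarrow> key_col \<alpha> k = {}"
  shows "(\<Prod>(k, z)\<in>entries cols. X z) * (\<Prod>(k, z)\<in>extra_pairs T. t * X z) =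
    t ^ ex (sort_comp \<alpha>) T * xpow (wt T)"
proof -
  let ?E = "entries cols"
  have Q: "(k, z) \<in> Q \<longleftrightarrow> (\<exists>r. z \<in> T (r, k))" for k z
    using mem_row_iff[of z k] by (simp add: Q_def entries_def)
  have disj: "?E \<inter> extra_pairs T = {}"
    using extra_properties(1) by (auto simp: entries_def extra_pairs_def)
  have finE: "finite ?E" "finite (extra_pairs T)" using fin by (simp_all add: Q_def)
  \<comment> \<open>A letter occurs at most once in a column, since its row is determined by
    \<open>cnt_column\<close>; boxes holding \<open>z\<close> thus correspond to columns holding
    \<open>z\<close>.\<close>
  have bij: "card {s. z \<in> T s} = card {k. (k, z) \<in> Q}" for z
  proof (rule bij_betw_same_card[of snd])
    have "inj_on snd {s. z \<in> T s}" by (rule inj_onI, clarsimp) (metis cnt_column)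
    moreover have "snd ` {s. z \<in> T s} = {k. (k, z) \<in> Q}" unfolding Q by force
    ultimately show "bij_betw snd {s. z \<in> T s} {k. (k, z) \<in> Q}" by (simp add: bij_betw_def)
  qed
  have "{z. card {s. z \<in> T s} \<noteq> 0} \<subseteq> snd ` Q"
  proof
    fix z assume "z \<in> {z. card {s. z \<in> T s} \<noteq> 0}"
    then have "{k. (k, z) \<in> Q} \<noteq> {}" unfolding bij mem_Collect_eq by (metis card.empty)
    then show "z \<in> snd ` Q" by force
  qed
  then have "finite {z. card {s. z \<in> T s} \<noteq> 0}" using fin finite_subset by blast
  then have part: "part (wt T) z = card {k. (k, z) \<in> Q}" for z
    unfolding wt_def bij[symmetric] by (rule fun_cong[OF lookup_Abs_poly_mapping])
  note PP = prod_pairs[OF fin part]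
  have Eeq: "?E = Sigma {1..n} cols"
  proof -
    have "k \<in> {1..n}" if "z \<in> cols k" for k z
      using n[of k] that column_leading[of k] by (cases "k = 0"; cases "n < k") auto
    then show ?thesis unfolding entries_def by blast
  qed
  have cardE: "card ?E = csize (sort_comp \<alpha>)"
  proof -
    \<comment> \<open>The boxes of the shape are counted by rows for \<open>csize\<close> and by
      columns for the leading entries.\<close>
    let ?B = "Sigma {1..n} (\<lambda>k. {1..height k})"
    have memB: "(k, r) \<in> ?B \<longleftrightarrow> (r, k) \<in> boxes (sort_comp \<alpha>)" for k r
      unfolding boxes_sort_comp_iff using n[of k] by (cases "k \<le> n") auto
    have "part (sort_comp \<alpha>) r = card {k. (k, r) \<in> ?B}" for r
    proof -
      have "{k. (k, r) \<in> ?B} = (if r = 0 then {} else {1..part (sort_comp \<alpha>) r})"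
        unfolding memB boxes_def by auto
      then show ?thesis using part_sort_comp_0[of \<alpha>] by (cases "r = 0") auto
    qed
    then have "csize (sort_comp \<alpha>) = card ?B" by (intro prod_pairs(2)) auto
    also have "\<dots> = (\<Sum>k\<in>{1..n}. height k)" by simp
    also have "\<dots> = (\<Sum>k\<in>{1..n}. card (cols k))"
      by (intro sum.cong refl) (simp add: card_column)
    also have "\<dots> = card ?E" unfolding Eeq using finite_column by simp
    finally show ?thesis by simp
  qed
  have "card Q = card ?E + card (extra_pairs T)"
    unfolding Q_def using finE disj by (rule card_Un_disjoint)
  then have ex: "ex (sort_comp \<alpha>) T = card (extra_pairs T)"
    unfolding ex_def PP(2) cardE by simp
  have "(\<Prod>(k, z)\<in>extra_pairs T. t * X z) = t ^ card (extra_pairs T) * (\<Prod>(k, z)\<in>extra_pairs T. X z)"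
    by (simp add: case_prod_unfold prod.distrib)
  moreover have "xpow (wt T) = (\<Prod>(k, z)\<in>?E. X z) * (\<Prod>(k, z)\<in>extra_pairs T. X z)"
    unfolding PP(1) Q_def using finE disj by (rule prod.union_disjoint)
  ultimately show ?thesis unfolding ex by (simp add: mult.left_commute)
qed

end

section \<open>From columns with extra entries back to a tableau\<close>

lemma cnt_antimono: "finite G \<Longrightarrow> t \<le> u \<Longrightarrow> cnt G u \<le> cnt G t"
  unfolding cnt_def by (intro card_mono) auto

lemma cnt_le_card: "finite G \<Longrightarrow> cnt G t \<le> card G"
  unfolding cnt_def by (intro card_mono) auto

lemma cnt_strict:
  assumes "finite G" "u \<in> G" "u < v"
  shows "cnt G v < cnt G u"
  using cnt_Suc[OF assms(1), of u] cnt_antimono[OF assms(1), of "Suc u" v] assms by simp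

text \<open>On \<open>G\<close> the function \<open>cnt G\<close> is the rank counted from the
  largest element, hence a bijection onto \<open>{1..card G}\<close>; in a column it is the row
  number.\<close>

lemma ex_cnt_eq:
  assumes "finite G" "1 \<le> r" "r \<le> card G"
  shows "\<exists>u\<in>G. cnt G u = r"
proof -
  have inj: "inj_on (cnt G) G"
    by (rule linorder_inj_onI') (use cnt_strict[OF assms(1)] in \<open>metis less_irrefl\<close>)
  have "cnt G ` G \<subseteq> {1..card G}"
  proof (rule image_subsetI)
    fix u assume "u \<in> G"
    then have "1 \<le> cnt G u" using cnt_Suc[OF assms(1), of u] by simp
    then show "cnt G u \<in> {1..card G}" using cnt_le_card[OF assms(1), of u] by simp
  qed
  then have "cnt G ` G = {1..card G}"
    using card_image[OF inj] by (intro card_subset_eq) auto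
  then have "r \<in> cnt G ` G" using assms by simp
  then show ?thesis by auto
qed

context
  fixes n N :: nat and \<alpha> :: composition and C :: "nat \<Rightarrow> nat set" and Y :: "(nat \<times> nat) set"
  assumes C: "C \<in> key_fillings n N \<alpha>" and Y: "Y \<subseteq> extras n N C"
begin

lemma key_filling_fillings: "C \<in> fillings n N"
  using C by (simp add: key_fillings_def)

lemma key_filling_finite: "finite (C k)"
proof (rule finite_subset)
  show "C k \<subseteq> {1..N}" using fillings_mem(2)[OF key_filling_fillings] by (rule subsetI)
qed simp

lemma key_filling_cnt: "1 \<le> k \<Longrightarrow> cnt (C (Suc k)) t \<le> cnt (C k) t"
  using C by (simp add: key_fillings_def dominance_chain_def dominates_def)

lemma key_filling_card:
  assumes "1 \<le> k"
  shows "card (C k) = card (key_col \<alpha> k)"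
proof -
  have "dominance_chain C" "column_le (lkey C 1 k) (key_col \<alpha> k)"
    using C assms unfolding key_fillings_def by blast+
  then show ?thesis using lkey_properties[OF _ order_refl assms, of C] unfolding column_le_def by metis
qed

lemma extra_mem:
  assumes "(k, z) \<in> Y"
  shows "k \<in> {1..n}" "z \<in> {1..N}" "z \<notin> C k" "cnt (C (Suc k)) (Suc z) < cnt (C k) (Suc z)"
    "cnt (C k) (Suc z) = cnt (C k) z"
  using assms Y cnt_Suc[OF key_filling_finite, of k z] unfolding extras_def by auto

lemma rebuild_iff: "z \<in> rebuild C Y (r, k) \<longleftrightarrow> (z \<in> C k \<or> (k, z) \<in> Y) \<and> cnt (C k) z = r"
  by (simp add: rebuild_def)

lemma rebuild_mem:
  assumes "z \<in> rebuild C Y (r, k)"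
  shows "1 \<le> k" "z \<in> {1..N}" "cnt (C k) z = r" "1 \<le> r" "r \<le> card (C k)"
proof -
  have z: "z \<in> C k \<or> (k, z) \<in> Y" "cnt (C k) z = r" using assms by (auto simp: rebuild_iff)
  show "cnt (C k) z = r" by (rule z(2))
  have "k \<in> {1..n} \<and> z \<in> {1..N}"
    using z(1) fillings_mem[OF key_filling_fillings, of z k] extra_mem(1,2)[of k z] by blast
  then show "1 \<le> k" "z \<in> {1..N}" by simp_all
  show "1 \<le> r"
  proof (cases "z \<in> C k")
    case True
    then show ?thesis using z(2) cnt_Suc[OF key_filling_finite, of k z] by simp
  next
    case False
    then have "(k, z) \<in> Y" using z(1) by simp
    from extra_mem(4,5)[OF this] show ?thesis using z(2) by simp
  qed
  show "r \<le> card (C k)" using z(2) cnt_le_card[OF key_filling_finite, of k z] by simp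
qed

lemma rebuild_finite: "finite (rebuild C Y (r, k))"
proof (rule finite_subset)
  show "rebuild C Y (r, k) \<subseteq> {1..N}" using rebuild_mem(2) by (rule subsetI)
qed simp

lemma Max_rebuild:
  assumes "u \<in> C k" "cnt (C k) u = r"
  shows "Max (rebuild C Y (r, k)) = u"
proof (rule Max_eqI)
  show "u \<in> rebuild C Y (r, k)" using assms by (simp add: rebuild_iff)
  fix z assume z: "z \<in> rebuild C Y (r, k)"
  show "z \<le> u"
  proof (rule ccontr)
    assume "\<not> z \<le> u"
    then show False using cnt_strict[OF key_filling_finite assms(1), of z] rebuild_mem(3)[OF z] assms(2) by simp
  qed
qed (rule rebuild_finite)

lemma rebuild_row_lead:
  assumes "1 \<le> r" "r \<le> card (C k)"
  obtains u where "u \<in> C k" "cnt (C k) u = r" "Max (rebuild C Y (r, k)) = u" "u \<in> rebuild C Y (r, k)"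
proof -
  obtain u where u: "u \<in> C k" "cnt (C k) u = r" using ex_cnt_eq[OF key_filling_finite assms] by blast
  show thesis by (rule that[OF u Max_rebuild[OF u]]) (use u in \<open>simp add: rebuild_iff\<close>)
qed

text \<open>If \<open>z < w\<close> for \<open>w\<close> to the right of \<open>z\<close> in row
  \<open>r\<close>, then column \<open>k + 1\<close> has at least \<open>r\<close> entries above
  \<open>z\<close>. This contradicts dominance if \<open>z\<close> is leading, and the inequality
  that defines \<open>extras\<close> if it is not. The column condition holds because counts
  decrease as the threshold grows.\<close>

lemma rebuild_RSVT: "rebuild C Y \<in> RSVT (sort_comp \<alpha>)"
proof -
  have box: "(r, k) \<in> boxes (sort_comp \<alpha>) \<longleftrightarrow> 1 \<le> r \<and> 1 \<le> k \<and> r \<le> card (C k)" for r k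
    using boxes_sort_comp_iff[of r k \<alpha>] key_filling_card[of k] by (cases "1 \<le> k") auto
  have ne: "rebuild C Y (r, k) \<noteq> {}" if "(r, k) \<in> boxes (sort_comp \<alpha>)" for r k
    using that rebuild_row_lead[of r k] unfolding box by blast
  have row: "w \<le> z" if z: "z \<in> rebuild C Y (r, k)" and w: "w \<in> rebuild C Y (r, Suc k)" for z w r k
  proof (rule ccontr)
    assume "\<not> w \<le> z"
    then have zw: "Suc z \<le> w" by simp
    have k: "1 \<le> k" by (rule rebuild_mem(1)[OF z])
    have w': "r \<le> cnt (C (Suc k)) (Suc z)"
      using cnt_antimono[OF key_filling_finite zw, of "Suc k"] rebuild_mem(3)[OF w] by simp
    show False
    proof (cases "z \<in> C k")
      case True
      then have "cnt (C k) (Suc z) < r"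
        using cnt_strict[OF key_filling_finite True, of "Suc z"] rebuild_mem(3)[OF z] by simp
      then show False using w' key_filling_cnt[OF k, of "Suc z"] by simp
    next
      case False
      then have "(k, z) \<in> Y" using z by (simp add: rebuild_iff)
      from extra_mem(4,5)[OF this] show False using w' rebuild_mem(3)[OF z] by simp
    qed
  qed
  have col: "w < z" if z: "z \<in> rebuild C Y (r, k)" and w: "w \<in> rebuild C Y (Suc r, k)" for z w r k
  proof (rule ccontr)
    assume "\<not> w < z"
    then show False
      using cnt_antimono[OF key_filling_finite, of z w k] rebuild_mem(3)[OF z] rebuild_mem(3)[OF w] by simp
  qed
  show ?thesis
    unfolding RSVT_def
  proof (intro CollectI conjI allI ballI impI)
    fix s assume s: "s \<in> boxes (sort_comp \<alpha>)"
    obtain r k where rk: "s = (r, k)" by (cases s)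
    show "finite (rebuild C Y s)" "rebuild C Y s \<noteq> {}" using s ne rebuild_finite unfolding rk by auto
    show "1 \<le> i" if "i \<in> rebuild C Y s" for i using rebuild_mem(2)[of i r k] that unfolding rk by simp
  next
    fix s assume s: "s \<notin> boxes (sort_comp \<alpha>)"
    obtain r k where rk: "s = (r, k)" by (cases s)
    show "rebuild C Y s = {}" using s rebuild_mem(1,4,5)[of _ r k] unfolding rk box by blast
  next
    fix r k assume "(r, k) \<in> boxes (sort_comp \<alpha>) \<and> (r, Suc k) \<in> boxes (sort_comp \<alpha>)"
    then show "Max (rebuild C Y (r, Suc k)) \<le> Min (rebuild C Y (r, k))"
      using ne rebuild_finite by (intro row[of _ r k] Min_in Max_in) auto
  next
    fix r k assume "(r, k) \<in> boxes (sort_comp \<alpha>) \<and> (Suc r, k) \<in> boxes (sort_comp \<alpha>)"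
    then show "Max (rebuild C Y (Suc r, k)) < Min (rebuild C Y (r, k))"
      using ne rebuild_finite by (intro col[of _ r k] Min_in Max_in) auto
  qed
qed

lemma column_rebuild: "column (leading (rebuild C Y)) = C"
proof (rule ext, rule set_eqI)
  fix k u
  show "u \<in> column (leading (rebuild C Y)) k \<longleftrightarrow> u \<in> C k"
    unfolding column_mem_iff[OF rebuild_RSVT]
  proof
    assume "\<exists>r. u \<in> rebuild C Y (r, k) \<and> u = Max (rebuild C Y (r, k))"
    then obtain r where r: "u \<in> rebuild C Y (r, k)" "u = Max (rebuild C Y (r, k))" by blast
    obtain v where "v \<in> C k" "Max (rebuild C Y (r, k)) = v"
      using rebuild_row_lead[OF rebuild_mem(4,5)[OF r(1)]] by blast
    then show "u \<in> C k" using r(2) by simp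
  next
    assume u: "u \<in> C k"
    then show "\<exists>r. u \<in> rebuild C Y (r, k) \<and> u = Max (rebuild C Y (r, k))"
      using Max_rebuild[OF u refl] by (intro exI[of _ "cnt (C k) u"]) (simp add: rebuild_iff)
  qed
qed

lemma extra_pairs_rebuild: "extra_pairs (rebuild C Y) = Y"
proof (rule set_eqI)
  fix p :: "nat \<times> nat"
  obtain k z where p: "p = (k, z)" by (cases p)
  show "p \<in> extra_pairs (rebuild C Y) \<longleftrightarrow> p \<in> Y"
  proof
    assume "p \<in> extra_pairs (rebuild C Y)"
    then obtain r where r: "z \<in> rebuild C Y (r, k)" "z < Max (rebuild C Y (r, k))"
      by (auto simp: p extra_pairs_def)
    then have "z \<notin> C k" using Max_rebuild[of z k r] rebuild_mem(3)[OF r(1)] by auto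
    then show "p \<in> Y" using r(1) by (simp add: p rebuild_iff)
  next
    assume "p \<in> Y"
    then have kz: "(k, z) \<in> Y" by (simp add: p)
    then have z: "z \<in> rebuild C Y (cnt (C k) z, k)" by (simp add: rebuild_iff)
    obtain u where u: "u \<in> C k" "Max (rebuild C Y (cnt (C k) z, k)) = u"
      using rebuild_row_lead[OF rebuild_mem(4,5)[OF z]] by blast
    have "z \<le> u" using Max_ge[OF rebuild_finite z] u(2) by simp
    then have "z < u" using u(1) extra_mem(3)[OF kz] by (cases "z = u") auto
    then show "p \<in> extra_pairs (rebuild C Y)" using z u(2) by (auto simp: p extra_pairs_def)
  qed
qed

end

text \<open>Strict in \<open>n\<close>, so that column \<open>n\<close> is empty, as the last site
  of the model requires.\<close>

definition bounds :: "nat \<Rightarrow> nat \<Rightarrow> composition \<Rightarrow> bool" where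
  "bounds n N \<alpha> \<longleftrightarrow> Poly_Mapping.keys \<alpha> \<subseteq> {1..N} \<and> (\<forall>i. part \<alpha> i < n)"

lemma key_col_bounds:
  assumes "bounds n N \<alpha>"
  shows "1 \<le> n" "n \<le> k \<Longrightarrow> key_col \<alpha> k = {}" "1 \<le> k \<Longrightarrow> key_col \<alpha> k \<subseteq> {1..N}"
proof -
  have lt: "part \<alpha> i < n" for i using assms by (simp add: bounds_def)
  show "1 \<le> n" using lt[of 0] by simp
  show "key_col \<alpha> k = {}" if "n \<le> k"
  proof -
    have "\<not> k \<le> part \<alpha> i" for i using lt[of i] that by simp
    then show ?thesis by (simp add: key_col_def)
  qed
  show "key_col \<alpha> k \<subseteq> {1..N}" if "1 \<le> k"
  proof
    fix i assume "i \<in> key_col \<alpha> k"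
    then have "i \<in> Poly_Mapping.keys \<alpha>" using that by (simp add: key_col_def in_keys_iff)
    then show "i \<in> {1..N}" using assms by (auto simp: bounds_def)
  qed
qed

lemma column_key_filling:
  assumes b: "bounds n N \<alpha>" and T: "T \<in> RSVT (sort_comp \<alpha>)" and le: "left_key_comp (leading T) \<le>\<^sub>k \<alpha>"
  shows "column (leading T) \<in> key_fillings n N \<alpha>" "extra_pairs T \<subseteq> extras n N (column (leading T))"
proof -
  let ?C = "column (leading T)"
  have col: "\<And>k. 1 \<le> k \<Longrightarrow> column_le (lkey ?C 1 k) (key_col \<alpha> k)"
    using le left_key_comp_le_iff[OF T] by blast
  have empty: "?C k = {}" if "k = 0 \<or> n \<le> k" for k
    using that key_col_bounds(2)[OF b, of k] column_leading[OF T, of k] by (cases "k = 0") auto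
  have sub: "?C k \<subseteq> {1..N}" for k
  proof (cases "k = 0")
    case True
    then show ?thesis using empty by simp
  next
    case False
    then have k: "1 \<le> k" by simp
    \<comment> \<open>Column \<open>k\<close> has at most as many entries above \<open>N\<close> as
      column \<open>k\<close> of the left key, and that one has none because it lies below the key
      of \<open>\<alpha>\<close>.\<close>
    have "cnt (?C k) (Suc N) \<le> cnt (lkey ?C 1 k) (Suc N)"
      using lkey_properties[OF dominance_chain_column[OF T] order_refl k] by blast
    also have "\<dots> \<le> cnt (key_col \<alpha> k) (Suc N)"
      using col[OF k] by (simp add: column_le_def)
    also have "\<dots> = 0"
    proof -
      have "key_col \<alpha> k \<inter> {Suc N..} = {}" using key_col_bounds(3)[OF b k] by fastforce
      then show ?thesis by (simp add: cnt_def)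
    qed
    finally have "?C k \<inter> {Suc N..} = {}" using finite_column[OF T, of k] by (simp add: cnt_def)
    then have "z \<le> N" if "z \<in> ?C k" for z using that by (metis IntI atLeast_iff empty_iff not_less_eq_eq)
    moreover have "1 \<le> z" if "z \<in> ?C k" for z
      using that zero_notin_column[OF T, of k] by (cases z) auto
    ultimately show ?thesis by auto
  qed
  have "?C k = {}" if "k \<notin> {1..n}" for k
    using that by (intro empty) auto
  then show "?C \<in> key_fillings n N \<alpha>"
    using sub dominance_chain_column[OF T] empty[of n] col by (simp add: key_fillings_def fillings_def)
  show "extra_pairs T \<subseteq> extras n N ?C"
  proof
    fix p assume "p \<in> extra_pairs T"
    then obtain r k z where p: "p = (k, z)" and z: "z \<in> T (r, k)" "z < Max (T (r, k))"
      by (auto simp: extra_pairs_def)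
    have m: "Max (T (r, k)) \<in> ?C k" using RSVT_Max(1)[OF T z(1)] column_mem_iff[OF T] by blast
    then have "Max (T (r, k)) \<le> N" using sub[of k] by auto
    moreover have "k \<in> {1..n}"
      using m empty[of k] by (cases "k = 0 \<or> n \<le> k") auto
    ultimately
    show "p \<in> extras n N ?C"
      using z RSVT_mem[OF T z(1)] extra_properties[OF T z] by (auto simp: p extras_def)
  qed
qed

section \<open>The weight-preserving bijection\<close>

theorem RSVT_sum_eq_state_sum:
  assumes b: "bounds n N \<alpha>"
  shows "(\<Sum>T \<in> {T \<in> RSVT (sort_comp \<alpha>). left_key_comp (leading T) \<le>\<^sub>k \<alpha>}.
      beta ^ ex (sort_comp \<alpha>) T * xpow (wt T)) = state_sum N n \<alpha>"
proof -
  let ?S = "{T \<in> RSVT (sort_comp \<alpha>). left_key_comp (leading T) \<le>\<^sub>k \<alpha>}"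
  let ?P = "Sigma (key_fillings n N \<alpha>) (\<lambda>C. Pow (extras n N C))"
  let ?w = "\<lambda>(C, Y). (\<Prod>(k, z)\<in>entries C. X z) * (\<Prod>(k, z)\<in>Y. beta * X z)"
  have "(\<Sum>T\<in>?S. beta ^ ex (sort_comp \<alpha>) T * xpow (wt T)) = sum ?w ?P"
  proof (rule sum.reindex_bij_witness[of _ "\<lambda>(C, Y). rebuild C Y" "\<lambda>T. (column (leading T), extra_pairs T)"])
    fix T assume "T \<in> ?S"
    then have T: "T \<in> RSVT (sort_comp \<alpha>)" "left_key_comp (leading T) \<le>\<^sub>k \<alpha>" by auto
    note kf = column_key_filling[OF b T]
    show "(\<lambda>(C, Y). rebuild C Y) (column (leading T), extra_pairs T) = T"
      using rebuild_column[OF T(1)] by simp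
    show "(column (leading T), extra_pairs T) \<in> ?P" using kf by simp
    have "finite (entries (column (leading T)) \<union> extra_pairs T)"
      using finite_subset[OF kf(2) finite_extras] finite_entries[of "column (leading T)" n N] kf(1)
      by (simp add: key_fillings_def)
    from weight_eq[OF T(1) this, of n beta]
    show "?w (column (leading T), extra_pairs T) = beta ^ ex (sort_comp \<alpha>) T * xpow (wt T)"
      using key_col_bounds(2)[OF b] by simp
  next
    fix p assume "p \<in> ?P"
    then obtain C Y where p: "p = (C, Y)" "C \<in> key_fillings n N \<alpha>" "Y \<subseteq> extras n N C" by auto
    show "(column (leading ((\<lambda>(C, Y). rebuild C Y) p)), extra_pairs ((\<lambda>(C, Y). rebuild C Y) p)) = p"
      using column_rebuild[OF p(2,3)] extra_pairs_rebuild[OF p(2,3)] by (simp add: p(1))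
    show "(\<lambda>(C, Y). rebuild C Y) p \<in> ?S"
      using rebuild_RSVT[OF p(2,3)] left_key_comp_le_iff[OF rebuild_RSVT[OF p(2,3)]]
        column_rebuild[OF p(2,3)] p(2) by (simp add: p(1) key_fillings_def)
  qed
  also have "\<dots> = state_sum N n \<alpha>"
    unfolding state_sum_eq[OF key_col_bounds(1)[OF b]]
    by (subst sum.Sigma) (auto simp: key_fillings_def finite_fillings finite_extras case_prod_unfold)
  finally show ?thesis .
qed

section \<open>The recursion\<close>

lemma swap_comp_is_composition:
  "1 \<le> i \<Longrightarrow> is_composition \<alpha> \<Longrightarrow> is_composition (swap_comp i \<alpha>)"
  by (simp add: is_composition_def lookup_swap_comp)

lemma bounds_swap_comp:
  assumes "1 \<le> i" "part \<alpha> (Suc i) \<noteq> 0" "bounds n N \<alpha>"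
  shows "bounds n N (swap_comp i \<alpha>)" "Suc i \<le> N"
proof -
  have "Suc i \<in> Poly_Mapping.keys \<alpha>" using assms(2) by (simp add: in_keys_iff)
  then show N: "Suc i \<le> N" using assms(3) by (auto simp: bounds_def)
  have "j \<in> {1..N}" if "part (swap_comp i \<alpha>) j \<noteq> 0" for j
  proof -
    have "swap_label i j \<in> {1..N}"
      using that assms(3) unfolding bounds_def lookup_swap_comp by (meson in_keys_iff subsetD)
    then show ?thesis using N assms(1) by (auto simp: Transposition.transpose_def split: if_splits)
  qed
  then show "bounds n N (swap_comp i \<alpha>)"
    using assms(3) by (auto simp: bounds_def lookup_swap_comp in_keys_iff)
qed

lemma lascoux_rel_eq:
  assumes "lascoux_rel \<alpha> f" "bounds n N \<alpha>"
  shows "f = state_sum N n \<alpha>"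
  using assms
proof (induction rule: lascoux_rel.induct)
  case (partition \<alpha>)
  then show ?case using state_sum_partition[of \<alpha> N n] by (simp add: bounds_def)
next
  case (ascent \<alpha> i f)
  then have b: "bounds n N (swap_comp i \<alpha>)" "Suc i \<le> N" using bounds_swap_comp[of i \<alpha> n N] by auto
  then show ?case using ascent demazure_beta_state_sum[of i \<alpha> N n] by simp
qed

text \<open>Exchanging an ascent moves the larger part to the smaller index and so lowers the sum of
  \<open>j * part \<alpha> j\<close>. The process ends at a composition without ascents, which is a
  partition.\<close>

lemma lascoux_rel_exists:
  assumes "is_composition \<alpha>" "bounds n N \<alpha>"
  shows "\<exists>f. lascoux_rel \<alpha> f"
  using assms
proof (induction "\<Sum>j\<le>N. j * part \<alpha> j" arbitrary: \<alpha> rule: less_induct)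
  case less
  show ?case
  proof (cases "is_partition \<alpha>")
    case True
    then show ?thesis by (blast intro: lascoux_rel.partition)
  next
    case False
    then obtain i where i: "1 \<le> i" "part \<alpha> i < part \<alpha> (Suc i)"
      using less.prems(1) by (auto simp: is_partition_def not_le)
    have b: "bounds n N (swap_comp i \<alpha>)" "Suc i \<le> N" using bounds_swap_comp[of i \<alpha> n N] i less.prems(2) by auto
    have split: "(\<Sum>j\<le>N. j * part \<gamma> j) =
        (\<Sum>j\<in>{..N} - {i, Suc i}. j * part \<gamma> j) + (i * part \<gamma> i + Suc i * part \<gamma> (Suc i))" for \<gamma> :: composition
      using sum.subset_diff[of "{i, Suc i}" "{..N}" "\<lambda>j. j * part \<gamma> j"] b(2) by simp
    have "(\<Sum>j\<in>{..N} - {i, Suc i}. j * part (swap_comp i \<alpha>) j) = (\<Sum>j\<in>{..N} - {i, Suc i}. j * part \<alpha> j)"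
      by (intro sum.cong refl) (simp add: lookup_swap_comp)
    then have "(\<Sum>j\<le>N. j * part (swap_comp i \<alpha>) j) < (\<Sum>j\<le>N. j * part \<alpha> j)"
      unfolding split using i(2) by (simp add: lookup_swap_comp)
    then obtain f where "lascoux_rel (swap_comp i \<alpha>) f"
      using less.hyps swap_comp_is_composition[OF i(1) less.prems(1)] b(1) by blast
    then show ?thesis using lascoux_rel.ascent[OF less.prems(1) i] by blast
  qed
qed

lemma bounds_exist:
  assumes "is_composition \<alpha>"
  obtains n N where "bounds n N \<alpha>"
proof
  show "bounds (Suc (csize \<alpha>)) (Max (insert 0 (Poly_Mapping.keys \<alpha>))) \<alpha>"
    unfolding bounds_def
  proof (intro conjI allI subsetI)
    fix i assume i: "i \<in> Poly_Mapping.keys \<alpha>"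
    then have "i \<noteq> 0" using assms unfolding is_composition_def by (metis in_keys_iff)
    then show "i \<in> {1..Max (insert 0 (Poly_Mapping.keys \<alpha>))}" using i by simp
  next
    show "part \<alpha> i < Suc (csize \<alpha>)" for i using part_le_csize[of \<alpha> i] by simp
  qed
qed

theorem theorem1p1:
  fixes \<alpha> :: composition
  assumes "is_composition \<alpha>"
  shows "lascoux \<alpha> =
    (\<Sum>T \<in> {T \<in> RSVT (sort_comp \<alpha>). left_key_comp (leading T) \<le>\<^sub>k \<alpha>}.
       beta ^ ex (sort_comp \<alpha>) T * xpow (wt T))"
proof -
  obtain n N where b: "bounds n N \<alpha>" using bounds_exist[OF assms] by blast
  obtain f where f: "lascoux_rel \<alpha> f" using lascoux_rel_exists[OF assms b] by blast
  have "lascoux \<alpha> = state_sum N n \<alpha>"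
    unfolding lascoux_def
    by (rule the_equality) (use f lascoux_rel_eq[OF _ b] in auto)
  then show ?thesis unfolding RSVT_sum_eq_state_sum[OF b] .
qed

end
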